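(* Let $L=L_K(E)$ be the Leavitt path algebra of an arbitrary graph $E$ over an arbitrary field $K$, and let $I$ be an ideal of $L$ that is an irredundant product of finitely many (not necessarily distinct) prime ideals. Then the prime ideals in the product are uniquely determined, up to the order in which they appear. That is, if $I=P_1\cdots P_m=Q_1\cdots Q_n$ ($m,n\ge1$) are two irredundant products, with all $P_i$ and $Q_j$ prime ideals of $L$, then $m=n$ and there is a permutation $\sigma$ of $\{1,\dots,m\}$ such that $P_i=Q_{\sigma(i)}$ for all $i$.
   Context: A graph $E=(E^0,E^1,r,s)$ is a directed graph: a nonempty set $E^0$ of vertices, a set $E^1$ of edges, and range and source maps $r,s:E^1\to E^0$ (no finiteness or countability assumptions). A vertex $v$ is regular if $s^{-1}(v)$ is finite and nonempty. For a field $K$, the Leavitt path algebra $L_K(E)$ is the (associative, not necessarily unital) $K$-algebra generated by $\{v\mid v\in E^0\}\cup\{e,e^*\mid e\in E^1\}$ subject to: $vw=\delta_{v,w}v$ for $v,w\in E^0$; $s(e)e=er(e)=e$ and $r(e)e^*=e^*s(e)=e^*$ for $e\in E^1$; $e^*f=\delta_{e,f}r(e)$ for $e,f\in E^1$; and $v=\sum_{e\in s^{-1}(v)}ee^*$ for every regular $v\in E^0$. "Ideal" means two-sided ideal, and the product $IJ$ of ideals is the set of finite sums of products $ab$ with $a\in I$, $b\in J$. A prime ideal is a proper ideal $P$ such that $IJ\subseteq P$ implies $I\subseteq P$ or $J\subseteq P$ for all ideals $I,J$. A product $J_1\cdots J_m$ of ideals is irredundant if either $m=1$ or $J_1\cdots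 J_m\ne J_1\cdots J_{i-1}J_{i+1}\cdots J_m$ for all $i\in\{1,\dots,m\}$. *)

theory Defs
  imports
    "HOL-Library.Poly_Mapping"
    "HOL-Combinatorics.Permutations"
    "HOL-Algebra.Ideal_Product"
    "HOL-Algebra.QuotRing"
    "HOL-Algebra.Module"
    "Graph_Theory.Digraph"
begin

section \<open>Ideals of rings that need not be unital\<close>

text \<open>
  The library's \<open>ideal\<close> and \<open>primeideal\<close> presuppose a unital (resp. commutative) ring. Apart from
  that, \<open>two_sided_ideal\<close> is \<open>ideal\<close>. The product \<open>ideal_prod\<close> makes no such assumption.
\<close>

definition two_sided_ideal :: "('a, 'b) ring_scheme \<Rightarrow> 'a set \<Rightarrow> bool" where
  "two_sided_ideal R I \<longleftrightarrow>
     additive_subgroup I R \<and>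
     (\<forall>a\<in>I. \<forall>x\<in>carrier R. x \<otimes>\<^bsub>R\<^esub> a \<in> I \<and> a \<otimes>\<^bsub>R\<^esub> x \<in> I)"

definition prime_two_sided_ideal :: "('a, 'b) ring_scheme \<Rightarrow> 'a set \<Rightarrow> bool" where
  "prime_two_sided_ideal R P \<longleftrightarrow>
     two_sided_ideal R P \<and> P \<noteq> carrier R \<and>
     (\<forall>I J. two_sided_ideal R I \<longrightarrow> two_sided_ideal R J \<longrightarrow> I \<cdot>\<^bsub>R\<^esub> J \<subseteq> P \<longrightarrow> I \<subseteq> P \<or> J \<subseteq> P)"

text \<open>
  The product of a nonempty list of ideals. The value at the empty list is a convention that
  is not used.
\<close>

fun ideal_list_prod :: "('a, 'b) ring_scheme \<Rightarrow> 'a set list \<Rightarrow> 'a set" where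
  "ideal_list_prod R [] = carrier R"
| "ideal_list_prod R [J] = J"
| "ideal_list_prod R (J # J' # Js) = J \<cdot>\<^bsub>R\<^esub> ideal_list_prod R (J' # Js)"

definition irredundant_product :: "('a, 'b) ring_scheme \<Rightarrow> 'a set list \<Rightarrow> bool" where
  "irredundant_product R Js \<longleftrightarrow>
     length Js = 1 \<or>
     (\<forall>i<length Js. ideal_list_prod R Js \<noteq> ideal_list_prod R (take i Js @ drop (Suc i) Js))"


section \<open>Free algebras and presentations\<close>

text \<open>
  The free nonunital associative algebra over the field \<open>'k\<close> on the set \<open>X\<close> has the nonempty
  words over \<open>X\<close> as its basis. The record type demands a \<open>one\<close>; it is set to the empty word,
  which is not in the carrier.
\<close>

abbreviation word :: "'x list \<Rightarrow> 'x list \<Rightarrow>\<^sub>0 'k::field" where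
  "word w \<equiv> Poly_Mapping.single w 1"

definition free_algebra :: "'x set \<Rightarrow> ('k::field, 'x list \<Rightarrow>\<^sub>0 'k) module" where
  "free_algebra X =
     \<lparr>carrier = {f. \<forall>w\<in>Poly_Mapping.keys f. w \<noteq> [] \<and> set w \<subseteq> X},
      mult = (\<lambda>f g. \<Sum>u\<in>Poly_Mapping.keys f. \<Sum>v\<in>Poly_Mapping.keys g.
        Poly_Mapping.single (u @ v) (Poly_Mapping.lookup f u * Poly_Mapping.lookup g v)),
      one = word [],
      zero = 0,
      add = (+),
      smult = (\<lambda>c. Poly_Mapping.map ((*) c))\<rparr>"

definition generated_algebra_ideal :: "('k, 'a, 'b) module_scheme \<Rightarrow> 'a set \<Rightarrow> 'a set" where
  "generated_algebra_ideal A S =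
     \<Inter>{I. two_sided_ideal A I \<and> (\<forall>c. \<forall>a\<in>I. c \<odot>\<^bsub>A\<^esub> a \<in> I) \<and> S \<subseteq> I}"

text \<open>Scalar multiplication of cosets follows the pattern of \<open>rcoset_mult\<close>.\<close>

definition quotient_algebra :: "('k, 'a) module \<Rightarrow> 'a set \<Rightarrow> ('k, 'a set) module" where
  "quotient_algebra A I =
     ring.extend (A Quot I) (module.fields (\<lambda>c C. \<Union>a\<in>C. I +>\<^bsub>A\<^esub> (c \<odot>\<^bsub>A\<^esub> a)))"

definition presented_algebra ::
    "'x set \<Rightarrow> ('x list \<Rightarrow>\<^sub>0 'k::field) set \<Rightarrow> ('k, ('x list \<Rightarrow>\<^sub>0 'k) set) module" where
  "presented_algebra X S =
     quotient_algebra (free_algebra X) (generated_algebra_ideal (free_algebra X) S)"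


section \<open>Leavitt path algebras\<close>

text \<open>
  The source and range maps are \<open>tail\<close> and \<open>head\<close>; \<open>out_arcs E v\<close> is the set of edges with
  source \<open>v\<close>. The generator \<open>Ghost e\<close> is usually written as \<open>e\<close> with a star.
\<close>

datatype ('v, 'e) lpa_gen = Vertex 'v | Edge 'e | Ghost 'e

definition regular_vertex :: "('v, 'e) pre_digraph \<Rightarrow> 'v \<Rightarrow> bool" where
  "regular_vertex E v \<longleftrightarrow> v \<in> verts E \<and> finite (out_arcs E v) \<and> out_arcs E v \<noteq> {}"

definition lpa_gens :: "('v, 'e) pre_digraph \<Rightarrow> ('v, 'e) lpa_gen set" where
  "lpa_gens E = Vertex ` verts E \<union> Edge ` arcs E \<union> Ghost ` arcs E"

text \<open>A defining relation \<open>a = b\<close> is recorded as \<open>a - b\<close>.\<close>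

definition lpa_relations ::
    "('v, 'e) pre_digraph \<Rightarrow> (('v, 'e) lpa_gen list \<Rightarrow>\<^sub>0 'k::field) set" where
  "lpa_relations E =
     {word [Vertex v, Vertex w] - (if v = w then word [Vertex v] else 0) | v w.
        v \<in> verts E \<and> w \<in> verts E}
   \<union> {word [Vertex (tail E e), Edge e] - word [Edge e] | e. e \<in> arcs E}
   \<union> {word [Edge e, Vertex (head E e)] - word [Edge e] | e. e \<in> arcs E}
   \<union> {word [Vertex (head E e), Ghost e] - word [Ghost e] | e. e \<in> arcs E}
   \<union> {word [Ghost e, Vertex (tail E e)] - word [Ghost e] | e. e \<in> arcs E}
   \<union> {word [Ghost e, Edge f] - (if e = f then word [Vertex (head E e)] else 0) | e f.
        e \<in> arcs E \<and> f \<in> arcs E}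
   \<union> {word [Vertex v] - (\<Sum>e\<in>out_arcs E v. word [Edge e, Ghost e]) | v. regular_vertex E v}"

text \<open>The field \<open>'k\<close> enters only through the type.\<close>

definition leavitt_path_algebra ::
    "('v, 'e) pre_digraph \<Rightarrow> ('k::field, (('v, 'e) lpa_gen list \<Rightarrow>\<^sub>0 'k) set) module" where
  "leavitt_path_algebra E = presented_algebra (lpa_gens E) (lpa_relations E)"

end

theory Submission
  imports Defs "HOL-Computational_Algebra.Polynomial"
begin

text \<open>
  Every homogeneous element of an ideal of a Leavitt path algebra has left and right units inside the
  ideal. Hence graded ideals absorb the ideals that they contain, and a graded prime occurs at most
  once in an irredundant product.

  Let \<open>P\<close> be a prime that is not graded, and \<open>gr P\<close> the ideal generated by its homogeneous elements.
  An element of \<open>P\<close> with the least number of components outside \<open>gr P\<close> commutes with the homogeneous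
  elements of a corner. This produces a vertex \<open>w\<close> on a cycle \<open>d\<close> without exits modulo \<open>gr P\<close>. The corner
  at \<open>w\<close> becomes the ring of Laurent polynomials in \<open>d\<close> over \<open>K\<close>, in which \<open>P\<close> is generated by a prime
  polynomial \<open>f\<close>, and the \<open>f\<close>-adic valuation recovers the multiplicity of \<open>P\<close> in a product.

  If \<open>P\<close> is properly contained in a prime \<open>Q\<close>, then \<open>P\<close> lies in the graded part of \<open>Q\<close>, so \<open>Q\<close>
  absorbs \<open>P\<close>. Therefore the factors of an irredundant product are the minimal primes over it, with
  multiplicities that the product determines.
\<close>

section \<open>Products of ideals in rings that need not be unital\<close>

text \<open>No quotient of the algebra by a graded ideal is ever formed: statements modulo
  \<open>gr P\<close> are memberships in \<open>gr P\<close>. The part of the vertices of such a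
  quotient is played by the idempotents w - (sum of f f* over a finite set of edges f leaving w),
  which make sense at every vertex, whatever the number of its edges.

  For a prime that is not graded, the obstacle is to extend the f-adic valuation from the corner at
  \<open>w\<close> to an algebra that is neither commutative nor unital. An element \<open>x\<close>
  is given value at least s when it maps L w into L f(d)^s modulo \<open>gr P\<close>.

  The claim about P properly contained in Q rests on a comparison of two cycles, one that belongs to
  P and one without exits modulo \<open>gr Q\<close>. The second turns out to have no exits modulo
  \<open>gr P\<close> either, and primeness of P connects the two, so that the vertices of both
  would lie in Q.

  The presented algebra depends on the graph and is not a type. It is embedded into the linear
  operators on the space of all words, so that the algebra can be done in a type of class
  \<open>ring_1\<close>.\<close>

locale nonunital_ring = abelian_group R for R (structure) +
  assumes m_closed: "\<lbrakk>x \<in> carrier R; y \<in> carrier R\<rbrakk> \<Longrightarrow> x \<otimes> y \<in> carrier R"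
    and m_assoc: "\<lbrakk>x \<in> carrier R; y \<in> carrier R; z \<in> carrier R\<rbrakk>
      \<Longrightarrow> (x \<otimes> y) \<otimes> z = x \<otimes> (y \<otimes> z)"
    and l_distr: "\<lbrakk>x \<in> carrier R; y \<in> carrier R; z \<in> carrier R\<rbrakk>
      \<Longrightarrow> (x \<oplus> y) \<otimes> z = x \<otimes> z \<oplus> y \<otimes> z"
    and r_distr: "\<lbrakk>x \<in> carrier R; y \<in> carrier R; z \<in> carrier R\<rbrakk>
      \<Longrightarrow> z \<otimes> (x \<oplus> y) = z \<otimes> x \<oplus> z \<otimes> y"
begin

lemma idempotent_zero:
  assumes "x \<in> carrier R" "x \<oplus> x = x"
  shows "x = \<zero>"
proof -
  have "x = (\<ominus> x \<oplus> x) \<oplus> x" using assms(1) by (simp add: l_neg)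
  also have "\<dots> = \<ominus> x \<oplus> x" using assms by (simp add: a_assoc)
  finally show ?thesis using assms(1) by (simp add: l_neg)
qed

lemma two_sided_idealD:
  assumes "two_sided_ideal R I"
  shows "I \<subseteq> carrier R" "\<zero> \<in> I"
    and "\<lbrakk>x \<in> I; y \<in> I\<rbrakk> \<Longrightarrow> x \<oplus> y \<in> I"
    and "x \<in> I \<Longrightarrow> \<ominus> x \<in> I"
    and "\<lbrakk>x \<in> carrier R; a \<in> I\<rbrakk> \<Longrightarrow> x \<otimes> a \<in> I"
    and "\<lbrakk>x \<in> carrier R; a \<in> I\<rbrakk> \<Longrightarrow> a \<otimes> x \<in> I"
proof -
  interpret additive_subgroup I R using assms by (simp add: two_sided_ideal_def)
  show "I \<subseteq> carrier R" "\<zero> \<in> I" "\<lbrakk>x \<in> I; y \<in> I\<rbrakk> \<Longrightarrow> x \<oplus> y \<in> I"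
    by auto
  show "x \<in> I \<Longrightarrow> \<ominus> x \<in> I"
    by (rule a_inv_closed)
  show "\<lbrakk>x \<in> carrier R; a \<in> I\<rbrakk> \<Longrightarrow> x \<otimes> a \<in> I" "\<lbrakk>x \<in> carrier R; a \<in> I\<rbrakk> \<Longrightarrow> a \<otimes> x \<in> I"
    using assms by (auto simp: two_sided_ideal_def)
qed

lemma two_sided_idealI:
  assumes "I \<subseteq> carrier R" "\<zero> \<in> I"
    and "\<And>x y. \<lbrakk>x \<in> I; y \<in> I\<rbrakk> \<Longrightarrow> x \<oplus> y \<in> I"
    and "\<And>x. x \<in> I \<Longrightarrow> \<ominus> x \<in> I"
    and "\<And>x a. \<lbrakk>x \<in> carrier R; a \<in> I\<rbrakk> \<Longrightarrow> x \<otimes> a \<in> I"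
    and "\<And>x a. \<lbrakk>x \<in> carrier R; a \<in> I\<rbrakk> \<Longrightarrow> a \<otimes> x \<in> I"
  shows "two_sided_ideal R I"
  unfolding two_sided_ideal_def
proof (intro conjI)
  have "subgroup I (add_monoid R)"
    by (rule group.subgroupI[OF a_group]) (use assms in \<open>auto simp: a_inv_def[symmetric]\<close>)
  then show "additive_subgroup I R"
    by (rule additive_subgroup.intro)
qed (use assms in auto)

lemma ideal_prod_subset:
  assumes I: "two_sided_ideal R I" and J: "two_sided_ideal R J"
  shows "I \<cdot> J \<subseteq> I" "I \<cdot> J \<subseteq> J"
proof -
  note ID = two_sided_idealD[OF I] and JD = two_sided_idealD[OF J]
  have "x \<in> I \<and> x \<in> J" if "x \<in> I \<cdot> J" for x
    using that
  proof induction
    case (prod i j)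
    then have "i \<in> carrier R" "j \<in> carrier R" using ID(1) JD(1) by auto
    with prod show ?case by (simp add: ID(6) JD(5))
  next
    case (sum s1 s2)
    then show ?case by (simp add: ID(3) JD(3))
  qed
  then show "I \<cdot> J \<subseteq> I" "I \<cdot> J \<subseteq> J" by auto
qed

text \<open>The inductive product is closed by construction under sums only, so zero and negatives
  must come from the factors: 0 = 0 0 and -(i j) = (-i) j.\<close>

lemma two_sided_ideal_prod:
  assumes I: "two_sided_ideal R I" and J: "two_sided_ideal R J"
  shows "two_sided_ideal R (I \<cdot> J)"
proof (rule two_sided_idealI)
  note ID = two_sided_idealD[OF I] and JD = two_sided_idealD[OF J]
  have sub: "I \<cdot> J \<subseteq> carrier R" using ideal_prod_subset(1)[OF I J] ID(1) by blast
  show "I \<cdot> J \<subseteq> carrier R" by (rule sub)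
  have z: "\<zero> \<otimes> \<zero> = \<zero>"
    by (rule idempotent_zero) (simp_all add: r_distr[symmetric] m_closed)
  show "\<zero> \<in> I \<cdot> J" using ideal_prod.prod[OF ID(2) JD(2), of R] z by simp
  show "x \<oplus> y \<in> I \<cdot> J" if "x \<in> I \<cdot> J" "y \<in> I \<cdot> J" for x y
    using that by (rule ideal_prod.sum)
  show "\<ominus> x \<in> I \<cdot> J" if "x \<in> I \<cdot> J" for x
    using that
  proof induction
    case (prod i j)
    have c: "i \<in> carrier R" "j \<in> carrier R" using prod ID(1) JD(1) by auto
    have "(\<ominus> i) \<otimes> j \<oplus> i \<otimes> j = \<zero> \<otimes> j"
      using l_distr[of "\<ominus> i" i j] c by (simp add: l_neg)
    also have "\<dots> = \<zero>"
      by (rule idempotent_zero) (simp_all add: l_distr[symmetric] m_closed c)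
    finally have "\<ominus> (i \<otimes> j) = (\<ominus> i) \<otimes> j"
      using c by (intro minus_equality m_closed a_inv_closed) auto
    then show ?case using ideal_prod.prod[OF ID(4)[OF prod(1)] prod(2), of R] by simp
  next
    case (sum s1 s2)
    then have "s1 \<in> carrier R" "s2 \<in> carrier R" using sub by auto
    then have "\<ominus> (s1 \<oplus> s2) = \<ominus> s1 \<oplus> \<ominus> s2" by (rule minus_add)
    then show ?case using ideal_prod.sum[OF sum(3,4)] by simp
  qed
  show "x \<otimes> a \<in> I \<cdot> J" if "x \<in> carrier R" "a \<in> I \<cdot> J" for x a
    using that(2)
  proof induction
    case (prod i j)
    have "i \<in> carrier R" "j \<in> carrier R" using prod ID(1) JD(1) by auto
    then have "x \<otimes> (i \<otimes> j) = (x \<otimes> i) \<otimes> j" using that(1) by (simp add: m_assoc)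
    then show ?case using ideal_prod.prod[OF ID(5)[OF that(1) prod(1)] prod(2), of R] by simp
  next
    case (sum s1 s2)
    then have "s1 \<in> carrier R" "s2 \<in> carrier R" using sub by auto
    then show ?case using ideal_prod.sum[OF sum(3,4)] that(1) by (simp add: r_distr)
  qed
  show "a \<otimes> x \<in> I \<cdot> J" if "x \<in> carrier R" "a \<in> I \<cdot> J" for x a
    using that(2)
  proof induction
    case (prod i j)
    have "i \<in> carrier R" "j \<in> carrier R" using prod ID(1) JD(1) by auto
    then have "(i \<otimes> j) \<otimes> x = i \<otimes> (j \<otimes> x)" using that(1) by (simp add: m_assoc)
    then show ?case using ideal_prod.prod[OF prod(1) JD(6)[OF that(1) prod(2)], of R] by simp
  next
    case (sum s1 s2)
    then have "s1 \<in> carrier R" "s2 \<in> carrier R" using sub by auto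
    then show ?case using ideal_prod.sum[OF sum(3,4)] that(1) by (simp add: l_distr)
  qed
qed

lemma ideal_prod_assoc:
  assumes I: "two_sided_ideal R I" and J: "two_sided_ideal R J" and K: "two_sided_ideal R K"
  shows "(I \<cdot> J) \<cdot> K = I \<cdot> (J \<cdot> K)"
proof -
  note sub = I[THEN two_sided_idealD(1)] J[THEN two_sided_idealD(1)] K[THEN two_sided_idealD(1)]
    two_sided_ideal_prod[OF I J, THEN two_sided_idealD(1)]
    two_sided_ideal_prod[OF J K, THEN two_sided_idealD(1)]
  have 1: "a \<otimes> k \<in> I \<cdot> (J \<cdot> K)" if a: "a \<in> I \<cdot> J" and k: "k \<in> K" for a k
    using a
  proof induction
    case (prod i j)
    then have "(i \<otimes> j) \<otimes> k = i \<otimes> (j \<otimes> k)"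
      using sub(1-3) k by (intro m_assoc) auto
    then show ?case
      using ideal_prod.prod[OF prod(1) ideal_prod.prod[OF prod(2) k, of R], of R] by simp
  next
    case (sum s1 s2)
    then have "(s1 \<oplus> s2) \<otimes> k = s1 \<otimes> k \<oplus> s2 \<otimes> k"
      using sub(3,4) k by (intro l_distr) auto
    then show ?case using ideal_prod.sum[OF sum(3,4)] by simp
  qed
  have 2: "i \<otimes> b \<in> (I \<cdot> J) \<cdot> K" if i: "i \<in> I" and b: "b \<in> J \<cdot> K" for i b
    using b
  proof induction
    case (prod j k)
    then have "(i \<otimes> j) \<otimes> k = i \<otimes> (j \<otimes> k)"
      using sub(1-3) i by (intro m_assoc) auto
    then show ?case
      using ideal_prod.prod[OF ideal_prod.prod[OF i prod(1), of R] prod(2), of R] by simp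
  next
    case (sum s1 s2)
    then have "i \<otimes> (s1 \<oplus> s2) = i \<otimes> s1 \<oplus> i \<otimes> s2"
      using sub(1,5) i by (intro r_distr) auto
    then show ?case using ideal_prod.sum[OF sum(3,4)] by simp
  qed
  show ?thesis
  proof
    show "(I \<cdot> J) \<cdot> K \<subseteq> I \<cdot> (J \<cdot> K)"
    proof
      fix x assume "x \<in> (I \<cdot> J) \<cdot> K"
      then show "x \<in> I \<cdot> (J \<cdot> K)"
        by induction (auto intro: 1 ideal_prod.sum)
    qed
    show "I \<cdot> (J \<cdot> K) \<subseteq> (I \<cdot> J) \<cdot> K"
    proof
      fix x assume "x \<in> I \<cdot> (J \<cdot> K)"
      then show "x \<in> (I \<cdot> J) \<cdot> K"
        by induction (auto intro: 2 ideal_prod.sum)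
    qed
  qed
qed

lemma ideal_list_prod_Cons:
  "Js \<noteq> [] \<Longrightarrow> ideal_list_prod R (J # Js) = J \<cdot> ideal_list_prod R Js"
  by (cases Js) auto

lemma two_sided_ideal_list_prod:
  assumes "Js \<noteq> []" "\<And>J. J \<in> set Js \<Longrightarrow> two_sided_ideal R J"
  shows "two_sided_ideal R (ideal_list_prod R Js)"
  using assms
proof (induction Js rule: list_nonempty_induct)
  case (cons J Js)
  then show ?case by (simp add: ideal_list_prod_Cons two_sided_ideal_prod)
qed simp

lemma ideal_list_prod_append:
  assumes "Is \<noteq> []" "Js \<noteq> []" "\<And>J. J \<in> set Is \<union> set Js \<Longrightarrow> two_sided_ideal R J"
  shows "ideal_list_prod R (Is @ Js) = ideal_list_prod R Is \<cdot> ideal_list_prod R Js"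
  using assms
proof (induction Is rule: list_nonempty_induct)
  case (cons I Is)
  then show ?case
    by (simp add: ideal_list_prod_Cons ideal_prod_assoc two_sided_ideal_list_prod)
qed (simp add: ideal_list_prod_Cons)

lemma ideal_list_prod_subset:
  assumes "\<And>J. J \<in> set Js \<Longrightarrow> two_sided_ideal R J" "P \<in> set Js"
  shows "ideal_list_prod R Js \<subseteq> P"
  using assms
proof (induction Js)
  case (Cons J Js)
  show ?case
  proof (cases "Js = []")
    case False
    then have *: "two_sided_ideal R J" "two_sided_ideal R (ideal_list_prod R Js)"
      using Cons.prems(1) by (auto intro: two_sided_ideal_list_prod)
    then show ?thesis
      using ideal_prod_subset[OF *] Cons False by (fastforce simp: ideal_list_prod_Cons)
  qed (use Cons in auto)
qed simp

lemma prime_list_prod_subset: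
  assumes "prime_two_sided_ideal R P" "Js \<noteq> []" "\<And>J. J \<in> set Js \<Longrightarrow> two_sided_ideal R J"
    and "ideal_list_prod R Js \<subseteq> P"
  shows "\<exists>J\<in>set Js. J \<subseteq> P"
  using assms(2-)
proof (induction Js rule: list_nonempty_induct)
  case (cons J Js)
  have "two_sided_ideal R (ideal_list_prod R Js)" "two_sided_ideal R J"
    using cons by (auto intro: two_sided_ideal_list_prod)
  then have "J \<subseteq> P \<or> ideal_list_prod R Js \<subseteq> P"
    using assms(1) cons(1,4) by (simp add: prime_two_sided_ideal_def ideal_list_prod_Cons)
  then show ?case using cons by auto
qed simp

text \<open>The units may depend on \<open>x\<close>. This suffices for products of ideals, because
  the single product x u = x already exhibits \<open>x\<close> as an element of the product with
  \<open>Q\<close>.\<close>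

definition absorbs :: "'a set \<Rightarrow> 'a set \<Rightarrow> bool" where
  "absorbs Q P \<longleftrightarrow> (\<forall>x\<in>P. (\<exists>u\<in>Q. x \<otimes> u = x) \<and> (\<exists>u\<in>Q. u \<otimes> x = x))"

text \<open>An absorbing factor \<open>Q\<close> can be deleted. The factors on the side of
  \<open>Q\<close> where \<open>P\<close> stands multiply to an ideal A inside \<open>P\<close>, and
  the units in \<open>Q\<close> give A Q = A or Q A = A.\<close>

lemma irredundant_not_absorbs:
  assumes irr: "irredundant_product R Js" and ideals: "\<And>J. J \<in> set Js \<Longrightarrow> two_sided_ideal R J"
    and ij: "i < length Js" "j < length Js" "i \<noteq> j"
  shows "\<not> absorbs (Js ! j) (Js ! i)"
proof
  assume abs: "absorbs (Js ! j) (Js ! i)"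
  define P Q Xs Ys where "P = Js ! i" and "Q = Js ! j"
    and "Xs = take j Js" and "Ys = drop (Suc j) Js"
  have Js: "Js = Xs @ Q # Ys"
    using ij by (simp add: Q_def Xs_def Ys_def id_take_nth_drop)
  have Q: "two_sided_ideal R Q" and XY: "\<And>J. J \<in> set Xs \<union> set Ys \<Longrightarrow> two_sided_ideal R J"
    using ideals by (auto simp: Js)
  have "length Js \<noteq> 1" using ij by auto
  then have ne: "ideal_list_prod R Js \<noteq> ideal_list_prod R (Xs @ Ys)"
    using irr ij by (auto simp: irredundant_product_def Xs_def Ys_def)
  have absorb_right: "A \<cdot> Q = A" if A: "two_sided_ideal R A" "A \<subseteq> P" for A
  proof
    show "A \<cdot> Q \<subseteq> A" by (rule ideal_prod_subset(1)[OF A(1) Q])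
    show "A \<subseteq> A \<cdot> Q"
    proof
      fix x assume x: "x \<in> A"
      then obtain u where "u \<in> Q" "x \<otimes> u = x"
        using abs A(2) by (auto simp: absorbs_def P_def Q_def)
      then show "x \<in> A \<cdot> Q" using ideal_prod.prod[OF x, of u Q R] by simp
    qed
  qed
  have absorb_left: "Q \<cdot> A = A" if A: "two_sided_ideal R A" "A \<subseteq> P" for A
  proof
    show "Q \<cdot> A \<subseteq> A" by (rule ideal_prod_subset(2)[OF Q A(1)])
    show "A \<subseteq> Q \<cdot> A"
    proof
      fix x assume x: "x \<in> A"
      then obtain u where "u \<in> Q" "u \<otimes> x = x"
        using abs A(2) by (auto simp: absorbs_def P_def Q_def)
      then show "x \<in> Q \<cdot> A" using ideal_prod.prod[OF _ x, of u Q R] by simp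
    qed
  qed
  \<comment> \<open>The order of the two factors decides whether right units or left units are
    used.\<close>
  consider "i < j" | "j < i" using ij by linarith
  then have "ideal_list_prod R Js = ideal_list_prod R (Xs @ Ys)"
  proof cases
    case 1
    then have "P \<in> set Xs" using ij by (auto simp: Xs_def P_def in_set_conv_nth intro!: exI[of _ i])
    moreover have "Xs \<noteq> []" using \<open>P \<in> set Xs\<close> by auto
    ultimately have "ideal_list_prod R Xs \<cdot> Q = ideal_list_prod R Xs"
      using XY by (intro absorb_right two_sided_ideal_list_prod ideal_list_prod_subset) auto
    then have XQ: "ideal_list_prod R (Xs @ [Q]) = ideal_list_prod R Xs"
      using \<open>Xs \<noteq> []\<close> XY Q by (subst ideal_list_prod_append) auto
    show ?thesis
    proof (cases "Ys = []")
      case False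
      have "ideal_list_prod R ((Xs @ [Q]) @ Ys) = ideal_list_prod R (Xs @ [Q]) \<cdot> ideal_list_prod R Ys"
        using False XY Q by (intro ideal_list_prod_append) auto
      then show ?thesis using XQ Js False \<open>Xs \<noteq> []\<close> XY by (subst ideal_list_prod_append[of Xs Ys]) auto
    qed (use XQ Js in auto)
  next
    case 2
    then have "P \<in> set Ys"
      using ij by (auto simp: Ys_def P_def in_set_conv_nth intro!: exI[of _ "i - Suc j"])
    moreover have "Ys \<noteq> []" using \<open>P \<in> set Ys\<close> by auto
    ultimately have "Q \<cdot> ideal_list_prod R Ys = ideal_list_prod R Ys"
      using XY by (intro absorb_left two_sided_ideal_list_prod ideal_list_prod_subset) auto
    then have QY: "ideal_list_prod R (Q # Ys) = ideal_list_prod R Ys"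
      using \<open>Ys \<noteq> []\<close> by (simp add: ideal_list_prod_Cons)
    show ?thesis
    proof (cases "Xs = []")
      case False
      have "ideal_list_prod R (Xs @ Q # Ys) = ideal_list_prod R Xs \<cdot> ideal_list_prod R (Q # Ys)"
        using False XY Q by (intro ideal_list_prod_append) auto
      then show ?thesis using QY Js False \<open>Ys \<noteq> []\<close> XY by (subst ideal_list_prod_append[of Xs Ys]) auto
    qed (use QY Js in auto)
  qed
  then show False using ne by simp
qed

end

text \<open>
  Models the valuation of a localisation at \<open>P\<close>: \<open>N s\<close> plays the role of the elements of valuation
  at least \<open>s\<close>, and the elements of \<open>E s\<close> have valuation exactly \<open>s\<close>.
\<close>

locale ideal_valuation = nonunital_ring +
  fixes P :: "'a set" and N E :: "nat \<Rightarrow> 'a set"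
  assumes N_0: "N 0 = carrier R" and P_subset_N_1: "P \<subseteq> N 1"
    and N_Suc_subset: "N (Suc s) \<subseteq> N s"
    and N_add: "\<lbrakk>x \<in> N s; y \<in> N s\<rbrakk> \<Longrightarrow> x \<oplus> y \<in> N s"
    and N_mult: "\<lbrakk>x \<in> carrier R; y \<in> N s\<rbrakk> \<Longrightarrow> x \<otimes> y \<in> N s"
    and P_mult_N: "\<lbrakk>x \<in> P; y \<in> N s\<rbrakk> \<Longrightarrow> x \<otimes> y \<in> N (Suc s)"
    and meets_E_0: "\<lbrakk>two_sided_ideal R J; \<not> J \<subseteq> P\<rbrakk> \<Longrightarrow> \<exists>x. x \<in> J \<and> x \<in> E 0"
    and P_meets_E_1: "\<exists>x. x \<in> P \<and> x \<in> E 1"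
    and E_mult: "\<lbrakk>x \<in> E s; y \<in> E t\<rbrakk> \<Longrightarrow> x \<otimes> y \<in> E (s + t)"
    and E_disjoint: "E s \<inter> N (Suc s) = {}"
begin

text \<open>Each factor \<open>P\<close> raises the value by one and every other factor preserves
  it. The last factor is the base case, through \<open>N_0\<close> and
  \<open>P_subset_N_1\<close>.\<close>

lemma list_prod_subset_N:
  assumes "Js \<noteq> []" "\<And>J. J \<in> set Js \<Longrightarrow> two_sided_ideal R J"
  shows "ideal_list_prod R Js \<subseteq> N (count_list Js P)"
  using assms
proof (induction Js rule: list_nonempty_induct)
  case (single J)
  then show ?case
    using two_sided_idealD(1)[of J] N_0 P_subset_N_1 by auto
next
  case (cons J Js)
  have IH: "ideal_list_prod R Js \<subseteq> N (count_list Js P)" using cons by simp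
  have J: "J \<subseteq> carrier R" using cons.prems two_sided_idealD(1) by simp
  have "x \<in> N (count_list (J # Js) P)" if "x \<in> J \<cdot> ideal_list_prod R Js" for x
    using that
  proof induction
    case (prod i j)
    then have ij: "i \<in> carrier R" "j \<in> N (count_list Js P)" using IH J by auto
    show ?case
      using N_mult[OF ij] P_mult_N[OF _ ij(2), of i] prod(1) by auto
  next
    case (sum s1 s2)
    then show ?case by (intro N_add)
  qed
  then have "J \<cdot> ideal_list_prod R Js \<subseteq> N (count_list (J # Js) P)"
    by (rule subsetI)
  then show ?case by (simp only: ideal_list_prod_Cons[OF cons(1)])
qed

text \<open>The bound is attained by a product of chosen elements, of value 1 from each copy of
  \<open>P\<close> and of value 0 from the other factors. A factor strictly inside \<open>P\<close>
  must be excluded, as all its elements have value at least 1.\<close>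

lemma list_prod_meets_E:
  assumes "Js \<noteq> []" "\<And>J. J \<in> set Js \<Longrightarrow> two_sided_ideal R J"
    and "\<And>J. \<lbrakk>J \<in> set Js; J \<subseteq> P\<rbrakk> \<Longrightarrow> J = P"
  shows "\<exists>x. x \<in> ideal_list_prod R Js \<and> x \<in> E (count_list Js P)"
  using assms
proof (induction Js rule: list_nonempty_induct)
  case (single J)
  then show ?case
    using meets_E_0[of J] P_meets_E_1 by (cases "J = P") auto
next
  case (cons J Js)
  have "\<exists>y. y \<in> ideal_list_prod R Js \<and> y \<in> E (count_list Js P)"
    using cons by auto
  then obtain y where y: "y \<in> ideal_list_prod R Js" "y \<in> E (count_list Js P)" by blast
  have "\<exists>x. x \<in> J \<and> x \<in> E (if J = P then 1 else 0)"
    using meets_E_0[of J] P_meets_E_1 cons.prems(1)[of J] cons.prems(2)[of J]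
    by (cases "J = P") auto
  then obtain x where x: "x \<in> J" "x \<in> E (if J = P then 1 else 0)" by blast
  have "x \<otimes> y \<in> E (count_list (J # Js) P)"
    using E_mult[OF x(2) y(2)] by (auto split: if_splits)
  moreover have "x \<otimes> y \<in> ideal_list_prod R (J # Js)"
    using ideal_prod.prod[OF x(1) y(1), of R] cons by (simp add: ideal_list_prod_Cons)
  ultimately show ?case by blast
qed

lemma N_antimono: "s \<le> t \<Longrightarrow> N t \<subseteq> N s"
proof (induction t rule: dec_induct)
  case (step n)
  then show ?case using N_Suc_subset[of n] by blast
qed simp

text \<open>The product of \<open>Js\<close> contains an element whose value is exactly its number
  of copies of \<open>P\<close>; a product with more copies of \<open>P\<close> contains no such
  element.\<close>

lemma count_list_le:
  assumes "Is \<noteq> []" "\<And>J. J \<in> set Is \<Longrightarrow> two_sided_ideal R J"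
    and "Js \<noteq> []" "\<And>J. J \<in> set Js \<Longrightarrow> two_sided_ideal R J"
    and "\<And>J. \<lbrakk>J \<in> set Js; J \<subseteq> P\<rbrakk> \<Longrightarrow> J = P"
    and "ideal_list_prod R Is = ideal_list_prod R Js"
  shows "count_list Is P \<le> count_list Js P"
proof (rule ccontr)
  assume "\<not> ?thesis"
  then have "N (count_list Is P) \<subseteq> N (Suc (count_list Js P))"
    by (intro N_antimono) simp
  then have "ideal_list_prod R Js \<subseteq> N (Suc (count_list Js P))"
    using list_prod_subset_N[OF assms(1,2)] assms(6) by auto
  then show False
    using list_prod_meets_E[OF assms(3-5)] E_disjoint[of "count_list Js P"] by blast
qed

end

section \<open>Uniqueness of irredundant products from absorption and valuations\<close>

context nonunital_ring
begin

text \<open>The algebra enters through \<open>chain\<close> and \<open>val\<close> only. With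
  \<open>chain\<close>, irredundancy makes the factors pairwise incomparable, so both lists have the
  same set of factors; \<open>val\<close> then settles the multiplicity of each factor.\<close>

theorem irredundant_prime_products_unique:
  assumes chain: "\<And>P Q. \<lbrakk>prime_two_sided_ideal R P; prime_two_sided_ideal R Q; P \<subset> Q\<rbrakk> \<Longrightarrow> absorbs Q P"
    and val: "\<And>P. prime_two_sided_ideal R P \<Longrightarrow> absorbs P P \<or> (\<exists>N E. ideal_valuation R P N E)"
    and Ps: "Ps \<noteq> []" "\<forall>P\<in>set Ps. prime_two_sided_ideal R P" "irredundant_product R Ps"
    and Qs: "Qs \<noteq> []" "\<forall>Q\<in>set Qs. prime_two_sided_ideal R Q" "irredundant_product R Qs"
    and eq: "ideal_list_prod R Ps = ideal_list_prod R Qs"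
  shows "mset Ps = mset Qs"
proof -
  have pI: "two_sided_ideal R P" if "prime_two_sided_ideal R P" for P
    using that by (simp add: prime_two_sided_ideal_def)
  \<comment> \<open>For a factor \<open>P'\<close> strictly inside \<open>P\<close>,
    \<open>chain\<close> provides units in \<open>P\<close>, and \<open>P\<close> could be
    deleted.\<close>
  have min: "P' = P"
    if Js: "\<forall>P\<in>set Js. prime_two_sided_ideal R P" "irredundant_product R Js"
      and P: "P \<in> set Js" "P' \<in> set Js" "P' \<subseteq> P" for Js P P'
  proof (rule ccontr)
    assume ne: "P' \<noteq> P"
    obtain i j where "i < length Js" "P' = Js ! i" "j < length Js" "P = Js ! j"
      using P(1,2) by (metis in_set_conv_nth)
    then have "\<not> absorbs P P'"
      using irredundant_not_absorbs[of Js i j] Js pI ne by auto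
    then show False using chain[of P' P] Js P ne by blast
  qed
  \<comment> \<open>Primeness leads from \<open>P\<close> down to a factor \<open>Q\<close> of the
    other list, and from \<open>Q\<close> down to a factor \<open>P'\<close> of the first list.
    Incomparability gives \<open>P' = P\<close>, so \<open>Q\<close> is squeezed in between.\<close>
  have sub: "set Is \<subseteq> set Js"
    if Is: "Is \<noteq> []" "\<forall>P\<in>set Is. prime_two_sided_ideal R P" "irredundant_product R Is"
      and Js: "Js \<noteq> []" "\<forall>P\<in>set Js. prime_two_sided_ideal R P"
      and prod: "ideal_list_prod R Is = ideal_list_prod R Js" for Is Js
  proof
    fix P assume P: "P \<in> set Is"
    then have "ideal_list_prod R Js \<subseteq> P"
      using ideal_list_prod_subset[of Is P] Is prod pI by auto
    then obtain Q where Q: "Q \<in> set Js" "Q \<subseteq> P"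
      using prime_list_prod_subset[of P Js] Is Js pI P by auto
    have "ideal_list_prod R Is \<subseteq> Q"
      using ideal_list_prod_subset[of Js Q] Js prod pI Q by auto
    then obtain P' where P': "P' \<in> set Is" "P' \<subseteq> Q"
      using prime_list_prod_subset[of Q Is] Is Js pI Q by auto
    then have "P' = P" using min[OF Is(2,3) P] Q by blast
    then show "P \<in> set Js" using Q P' by auto
  qed
  have set_eq: "set Ps = set Qs"
    using sub[OF Ps Qs(1,2) eq] sub[OF Qs Ps(1,2) eq[symmetric]] by blast
  have once: "count_list Js P = 1"
    if Js: "\<forall>P\<in>set Js. prime_two_sided_ideal R P" "irredundant_product R Js"
      and P: "P \<in> set Js" "absorbs P P" for Js P
  proof -
    obtain Xs Ys where XY: "Js = Xs @ P # Ys" "P \<notin> set Xs"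
      using split_list_first[OF P(1)] by blast
    have "P \<notin> set Ys"
    proof
      assume "P \<in> set Ys"
      then obtain k where "k < length Ys" "Ys ! k = P" by (auto simp: in_set_conv_nth)
      then show False
        using irredundant_not_absorbs[OF Js(2), of "length Xs" "length Xs + Suc k"] Js(1) pI P(2)
        by (simp add: XY nth_append)
    qed
    then show ?thesis using XY by (simp add: count_list_0_iff)
  qed
  have "count_list Ps P = count_list Qs P" for P
  proof (cases "P \<in> set Ps")
    case True
    then have P: "prime_two_sided_ideal R P" using Ps by simp
    show ?thesis
    proof (cases "absorbs P P")
      case True
      then show ?thesis using once[of Ps P] once[of Qs P] Ps Qs \<open>P \<in> set Ps\<close> set_eq by simp
    next
      case False
      then obtain N E where "ideal_valuation R P N E" using val[OF P] by blast
      then interpret ideal_valuation R P N E .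
      show ?thesis
      proof (rule antisym)
        show "count_list Ps P \<le> count_list Qs P"
          using True set_eq Ps Qs eq pI min[OF Qs(2,3)]
          by (intro count_list_le) auto
        show "count_list Qs P \<le> count_list Ps P"
          using True Ps Qs eq pI min[OF Ps(2,3)]
          by (intro count_list_le) auto
      qed
    qed
  next
    case False
    then show ?thesis using set_eq by (metis count_notin)
  qed
  then show ?thesis by (simp add: multiset_eq_iff count_mset)
qed

end

section \<open>Families of Leavitt type in a ring\<close>

text \<open>The ambient ring has a 1 so that the empty path can be given a value. Only relations are
  required and no independence, so the opposite ring, with \<open>ed\<close> and \<open>gh\<close>
  exchanged, is again an instance.\<close>

locale leavitt_family =
  fixes V :: "'v set" and A :: "'e set" and src rng :: "'e \<Rightarrow> 'v"
    and \<kappa> :: "'k::field \<Rightarrow> 'r::ring_1" and vx :: "'v \<Rightarrow> 'r" and ed gh :: "'e \<Rightarrow> 'r"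
  assumes src_in: "e \<in> A \<Longrightarrow> src e \<in> V" and rng_in: "e \<in> A \<Longrightarrow> rng e \<in> V"
    and \<kappa>_add: "\<kappa> (c + d) = \<kappa> c + \<kappa> d"
    and \<kappa>_mult: "\<kappa> (c * d) = \<kappa> c * \<kappa> d"
    and \<kappa>_1: "\<kappa> 1 = 1"
    and \<kappa>_commute: "x * \<kappa> c = \<kappa> c * x"
    and vx_vx: "\<lbrakk>v \<in> V; w \<in> V\<rbrakk> \<Longrightarrow> vx v * vx w = (if v = w then vx v else 0)"
    and vx_ed: "e \<in> A \<Longrightarrow> vx (src e) * ed e = ed e"
    and ed_vx: "e \<in> A \<Longrightarrow> ed e * vx (rng e) = ed e"
    and vx_gh: "e \<in> A \<Longrightarrow> vx (rng e) * gh e = gh e"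
    and gh_vx: "e \<in> A \<Longrightarrow> gh e * vx (src e) = gh e"
    and gh_ed: "\<lbrakk>e \<in> A; f \<in> A\<rbrakk> \<Longrightarrow> gh e * ed f = (if e = f then vx (rng e) else 0)"
begin

lemma \<kappa>_0: "\<kappa> 0 = 0"
  using \<kappa>_add[of 0 0] by simp

lemma \<kappa>_minus: "\<kappa> (- c) = - \<kappa> c"
  using \<kappa>_add[of c "- c"] \<kappa>_0 by (simp add: eq_neg_iff_add_eq_0 add.commute)

lemma \<kappa>_inverse: "c \<noteq> 0 \<Longrightarrow> \<kappa> (inverse c) * (\<kappa> c * x) = x"
  using \<kappa>_mult[of "inverse c" c] by (simp add: \<kappa>_1 mult.assoc[symmetric])

lemma mult_\<kappa>_left: "x * (\<kappa> c * y) = \<kappa> c * (x * y)"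
  by (metis \<kappa>_commute mult.assoc)

section \<open>Linear spans over the scalars\<close>

inductive_set lspan :: "'r set \<Rightarrow> 'r set" for B where
  zero: "0 \<in> lspan B"
| add: "\<lbrakk>b \<in> B; x \<in> lspan B\<rbrakk> \<Longrightarrow> \<kappa> c * b + x \<in> lspan B"

lemma lspan_base: "b \<in> B \<Longrightarrow> b \<in> lspan B"
  using lspan.add[of b B 0 1] by (simp add: lspan.zero \<kappa>_1)

lemma lspan_add: "x \<in> lspan B \<Longrightarrow> y \<in> lspan B \<Longrightarrow> x + y \<in> lspan B"
  by (induction rule: lspan.induct) (auto simp: add.assoc intro: lspan.add)

lemma lspan_scale: "x \<in> lspan B \<Longrightarrow> \<kappa> c * x \<in> lspan B"
proof (induction rule: lspan.induct)
  case (add b x d)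
  then show ?case
    using lspan.add[of b B "\<kappa> c * x" "c * d"] by (simp add: \<kappa>_mult mult.assoc distrib_left)
qed (simp add: lspan.zero)

lemma lspan_minus: "x \<in> lspan B \<Longrightarrow> - x \<in> lspan B"
  using lspan_scale[of x B "- 1"] by (simp add: \<kappa>_minus \<kappa>_1)

lemma lspan_diff: "x \<in> lspan B \<Longrightarrow> y \<in> lspan B \<Longrightarrow> x - y \<in> lspan B"
  using lspan_add[of x B "- y"] lspan_minus[of y B] by simp

lemma lspan_sum: "(\<And>i. i \<in> I \<Longrightarrow> f i \<in> lspan B) \<Longrightarrow> sum f I \<in> lspan B"
  by (induction I rule: infinite_finite_induct) (auto intro: lspan_add lspan.zero)

lemma lspan_subset: "B \<subseteq> lspan C \<Longrightarrow> lspan B \<subseteq> lspan C"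
proof
  fix x assume "B \<subseteq> lspan C" "x \<in> lspan B"
  then show "x \<in> lspan C"
    by (induction rule: lspan.induct[OF \<open>x \<in> lspan B\<close>])
       (auto intro: lspan.zero lspan_add lspan_scale)
qed

lemma lspan_mono: "B \<subseteq> C \<Longrightarrow> lspan B \<subseteq> lspan C"
  by (rule lspan_subset) (auto intro: lspan_base)

lemma lspan_mult_left:
  assumes "x \<in> lspan B" "\<And>b. b \<in> B \<Longrightarrow> a * b \<in> lspan C"
  shows "a * x \<in> lspan C"
  using assms
  by (induction rule: lspan.induct)
     (auto simp: distrib_left mult_\<kappa>_left intro: lspan.zero lspan_add lspan_scale)

lemma lspan_mult_right:
  assumes "x \<in> lspan B" "\<And>b. b \<in> B \<Longrightarrow> b * a \<in> lspan C"
  shows "x * a \<in> lspan C"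
  using assms
  by (induction rule: lspan.induct)
     (auto simp: distrib_right mult.assoc intro: lspan.zero lspan_add lspan_scale)

lemma lspan_eqI:
  assumes "x \<in> lspan B" "\<And>b. b \<in> B \<Longrightarrow> a * b * a' = b"
  shows "a * x * a' = x"
  using assms
  by (induction rule: lspan.induct)
     (auto simp: distrib_left distrib_right mult_\<kappa>_left mult.assoc)

text \<open>
  A product of edges that do not compose is \<open>0\<close>, so that monomials need no path predicate. The empty
  list stands for every path of length \<open>0\<close>; its value \<open>1\<close> need not lie in \<open>S\<close>.
\<close>

definition ep :: "'e list \<Rightarrow> 'r" where "ep es = prod_list (map ed es)"
definition gp :: "'e list \<Rightarrow> 'r" where "gp es = prod_list (map gh (rev es))"

lemma ep_simps [simp]:
  "ep [] = 1" "ep (e # es) = ed e * ep es" "ep (es @ fs) = ep es * ep fs"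
  by (simp_all add: ep_def)

lemma gp_simps [simp]:
  "gp [] = 1" "gp (e # es) = gp es * gh e" "gp (es @ fs) = gp fs * gp es"
  by (simp_all add: gp_def)

lemma vx_idem: "v \<in> V \<Longrightarrow> vx v * vx v = vx v"
  by (simp add: vx_vx)

lemma vx_ed': "v \<in> V \<Longrightarrow> e \<in> A \<Longrightarrow> vx v * ed e = (if src e = v then ed e else 0)"
  by (metis vx_ed vx_vx src_in mult.assoc mult_zero_left)

lemma gh_vx': "v \<in> V \<Longrightarrow> e \<in> A \<Longrightarrow> gh e * vx v = (if src e = v then gh e else 0)"
  by (metis gh_vx vx_vx src_in mult.assoc mult_zero_right)

lemma ed_vx': "v \<in> V \<Longrightarrow> e \<in> A \<Longrightarrow> ed e * vx v = (if rng e = v then ed e else 0)"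
  by (metis ed_vx vx_vx rng_in mult.assoc mult_zero_right)

lemma vx_ep: "v \<in> V \<Longrightarrow> set es \<subseteq> A \<Longrightarrow> es \<noteq> [] \<Longrightarrow> vx v * ep es = (if src (hd es) = v then ep es else 0)"
  by (cases es) (auto simp: mult.assoc[symmetric] vx_ed')

lemma ep_vx: "v \<in> V \<Longrightarrow> set es \<subseteq> A \<Longrightarrow> es \<noteq> [] \<Longrightarrow> ep es * vx v = (if rng (last es) = v then ep es else 0)"
  by (cases es rule: rev_cases) (auto simp: mult.assoc ed_vx')

lemma gp_vx: "v \<in> V \<Longrightarrow> set es \<subseteq> A \<Longrightarrow> es \<noteq> [] \<Longrightarrow> gp es * vx v = (if src (hd es) = v then gp es else 0)"
  by (cases es) (auto simp: mult.assoc gh_vx')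

text \<open>Ghost and real edges cancel from the middle outwards. The factor \<open>vx v\<close>
  supplies the end vertex of an empty path; the second alternative covers paths that do not compose
  or end elsewhere.\<close>

lemma gp_ep_same: "set es \<subseteq> A \<Longrightarrow> gp es * ep es * vx v = vx v \<or> ep es * vx v = 0" if "v \<in> V"
proof (induction es)
  case (Cons e es)
  then have IH: "gp es * ep es * vx v = vx v \<or> ep es * vx v = 0" and e: "e \<in> A" by auto
  have eq: "gp (e # es) * ep (e # es) * vx v = gp es * (gh e * ed e) * ep es * vx v"
    by (simp add: mult.assoc)
  have eq2: "ep (e # es) * vx v = ed e * (vx (rng e) * (ep es * vx v))"
    using ed_vx[OF e] by (simp add: mult.assoc[symmetric])
  have *: "vx (rng e) * (ep es * vx v) = ep es * vx v \<or> vx (rng e) * (ep es * vx v) = 0"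
    using Cons.prems e vx_ep[of "rng e" es] rng_in[OF e] that
    by (cases "es = []") (auto simp: mult.assoc[symmetric] vx_vx split: if_splits)
  show ?case
    unfolding eq eq2 using IH * gh_ed[OF e e] by (auto simp: mult.assoc)
qed simp

text \<open>\<open>gh b * ed c\<close> vanishes unless \<open>b = c\<close>, so the ghost path
  compares \<open>bs\<close> with \<open>cs\<close> edge by edge. The product
  \<open>gp bs * ep bs\<close> is left standing in the conclusion because for empty
  \<open>bs\<close> it is 1 and not a vertex.\<close>

lemma gp_ep_prefix:
  assumes "set bs \<subseteq> A" "set cs \<subseteq> A" "length bs \<le> length cs"
  shows "gp bs * ep cs = 0 \<or> (\<exists>ds. cs = bs @ ds \<and> gp bs * ep cs = gp bs * ep bs * ep ds)"
  using assms
proof (induction bs arbitrary: cs)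
  case (Cons b bs)
  then obtain c cs' where cs: "cs = c # cs'" by (cases cs) auto
  show ?case
  proof (cases "b = c")
    case True
    have b: "b \<in> A" using Cons by auto
    have "gp bs * ep cs' = 0 \<or> (\<exists>ds. cs' = bs @ ds)"
      using Cons.IH[of cs'] Cons.prems cs by auto
    moreover have "gp (b # bs) * ep cs = gp bs * (vx (rng b) * ep cs')"
      using True cs gh_ed[OF b b] by (simp add: mult.assoc) (simp add: mult.assoc[symmetric])
    moreover have "vx (rng b) * ep cs' = ep cs' \<or> vx (rng b) * ep cs' = 0 \<or> cs' = []"
      using vx_ep[of "rng b" cs'] rng_in[OF b] Cons.prems cs by fastforce
    moreover have "gp (b # bs) * ep cs = gp (b # bs) * ep (b # bs) * ep ds" if "cs' = bs @ ds" for ds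
      using that cs True by (simp add: mult.assoc)
    ultimately show ?thesis using True cs Cons.prems by auto
  next
    case False
    have "gh b * ed c = 0" using False Cons.prems cs gh_ed by auto
    then have "gp (b # bs) * ep cs = 0" using cs by (simp add: mult.assoc) (simp add: mult.assoc[symmetric])
    then show ?thesis by blast
  qed
qed simp

lemma gp_ep_diff:
  assumes "set bs \<subseteq> A" "set cs \<subseteq> A" "length bs = length cs" "bs \<noteq> cs"
  shows "gp bs * ep cs = 0"
  using gp_ep_prefix[of bs cs] assms by auto

text \<open>The index \<open>n\<close> is the degree, and \<open>N\<close> bounds the number of ghost edges.\<close>

inductive_set monomials :: "int \<Rightarrow> nat \<Rightarrow> 'r set" for n N where
  "\<lbrakk>set as \<subseteq> A; set bs \<subseteq> A; v \<in> V; int (length as) - int (length bs) = n; length bs \<le> N\<rbrakk>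
    \<Longrightarrow> ep as * vx v * gp bs \<in> monomials n N"

text \<open>That elements of two different degrees are 0 does not follow from the relations of the
  family; it is demanded later through the projections \<open>hc\<close>.\<close>

definition homog :: "int \<Rightarrow> 'r set" where "homog n = lspan (\<Union>N. monomials n N)"
definition S :: "'r set" where "S = lspan (\<Union>n N. monomials n N)"

lemma monomialsI:
  assumes "set as \<subseteq> A" "set bs \<subseteq> A" "v \<in> V" "int (length as) - int (length bs) = n"
  shows "ep as * vx v * gp bs \<in> (\<Union>N. monomials n N)"
  using monomials.intros[OF assms order_refl] by blast

lemma homogI:
  assumes "set as \<subseteq> A" "set bs \<subseteq> A" "v \<in> V" "int (length as) - int (length bs) = n"
  shows "ep as * vx v * gp bs \<in> homog n"
  unfolding homog_def using monomialsI[OF assms] by (rule lspan_base)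

lemma homog_subset_S: "homog n \<subseteq> S"
  unfolding homog_def S_def by (rule lspan_mono) auto

lemma homog_zero [simp]: "0 \<in> homog n" by (simp add: homog_def lspan.zero)
lemma homog_add: "x \<in> homog n \<Longrightarrow> y \<in> homog n \<Longrightarrow> x + y \<in> homog n"
  by (simp add: homog_def lspan_add)
lemma homog_diff: "x \<in> homog n \<Longrightarrow> y \<in> homog n \<Longrightarrow> x - y \<in> homog n"
  by (simp add: homog_def lspan_diff)
lemma homog_scale: "x \<in> homog n \<Longrightarrow> \<kappa> c * x \<in> homog n"
  by (simp add: homog_def lspan_scale)
lemma homog_sum: "(\<And>i. i \<in> I \<Longrightarrow> f i \<in> homog n) \<Longrightarrow> sum f I \<in> homog n"
  by (simp add: homog_def lspan_sum)

lemma S_zero [simp]: "0 \<in> S" by (simp add: S_def lspan.zero)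
lemma S_add: "x \<in> S \<Longrightarrow> y \<in> S \<Longrightarrow> x + y \<in> S" by (simp add: S_def lspan_add)
lemma S_diff: "x \<in> S \<Longrightarrow> y \<in> S \<Longrightarrow> x - y \<in> S" by (simp add: S_def lspan_diff)
lemma S_scale: "x \<in> S \<Longrightarrow> \<kappa> c * x \<in> S" by (simp add: S_def lspan_scale)
lemma S_induct [consumes 1, case_names zero add]:
  assumes "x \<in> S" "Q 0"
    and "\<And>n b x. \<lbrakk>b \<in> homog n; x \<in> S; Q x\<rbrakk> \<Longrightarrow> Q (b + x)"
  shows "Q x"
  using assms(1) unfolding S_def
proof (induction rule: lspan.induct)
  case (add b x c)
  then obtain n where "b \<in> (\<Union>N. monomials n N)" by blast
  then have "\<kappa> c * b \<in> homog n" by (simp add: homog_def lspan_base lspan_scale)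
  then show ?case using assms(3) add by (simp add: S_def)
qed (rule assms(2))

section \<open>Products of homogeneous elements\<close>

lemma vx_mono:
  assumes "v \<in> V" "set as \<subseteq> A" "w \<in> V"
  shows "vx v * (ep as * vx w * gp bs) = ep as * vx w * gp bs \<or> vx v * (ep as * vx w * gp bs) = 0"
  using assms vx_ep[of v as] vx_vx[of v w]
  by (cases "as = []") (auto simp: mult.assoc[symmetric])

lemma mono_vx:
  assumes "v \<in> V" "set bs \<subseteq> A" "w \<in> V"
  shows "(ep as * vx w * gp bs) * vx v = ep as * vx w * gp bs \<or> (ep as * vx w * gp bs) * vx v = 0"
  using assms gp_vx[of v bs] vx_vx[of w v]
  by (cases "bs = []") (auto simp: mult.assoc)

lemma vx_homog: assumes v: "v \<in> V" and x: "x \<in> homog n" shows "vx v * x \<in> homog n"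
  using x unfolding homog_def
proof (rule lspan_mult_left)
  fix b assume "b \<in> (\<Union>N. monomials n N)"
  then show "vx v * b \<in> lspan (\<Union>N. monomials n N)"
    by (auto elim!: monomials.cases) (use v in \<open>metis vx_mono monomialsI lspan_base lspan.zero\<close>)
qed

lemma ed_homog: assumes e: "e \<in> A" and x: "x \<in> homog n" shows "ed e * x \<in> homog (n + 1)"
  using x unfolding homog_def
proof (rule lspan_mult_left)
  fix b assume "b \<in> (\<Union>N. monomials n N)"
  then show "ed e * b \<in> lspan (\<Union>N. monomials (n + 1) N)"
    using e homogI[of "e # as" bs v "n + 1" for as bs v]
    by (auto elim!: monomials.cases simp: mult.assoc homog_def)
qed

lemma gh_homog: assumes e: "e \<in> A" and x: "x \<in> homog n" shows "gh e * x \<in> homog (n - 1)"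
  using x unfolding homog_def
proof (rule lspan_mult_left)
  fix b assume "b \<in> (\<Union>N. monomials n N)"
  then obtain as bs v where b: "b = ep as * vx v * gp bs" "set as \<subseteq> A" "set bs \<subseteq> A" "v \<in> V"
    "int (length as) - int (length bs) = n"
    by (auto elim!: monomials.cases)
  have "gh e * b \<in> homog (n - 1)"
  proof (cases as)
    case Nil
    then have "gh e * b = gh e * vx v * gp bs" using b by (simp add: mult.assoc)
    also have "\<dots> = (if src e = v then vx (rng e) * gp (bs @ [e]) else 0)"
      using gh_vx'[OF b(4) e] vx_gh[OF e] by (simp add: mult.assoc[symmetric])
    finally show ?thesis
      using homogI[of "[]" "bs @ [e]" "rng e" "n - 1"] b e Nil rng_in by auto
  next
    case (Cons f as')
    have "gh e * b = gh e * ed f * (ep as' * vx v * gp bs)" using b Cons by (simp add: mult.assoc)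
    also have "\<dots> = (if e = f then vx (rng e) * (ep as' * vx v * gp bs) else 0)"
      using gh_ed[OF e, of f] b Cons by simp
    finally show ?thesis
      using vx_homog[OF rng_in[OF e] homogI[of as' bs v "n - 1"]] b Cons by auto
  qed
  then show "gh e * b \<in> lspan (\<Union>N. monomials (n - 1) N)" by (simp add: homog_def)
qed

lemma ep_homog: "set as \<subseteq> A \<Longrightarrow> x \<in> homog n \<Longrightarrow> ep as * x \<in> homog (n + int (length as))"
proof (induction as)
  case (Cons a as)
  then show ?case using ed_homog[of a "ep as * x" "n + int (length as)"] by (simp add: mult.assoc algebra_simps)
qed simp

lemma gp_homog: "set bs \<subseteq> A \<Longrightarrow> x \<in> homog n \<Longrightarrow> gp bs * x \<in> homog (n - int (length bs))"
proof (induction bs arbitrary: x n)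
  case (Cons b bs)
  then show ?case using Cons.IH[of "gh b * x" "n - 1"] gh_homog[of b x n]
    by (simp add: mult.assoc algebra_simps)
qed simp

text \<open>A monomial acts from the left as a ghost path, then a vertex, then a path, so left
  multiplication by single generators is all that has to be known.\<close>

lemma homog_mult: assumes "x \<in> homog m" "y \<in> homog n" shows "x * y \<in> homog (m + n)"
  using assms(1) unfolding homog_def[of m] homog_def[of "m + n"]
proof (rule lspan_mult_right)
  fix b assume "b \<in> (\<Union>N. monomials m N)"
  then obtain as bs v where b: "b = ep as * vx v * gp bs" "set as \<subseteq> A" "set bs \<subseteq> A" "v \<in> V"
    "int (length as) - int (length bs) = m"
    by (auto elim!: monomials.cases)
  have "b * y = ep as * (vx v * (gp bs * y))" using b by (simp add: mult.assoc)
  also have "\<dots> \<in> homog (n - int (length bs) + int (length as))"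
    using b assms(2) by (intro ep_homog vx_homog gp_homog) auto
  finally show "b * y \<in> lspan (\<Union>N. monomials (m + n) N)"
    using b(5) by (simp add: homog_def[symmetric] algebra_simps)
qed

lemma S_mult: assumes "x \<in> S" "y \<in> S" shows "x * y \<in> S"
  using assms(1)
proof (induction rule: S_induct)
  case (add n b x)
  from assms(2) have "b * y \<in> S"
  proof (induction rule: S_induct)
    case (add m c y)
    then show ?case using homog_mult[OF \<open>b \<in> homog n\<close>, of c m] homog_subset_S
      by (auto simp: distrib_left intro: S_add)
  qed simp
  then show ?case using add by (auto simp: distrib_right intro: S_add)
qed simp

lemma vx_homog0: "v \<in> V \<Longrightarrow> vx v \<in> homog 0"
  using homogI[of "[]" "[]" v 0] by simp

lemma ed_homog1: "e \<in> A \<Longrightarrow> ed e \<in> homog 1"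
  using ed_homog[of e "vx (rng e)" 0] vx_homog0 rng_in ed_vx by simp

lemma gh_homog1: "e \<in> A \<Longrightarrow> gh e \<in> homog (- 1)"
  using gh_homog[of e "vx (src e)" 0] vx_homog0 src_in gh_vx by simp

lemma vx_S: "v \<in> V \<Longrightarrow> vx v \<in> S" using vx_homog0 homog_subset_S by blast
lemma ed_S: "e \<in> A \<Longrightarrow> ed e \<in> S" using ed_homog1 homog_subset_S by blast
lemma gh_S: "e \<in> A \<Longrightarrow> gh e \<in> S" using gh_homog1 homog_subset_S by blast

section \<open>Local units from sums of vertices\<close>

definition vsum :: "'v set \<Rightarrow> 'r" where "vsum W = (\<Sum>v\<in>W. vx v)"

lemma vsum_homog: "W \<subseteq> V \<Longrightarrow> vsum W \<in> homog 0"
  unfolding vsum_def by (rule homog_sum) (auto intro: vx_homog0)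

lemma vsum_vx: "finite W \<Longrightarrow> W \<subseteq> V \<Longrightarrow> w \<in> W \<Longrightarrow> vsum W * vx w = vx w"
  unfolding vsum_def sum_distrib_right
  by (subst sum.cong[OF refl, where h = "\<lambda>v. if v = w then vx w else 0"]) (auto simp: vx_vx subset_iff)

lemma vx_vsum: "finite W \<Longrightarrow> W \<subseteq> V \<Longrightarrow> w \<in> W \<Longrightarrow> vx w * vsum W = vx w"
  unfolding vsum_def sum_distrib_left
  by (subst sum.cong[OF refl, where h = "\<lambda>v. if v = w then vx w else 0"]) (auto simp: vx_vx subset_iff)

text \<open>The claim for all finite sets above \<open>W\<close> is what allows the units of two
  elements to be merged, and the set to be enlarged later by the sources of given edges.\<close>

lemma local_unit:
  assumes "x \<in> S"
  shows "\<exists>W. finite W \<and> W \<subseteq> V \<and>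
    (\<forall>W'. finite W' \<longrightarrow> W \<subseteq> W' \<longrightarrow> W' \<subseteq> V \<longrightarrow> vsum W' * x = x \<and> x * vsum W' = x)"
  using assms unfolding S_def
proof (induction rule: lspan.induct)
  case zero
  then show ?case by (auto intro!: exI[of _ "{}"])
next
  case (add b x c)
  obtain n where "b \<in> (\<Union>N. monomials n N)" using add by blast
  then obtain as bs v where b: "b = ep as * vx v * gp bs" "set as \<subseteq> A" "set bs \<subseteq> A" "v \<in> V"
    by (auto elim!: monomials.cases)
  obtain W where W: "finite W" "W \<subseteq> V"
    "\<forall>W'. finite W' \<longrightarrow> W \<subseteq> W' \<longrightarrow> W' \<subseteq> V \<longrightarrow> vsum W' * x = x \<and> x * vsum W' = x"
    using add by blast
  define l where "l = (if as = [] then v else src (hd as))"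
  define r where "r = (if bs = [] then v else src (hd bs))"
  have lr: "l \<in> V" "r \<in> V" unfolding l_def r_def using b src_in by (cases as; cases bs; auto)+
  have lb: "vx l * b = b"
  proof (cases "as = []")
    case True
    then show ?thesis using b vx_idem by (simp add: l_def mult.assoc[symmetric])
  next
    case False
    then have "vx l * ep as = ep as" using vx_ep[OF lr(1) b(2)] by (simp add: l_def)
    then show ?thesis using b by (simp add: mult.assoc[symmetric])
  qed
  have br: "b * vx r = b"
  proof (cases "bs = []")
    case True
    then show ?thesis using b vx_idem by (simp add: r_def mult.assoc)
  next
    case False
    then have "gp bs * vx r = gp bs" using gp_vx[OF lr(2) b(3)] by (simp add: r_def)
    then show ?thesis using b by (simp add: mult.assoc)
  qed
  show ?case
  proof (intro exI[of _ "insert l (insert r W)"] conjI allI impI)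
    fix W' assume W': "finite W'" "insert l (insert r W) \<subseteq> W'" "W' \<subseteq> V"
    have "vsum W' * b = b"
      using vsum_vx[of W' l] W' lb by (metis insert_subset mult.assoc)
    moreover have "b * vsum W' = b"
      using vx_vsum[of W' r] W' br by (metis insert_subset mult.assoc)
    moreover have "vsum W' * x = x" "x * vsum W' = x" using W W' by auto
    ultimately show "vsum W' * (\<kappa> c * b + x) = \<kappa> c * b + x" "(\<kappa> c * b + x) * vsum W' = \<kappa> c * b + x"
      by (simp_all add: distrib_left distrib_right mult_\<kappa>_left mult.assoc)
  qed (use W lr in auto)
qed

lemma local_unit_S:
  assumes "x \<in> S"
  obtains u where "u \<in> homog 0" "u * x = x" "x * u = x"
  using local_unit[OF assms] by (meson order_refl vsum_homog)

end

text \<open>In a type class the multiplication belongs to the type, so the opposite ring needs a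
  type of its own.\<close>

typedef 'a opp = "UNIV :: 'a set" morphisms unopp Opp ..

setup_lifting type_definition_opp

instantiation opp :: (ring_1) ring_1
begin

lift_definition zero_opp :: "'a opp" is 0 .
lift_definition one_opp :: "'a opp" is 1 .
lift_definition plus_opp :: "'a opp \<Rightarrow> 'a opp \<Rightarrow> 'a opp" is "(+)" .
lift_definition minus_opp :: "'a opp \<Rightarrow> 'a opp \<Rightarrow> 'a opp" is "(-)" .
lift_definition uminus_opp :: "'a opp \<Rightarrow> 'a opp" is uminus .
lift_definition times_opp :: "'a opp \<Rightarrow> 'a opp \<Rightarrow> 'a opp" is "\<lambda>x y. y * x" .

instance by standard (transfer, simp add: algebra_simps)+

end

lemma Opp_simps:
  "Opp 0 = 0" "Opp 1 = 1" "Opp (x + y) = Opp x + Opp y" "Opp (x * y) = Opp y * Opp x"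
  "Opp x = Opp y \<longleftrightarrow> x = y"
  by (simp_all add: zero_opp_def one_opp_def plus_opp.abs_eq times_opp.abs_eq Opp_inject)

context leavitt_family
begin

text \<open>Scalar multiples and negatives are consequences: c x = (c u) x for a local unit u of x,
  and c u lies in \<open>S\<close>.\<close>

definition idl :: "'r set \<Rightarrow> bool" where
  "idl I \<longleftrightarrow> I \<subseteq> S \<and> 0 \<in> I \<and> (\<forall>x\<in>I. \<forall>y\<in>I. x + y \<in> I) \<and>
    (\<forall>a\<in>S. \<forall>x\<in>I. a * x \<in> I \<and> x * a \<in> I)"

lemma idlI:
  assumes "I \<subseteq> S" "0 \<in> I" "\<And>x y. x \<in> I \<Longrightarrow> y \<in> I \<Longrightarrow> x + y \<in> I"
    "\<And>a x. a \<in> S \<Longrightarrow> x \<in> I \<Longrightarrow> a * x \<in> I" "\<And>a x. a \<in> S \<Longrightarrow> x \<in> I \<Longrightarrow> x * a \<in> I"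
  shows "idl I"
  using assms by (auto simp: idl_def)

context
  fixes I assumes I: "idl I"
begin

lemma idl_S: "x \<in> I \<Longrightarrow> x \<in> S" using I by (auto simp: idl_def)
lemma idl_0: "0 \<in> I" using I by (auto simp: idl_def)
lemma idl_add: "x \<in> I \<Longrightarrow> y \<in> I \<Longrightarrow> x + y \<in> I" using I by (auto simp: idl_def)
lemma idl_left: "a \<in> S \<Longrightarrow> x \<in> I \<Longrightarrow> a * x \<in> I" using I by (auto simp: idl_def)
lemma idl_right: "x \<in> I \<Longrightarrow> a \<in> S \<Longrightarrow> x * a \<in> I" using I by (auto simp: idl_def)

lemma idl_scale: assumes "x \<in> I" shows "\<kappa> c * x \<in> I"
proof -
  obtain u where u: "u \<in> homog 0" "u * x = x"
    using local_unit_S[OF idl_S[OF assms]] by blast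
  have "(\<kappa> c * u) * x \<in> I"
    using u assms homog_subset_S by (intro idl_left S_scale) auto
  then show ?thesis using u by (simp add: mult.assoc)
qed

lemma idl_minus: "x \<in> I \<Longrightarrow> - x \<in> I"
  using idl_scale[of x "- 1"] by (simp add: \<kappa>_minus \<kappa>_1)

lemma idl_diff: "x \<in> I \<Longrightarrow> y \<in> I \<Longrightarrow> x - y \<in> I"
  using idl_add[of x "- y"] idl_minus[of y] by simp

lemma idl_sum: "(\<And>i. i \<in> A' \<Longrightarrow> f i \<in> I) \<Longrightarrow> sum f A' \<in> I"
  by (induction A' rule: infinite_finite_induct) (auto intro: idl_add idl_0)

lemma idl_unscale: "\<kappa> c * x \<in> I \<Longrightarrow> c \<noteq> 0 \<Longrightarrow> x \<in> I"
  using idl_scale[of "\<kappa> c * x" "inverse c"] by (simp add: \<kappa>_inverse)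

lemma idl_lspan: "B \<subseteq> I \<Longrightarrow> lspan B \<subseteq> I"
proof
  fix x assume "B \<subseteq> I" "x \<in> lspan B"
  then show "x \<in> I"
    by (induction rule: lspan.induct[OF \<open>x \<in> lspan B\<close>]) (auto intro: idl_0 idl_add idl_scale)
qed

lemma idl_ep_right: "set bs \<subseteq> A \<Longrightarrow> x \<in> I \<Longrightarrow> x * ep bs \<in> I"
proof (induction bs arbitrary: x)
  case (Cons b bs)
  then show ?case using Cons.IH[of "x * ed b"] idl_right[OF _ ed_S, of x b]
    by (simp add: mult.assoc)
qed simp

lemma idl_gp_right: "set bs \<subseteq> A \<Longrightarrow> x \<in> I \<Longrightarrow> x * gp bs \<in> I"
proof (induction bs arbitrary: x)
  case (Cons b bs)
  then show ?case using Cons.IH[of x] idl_right[OF _ gh_S, of "x * gp bs" b]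
    by (simp add: mult.assoc)
qed simp

end

text \<open>Multiplication by \<open>gap F w\<close> kills exactly the part of an element that passes through \<open>F\<close>.\<close>

definition gap :: "'e set \<Rightarrow> 'v \<Rightarrow> 'r" where
  "gap F w = vx w - (\<Sum>f\<in>{f\<in>F. src f = w}. ed f * gh f)"

section \<open>Vertices with finitely many outgoing edges removed\<close>

context
  fixes F assumes F: "finite F" "F \<subseteq> A"
begin

lemma vx_gap: "v \<in> V \<Longrightarrow> w \<in> V \<Longrightarrow> vx v * gap F w = (if v = w then gap F w else 0)"
proof -
  assume vw: "v \<in> V" "w \<in> V"
  have "(\<Sum>f\<in>{f\<in>F. src f = w}. vx v * (ed f * gh f)) = (if v = w then (\<Sum>f\<in>{f\<in>F. src f = w}. ed f * gh f) else 0)"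
    using F vw by (auto simp: mult.assoc[symmetric] vx_ed' intro!: sum.cong sum.neutral)
  then show ?thesis using vw by (auto simp: gap_def right_diff_distrib sum_distrib_left vx_vx)
qed

lemma gap_vx: "v \<in> V \<Longrightarrow> w \<in> V \<Longrightarrow> gap F w * vx v = (if v = w then gap F w else 0)"
proof -
  assume vw: "v \<in> V" "w \<in> V"
  have "(\<Sum>f\<in>{f\<in>F. src f = w}. (ed f * gh f) * vx v) = (if v = w then (\<Sum>f\<in>{f\<in>F. src f = w}. ed f * gh f) else 0)"
    using F vw by (auto simp: mult.assoc gh_vx' intro!: sum.cong sum.neutral)
  then show ?thesis using vw by (auto simp: gap_def left_diff_distrib sum_distrib_right vx_vx)
qed

lemma gap_ed:
  assumes "w \<in> V" "e \<in> A"
  shows "gap F w * ed e = (if src e = w \<and> e \<notin> F then ed e else 0)"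
proof -
  have "(\<Sum>f\<in>{f\<in>F. src f = w}. (ed f * gh f) * ed e) = (\<Sum>f\<in>{f\<in>F. src f = w}. if f = e then ed e else 0)"
    using F assms by (intro sum.cong refl) (auto simp: mult.assoc gh_ed ed_vx)
  also have "\<dots> = (if src e = w \<and> e \<in> F then ed e else 0)" using F by (simp add: sum.delta)
  finally show ?thesis using assms by (auto simp: gap_def left_diff_distrib sum_distrib_right vx_ed')
qed

lemma gh_gap:
  assumes "w \<in> V" "e \<in> A"
  shows "gh e * gap F w = (if src e = w \<and> e \<notin> F then gh e else 0)"
proof -
  have "(\<Sum>f\<in>{f\<in>F. src f = w}. gh e * (ed f * gh f)) = (\<Sum>f\<in>{f\<in>F. src f = w}. if f = e then gh e else 0)"
    using F assms by (intro sum.cong refl) (auto simp: mult.assoc[symmetric] gh_ed vx_gh)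
  also have "\<dots> = (if src e = w \<and> e \<in> F then gh e else 0)" using F by (simp add: sum.delta)
  finally show ?thesis using assms by (auto simp: gap_def right_diff_distrib sum_distrib_left gh_vx')
qed

lemma gap_gap:
  assumes "w \<in> V" "w' \<in> V"
  shows "gap F w * gap F w' = (if w = w' then gap F w else 0)"
proof -
  have "gap F w * gap F w' = gap F w * vx w' - (\<Sum>f\<in>{f\<in>F. src f = w'}. (gap F w * ed f) * gh f)"
    by (simp add: gap_def[of F w'] right_diff_distrib sum_distrib_left mult.assoc)
  also have "(\<Sum>f\<in>{f\<in>F. src f = w'}. (gap F w * ed f) * gh f) = 0"
    using assms F by (intro sum.neutral) (auto simp: gap_ed)
  finally show ?thesis using assms by (simp add: gap_vx)
qed

lemma gap_homog: "w \<in> V \<Longrightarrow> gap F w \<in> homog 0"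
  unfolding gap_def
proof (intro homog_diff homog_sum)
  fix f assume "f \<in> {f\<in>F. src f = w}"
  then show "ed f * gh f \<in> homog 0"
    using homog_mult[OF ed_homog1 gh_homog1, of f f] F by auto
qed (rule vx_homog0)

text \<open>For \<open>W\<close> inside \<open>V\<close> this splits a local unit into mutually
  orthogonal idempotents, the gaps and the elements \<open>ed f * gh f\<close>.\<close>

lemma vsum_gap:
  assumes "finite W" "src ` F \<subseteq> W"
  shows "vsum W = (\<Sum>w\<in>W. gap F w) + (\<Sum>f\<in>F. ed f * gh f)"
proof -
  have "(\<Sum>w\<in>W. \<Sum>f\<in>{f\<in>F. src f = w}. ed f * gh f) = (\<Sum>f\<in>F. ed f * gh f)"
    by (rule sum.group[OF F(1) assms])
  then show ?thesis by (simp add: gap_def vsum_def sum_subtractf)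
qed

end

section \<open>Induction on the number of ghost edges\<close>

inductive_set reals_of :: "int \<Rightarrow> 'r set" for n where
  "\<lbrakk>set as \<subseteq> A; v \<in> V; int (length as) = n\<rbrakk> \<Longrightarrow> ep as * vx v \<in> reals_of n"

text \<open>A monomial either has no ghost edge or ends in one, and the terms are collected by that
  last edge. Making \<open>g\<close> vanish outside \<open>F\<close> lets a new edge join the sum
  without a case distinction.\<close>

lemma split_last_ghost:
  assumes "x \<in> lspan (monomials n N)"
  shows "\<exists>F x1 g. finite F \<and> F \<subseteq> A \<and> (N = 0 \<longrightarrow> F = {}) \<and> x1 \<in> lspan (reals_of n) \<and>
    (\<forall>f. g f \<in> lspan (monomials (n + 1) (N - 1))) \<and> (\<forall>f. f \<notin> F \<longrightarrow> g f = 0) \<and>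
    x = x1 + (\<Sum>f\<in>F. g f * gh f)"
  using assms
proof (induction rule: lspan.induct)
  case zero
  show ?case by (rule exI[of _ "{}"], rule exI[of _ 0], rule exI[of _ "\<lambda>_. 0"]) (simp add: lspan.zero)
next
  case (add b x c)
  then obtain F x1 g where IH: "finite F" "F \<subseteq> A" "N = 0 \<longrightarrow> F = {}" "x1 \<in> lspan (reals_of n)"
    "\<And>f. g f \<in> lspan (monomials (n + 1) (N - 1))" "\<And>f. f \<notin> F \<Longrightarrow> g f = 0"
    "x = x1 + (\<Sum>f\<in>F. g f * gh f)" by blast
  obtain as bs v where b: "b = ep as * vx v * gp bs" "set as \<subseteq> A" "set bs \<subseteq> A" "v \<in> V"
    "int (length as) - int (length bs) = n" "length bs \<le> N"
    using add(1) by (auto elim!: monomials.cases)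
  show ?case
  proof (cases bs)
    case Nil
    then have "b \<in> reals_of n" using b reals_of.intros[of as v n] by simp
    then have "\<kappa> c * b + x1 \<in> lspan (reals_of n)" using IH by (intro lspan.add)
    moreover have "\<kappa> c * b + x = (\<kappa> c * b + x1) + (\<Sum>f\<in>F. g f * gh f)" using IH by simp
    ultimately show ?thesis using IH by blast
  next
    case (Cons f bs')
    define b' where "b' = ep as * vx v * gp bs'"
    have "b' \<in> monomials (n + 1) (N - 1)"
      unfolding b'_def using b Cons by (intro monomials.intros) auto
    then have b': "b' \<in> lspan (monomials (n + 1) (N - 1))" by (rule lspan_base)
    have bf: "b = b' * gh f" using b Cons by (simp add: b'_def mult.assoc)
    define g' where "g' = (\<lambda>h. if h = f then g f + \<kappa> c * b' else g h)"
    have eq: "g' h * gh h = g h * gh h + (if h = f then \<kappa> c * b else 0)" for h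
      by (simp add: g'_def bf distrib_right mult.assoc)
    have "(\<Sum>h\<in>insert f F. g' h * gh h) = (\<Sum>h\<in>insert f F. g h * gh h) + \<kappa> c * b"
      unfolding eq sum.distrib using IH by (simp add: sum.delta)
    also have "(\<Sum>h\<in>insert f F. g h * gh h) = (\<Sum>h\<in>F. g h * gh h)"
      using IH by (intro sum.mono_neutral_right) auto
    finally have "\<kappa> c * b + x = x1 + (\<Sum>h\<in>insert f F. g' h * gh h)" using IH by simp
    moreover have "g' h \<in> lspan (monomials (n + 1) (N - 1))" for h
      using IH b' by (auto simp: g'_def intro: lspan_add lspan_scale)
    moreover have "finite (insert f F)" "insert f F \<subseteq> A" "N = 0 \<longrightarrow> insert f F = {}"
      "\<forall>h. h \<notin> insert f F \<longrightarrow> g' h = 0"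
      using IH b Cons by (auto simp: g'_def)
    ultimately show ?thesis using IH(4) by blast
  qed
qed

lemma reals_of_ed: "x \<in> lspan (reals_of n) \<Longrightarrow> f \<in> A \<Longrightarrow> x * ed f \<in> lspan (monomials (n + 1) N)"
proof (erule lspan_mult_right)
  fix b assume f: "f \<in> A" and "b \<in> reals_of n"
  then obtain as v where b: "b = ep as * vx v" "set as \<subseteq> A" "v \<in> V" "int (length as) = n"
    by (auto elim!: reals_of.cases)
  have "b * ed f = (if src f = v then ep (as @ [f]) * vx (rng f) * gp [] else 0)"
    using b f by (simp add: mult.assoc vx_ed' ed_vx)
  moreover have "ep (as @ [f]) * vx (rng f) * gp [] \<in> monomials (n + 1) N"
    using b f rng_in by (intro monomials.intros) auto
  ultimately show "b * ed f \<in> lspan (monomials (n + 1) N)"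
    by (auto intro: lspan_base lspan.zero)
qed

lemma monomials_vx: "x \<in> lspan (monomials n N) \<Longrightarrow> v \<in> V \<Longrightarrow> x * vx v \<in> lspan (monomials n N)"
proof (erule lspan_mult_right)
  fix b assume v: "v \<in> V" and b: "b \<in> monomials n N"
  then have "b * vx v = b \<or> b * vx v = 0" using mono_vx by (auto elim!: monomials.cases)
  with b show "b * vx v \<in> lspan (monomials n N)" by (auto intro: lspan_base lspan.zero)
qed

lemma lspan_monomials_homog: "x \<in> lspan (monomials n N) \<Longrightarrow> x \<in> homog n"
  unfolding homog_def using lspan_mono[of "monomials n N" "\<Union>N. monomials n N"] by blast

lemma homog_depth: "x \<in> homog n \<Longrightarrow> \<exists>N. x \<in> lspan (monomials n N)"
  unfolding homog_def
proof (induction rule: lspan.induct)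
  case (add b x c)
  obtain N where N: "x \<in> lspan (monomials n N)" using add by blast
  obtain M where M: "b \<in> monomials n M" using add by blast
  have mono: "monomials n N' \<subseteq> monomials n (max N M)" if "N' \<le> max N M" for N'
    using that by (auto elim!: monomials.cases intro!: monomials.intros)
  have "\<kappa> c * b + x \<in> lspan (monomials n (max N M))"
    using M N mono[of M] lspan_mono[OF mono[of N]] by (intro lspan.add) auto
  then show ?case by blast
qed (auto intro: lspan.zero)

text \<open>Right multiplication by the local unit of \<open>vsum_gap\<close> splits
  \<open>x\<close>. A gap kills all terms that end in a ghost edge of \<open>F\<close>, so only the
  real paths in \<open>x1\<close> survive there; an edge of \<open>F\<close> cancels such a ghost
  edge, so the bound \<open>N\<close> drops. For \<open>N = 0\<close> the set \<open>F\<close> is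
  empty, and this is where inductions on \<open>N\<close> stop.\<close>

lemma gap_decomposition:
  assumes "x \<in> lspan (monomials n N)"
  shows "\<exists>W F x1. finite W \<and> W \<subseteq> V \<and> finite F \<and> F \<subseteq> A \<and> (N = 0 \<longrightarrow> F = {}) \<and>
    x = (\<Sum>w\<in>W. x * gap F w) + (\<Sum>f\<in>F. x * ed f * gh f) \<and>
    x1 \<in> lspan (reals_of n) \<and> (\<forall>w\<in>W. x * gap F w = x1 * gap F w) \<and>
    (\<forall>f\<in>F. x * ed f \<in> lspan (monomials (n + 1) (N - 1)))"
proof -
  obtain F x1 g where d: "finite F" "F \<subseteq> A" "N = 0 \<longrightarrow> F = {}" "x1 \<in> lspan (reals_of n)"
    "\<And>f. g f \<in> lspan (monomials (n + 1) (N - 1))"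
    "x = x1 + (\<Sum>f\<in>F. g f * gh f)" using split_last_ghost[OF assms] by blast
  have xS: "x \<in> S" using subsetD[OF homog_subset_S lspan_monomials_homog[OF assms]] .
  obtain W0 where W0: "finite W0" "W0 \<subseteq> V"
    "\<forall>W'. finite W' \<longrightarrow> W0 \<subseteq> W' \<longrightarrow> W' \<subseteq> V \<longrightarrow> vsum W' * x = x \<and> x * vsum W' = x"
    using local_unit[OF xS] by (elim exE conjE)
  define W where "W = W0 \<union> src ` F"
  have W: "finite W" "W \<subseteq> V" "src ` F \<subseteq> W" using W0(1,2) d(1,2) src_in by (auto simp: W_def)
  have "x = x * vsum W" using W0(3)[rule_format, of W] W by (simp add: W_def)
  also have "\<dots> = (\<Sum>w\<in>W. x * gap F w) + (\<Sum>f\<in>F. x * ed f * gh f)"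
    using vsum_gap[OF d(1,2) W(1,3)] by (simp add: distrib_left sum_distrib_left mult.assoc)
  finally have 1: "x = (\<Sum>w\<in>W. x * gap F w) + (\<Sum>f\<in>F. x * ed f * gh f)" .
  have 2: "x * gap F w = x1 * gap F w" if "w \<in> W" for w
  proof -
    have "(\<Sum>f\<in>F. g f * gh f) * gap F w = 0"
      unfolding sum_distrib_right using d(1,2) W that
      by (intro sum.neutral) (auto simp: mult.assoc gh_gap[OF d(1,2)] subset_iff)
    then show ?thesis by (subst d(6)) (simp add: distrib_right)
  qed
  have 3: "x * ed f \<in> lspan (monomials (n + 1) (N - 1))" if f: "f \<in> F" for f
  proof -
    have fA: "f \<in> A" using f d(2) by auto
    have "(\<Sum>h\<in>F. g h * gh h) * ed f = (\<Sum>h\<in>F. if h = f then g f * vx (rng f) else 0)"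
      unfolding sum_distrib_right using d(1,2) f
      by (intro sum.cong) (auto simp: mult.assoc gh_ed subset_iff)
    then have "x * ed f = x1 * ed f + g f * vx (rng f)"
      using d(1) f by (subst d(6)) (simp add: distrib_right)
    then show ?thesis
      using reals_of_ed[OF d(4) fA] monomials_vx[OF d(5) rng_in[OF fA]] by (simp add: lspan_add)
  qed
  show ?thesis
    by (rule exI[of _ W], rule exI[of _ F], rule exI[of _ x1])
      (intro conjI ballI W(1,2) d(1-4) 1 2 3)
qed

text \<open>The equation with \<open>gp \<alpha>\<close> takes the place of linear independence: it
  allows every coefficient to be read off by a ghost path, and it holds once the paths of value 0 at
  \<open>w\<close> are discarded.\<close>

lemma reals_of_coeffs:
  assumes "x \<in> lspan (reals_of n)" "w \<in> V"
  shows "\<exists>\<Lambda> k. finite \<Lambda> \<and>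
    (\<forall>\<alpha>\<in>\<Lambda>. set \<alpha> \<subseteq> A \<and> int (length \<alpha>) = n \<and> k \<alpha> \<noteq> 0 \<and> gp \<alpha> * ep \<alpha> * vx w = vx w) \<and>
    x * vx w = (\<Sum>\<alpha>\<in>\<Lambda>. \<kappa> (k \<alpha>) * (ep \<alpha> * vx w))"
proof -
  have "\<exists>\<Lambda> k. finite \<Lambda> \<and> (\<forall>\<alpha>\<in>\<Lambda>. set \<alpha> \<subseteq> A \<and> int (length \<alpha>) = n) \<and> (\<forall>\<alpha>. \<alpha> \<notin> \<Lambda> \<longrightarrow> k \<alpha> = 0)
    \<and> x * vx w = (\<Sum>\<alpha>\<in>\<Lambda>. \<kappa> (k \<alpha>) * (ep \<alpha> * vx w))"
    using assms(1)
  proof (induction rule: lspan.induct)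
    case zero
    show ?case by (rule exI[of _ "{}"], rule exI[of _ "\<lambda>_. 0"]) simp
  next
    case (add b x c)
    from add.IH obtain \<Lambda> k where IH: "finite \<Lambda>" "\<forall>\<alpha>\<in>\<Lambda>. set \<alpha> \<subseteq> A \<and> int (length \<alpha>) = n"
      "\<forall>\<alpha>. \<alpha> \<notin> \<Lambda> \<longrightarrow> k \<alpha> = 0" "x * vx w = (\<Sum>\<alpha>\<in>\<Lambda>. \<kappa> (k \<alpha>) * (ep \<alpha> * vx w))"
      by (elim exE conjE)
    obtain as v where b: "b = ep as * vx v" "set as \<subseteq> A" "v \<in> V" "int (length as) = n"
      using add(1) by (auto elim!: reals_of.cases)
    show ?case
    proof (cases "v = w")
      case False
      then have "(\<kappa> c * b + x) * vx w = x * vx w"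
        using b assms(2) by (simp add: distrib_right mult.assoc vx_vx)
      then show ?thesis
        by (intro exI[of _ \<Lambda>] exI[of _ k] conjI IH(1-3)) (simp add: IH(4))
    next
      case True
      define k' where "k' = (\<lambda>\<alpha>. k \<alpha> + (if \<alpha> = as then c else 0))"
      have eq: "\<kappa> (k' \<alpha>) * (ep \<alpha> * vx w) = \<kappa> (k \<alpha>) * (ep \<alpha> * vx w) + (if \<alpha> = as then \<kappa> c * (ep as * vx w) else 0)" for \<alpha>
        by (simp add: k'_def \<kappa>_add \<kappa>_0 distrib_right)
      have "(\<Sum>\<alpha>\<in>insert as \<Lambda>. \<kappa> (k' \<alpha>) * (ep \<alpha> * vx w))
        = (\<Sum>\<alpha>\<in>insert as \<Lambda>. \<kappa> (k \<alpha>) * (ep \<alpha> * vx w)) + \<kappa> c * (ep as * vx w)"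
        unfolding eq sum.distrib using IH by (simp add: sum.delta)
      also have "(\<Sum>\<alpha>\<in>insert as \<Lambda>. \<kappa> (k \<alpha>) * (ep \<alpha> * vx w)) = (\<Sum>\<alpha>\<in>\<Lambda>. \<kappa> (k \<alpha>) * (ep \<alpha> * vx w))"
        using IH by (intro sum.mono_neutral_right) (auto simp: \<kappa>_0)
      finally have "(\<kappa> c * b + x) * vx w = (\<Sum>\<alpha>\<in>insert as \<Lambda>. \<kappa> (k' \<alpha>) * (ep \<alpha> * vx w))"
        using IH b True by (simp add: distrib_right mult.assoc vx_vx)
      moreover have "\<forall>\<alpha>. \<alpha> \<notin> insert as \<Lambda> \<longrightarrow> k' \<alpha> = 0" using IH by (simp add: k'_def)
      moreover have "finite (insert as \<Lambda>)" "\<forall>\<alpha>\<in>insert as \<Lambda>. set \<alpha> \<subseteq> A \<and> int (length \<alpha>) = n"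
        using IH(1,2) b(2,4) by auto
      ultimately show ?thesis by (intro exI[of _ "insert as \<Lambda>"] exI[of _ k'] conjI)
    qed
  qed
  then obtain \<Lambda> k where k: "finite \<Lambda>" "\<forall>\<alpha>\<in>\<Lambda>. set \<alpha> \<subseteq> A \<and> int (length \<alpha>) = n"
    "x * vx w = (\<Sum>\<alpha>\<in>\<Lambda>. \<kappa> (k \<alpha>) * (ep \<alpha> * vx w))" by (elim exE conjE)
  define \<Lambda>' where "\<Lambda>' = {\<alpha>\<in>\<Lambda>. k \<alpha> \<noteq> 0 \<and> ep \<alpha> * vx w \<noteq> 0}"
  have "x * vx w = (\<Sum>\<alpha>\<in>\<Lambda>'. \<kappa> (k \<alpha>) * (ep \<alpha> * vx w))"
    unfolding k(3) \<Lambda>'_def using k(1) by (intro sum.mono_neutral_right) (auto simp: \<kappa>_0)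
  moreover have "gp \<alpha> * ep \<alpha> * vx w = vx w" if "\<alpha> \<in> \<Lambda>'" for \<alpha>
    using gp_ep_same[OF assms(2), of \<alpha>] that k(2) by (auto simp: \<Lambda>'_def)
  moreover have "finite \<Lambda>'" "\<forall>\<alpha>\<in>\<Lambda>'. set \<alpha> \<subseteq> A \<and> int (length \<alpha>) = n \<and> k \<alpha> \<noteq> 0"
    using k(1,2) by (auto simp: \<Lambda>'_def)
  ultimately show ?thesis by (intro exI[of _ \<Lambda>'] exI[of _ k]) simp
qed

text \<open>Homogeneity is essential: among paths of one fixed length, a ghost path annihilates all
  but its own.\<close>

lemma reals_of_coeff_extract:
  assumes "finite \<Lambda>" "\<beta> \<in> \<Lambda>"
    and "\<And>\<alpha>. \<alpha> \<in> \<Lambda> \<Longrightarrow> set \<alpha> \<subseteq> A \<and> int (length \<alpha>) = n \<and> gp \<alpha> * ep \<alpha> * vx w = vx w"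
  shows "gp \<beta> * (\<Sum>\<alpha>\<in>\<Lambda>. \<kappa> (k \<alpha>) * (ep \<alpha> * vx w)) = \<kappa> (k \<beta>) * vx w"
proof -
  have "gp \<beta> * (\<kappa> (k \<alpha>) * (ep \<alpha> * vx w)) = (if \<alpha> = \<beta> then \<kappa> (k \<beta>) * vx w else 0)" if "\<alpha> \<in> \<Lambda>" for \<alpha>
  proof (cases "\<alpha> = \<beta>")
    case True
    then show ?thesis using assms(3)[OF that] by (simp add: mult_\<kappa>_left) (simp add: mult.assoc)
  next
    case False
    then have "gp \<beta> * ep \<alpha> = 0"
      using assms(3)[OF that] assms(3)[OF assms(2)] by (intro gp_ep_diff) auto
    moreover have "gp \<beta> * (\<kappa> (k \<alpha>) * (ep \<alpha> * vx w)) = \<kappa> (k \<alpha>) * ((gp \<beta> * ep \<alpha>) * vx w)"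
      by (simp add: mult_\<kappa>_left mult.assoc)
    ultimately show ?thesis using False by simp
  qed
  then show ?thesis using assms(1,2) by (simp add: sum_distrib_left cong: sum.cong)
qed

text \<open>The ghost path of any path that occurs in \<open>x1 * vx w\<close> isolates its
  coefficient, and multiplication by the inverse of that coefficient leaves the gap itself.\<close>

lemma extract_gap:
  assumes "x1 \<in> lspan (reals_of n)" "finite F" "F \<subseteq> A" "w \<in> V" "x1 * gap F w \<noteq> 0"
  shows "\<exists>a \<in> homog (- n). a * (x1 * gap F w) = gap F w"
proof -
  obtain \<Lambda> k where k: "finite \<Lambda>"
    "\<forall>\<alpha>\<in>\<Lambda>. set \<alpha> \<subseteq> A \<and> int (length \<alpha>) = n \<and> k \<alpha> \<noteq> 0 \<and> gp \<alpha> * ep \<alpha> * vx w = vx w"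
    "x1 * vx w = (\<Sum>\<alpha>\<in>\<Lambda>. \<kappa> (k \<alpha>) * (ep \<alpha> * vx w))"
    using reals_of_coeffs[OF assms(1,4)] by (elim exE conjE)
  have g: "vx w * gap F w = gap F w" using vx_gap[OF assms(2,3)] assms(4) by simp
  have "x1 * vx w \<noteq> 0" using assms(5) g by (metis mult.assoc mult_zero_left)
  then have "\<Lambda> \<noteq> {}" using k(3) by auto
  then obtain \<beta> where \<beta>: "\<beta> \<in> \<Lambda>" by blast
  have \<beta>': "set \<beta> \<subseteq> A" "int (length \<beta>) = n" "k \<beta> \<noteq> 0" using k(2) \<beta> by auto
  have "gp \<beta> * (x1 * vx w) = \<kappa> (k \<beta>) * vx w"
    unfolding k(3) by (rule reals_of_coeff_extract[OF k(1) \<beta>, of n]) (use k(2) in blast)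
  then have "gp \<beta> * (x1 * gap F w) = \<kappa> (k \<beta>) * gap F w"
    using g by (metis mult.assoc)
  then have eq: "(vx w * gp \<beta>) * (x1 * gap F w) = \<kappa> (k \<beta>) * gap F w"
    using g by (metis mult.assoc mult_\<kappa>_left)
  have "ep [] * vx w * gp \<beta> \<in> homog (- n)" using \<beta>' assms(4) by (intro homogI) auto
  then have "\<kappa> (inverse (k \<beta>)) * (vx w * gp \<beta>) \<in> homog (- n)" by (intro homog_scale) simp
  moreover have "(\<kappa> (inverse (k \<beta>)) * (vx w * gp \<beta>)) * (x1 * gap F w) = gap F w"
    using eq \<beta>'(3) by (simp only: mult.assoc \<kappa>_inverse) (metis \<kappa>_inverse mult.assoc)
  ultimately show ?thesis by blast
qed

text \<open>If some piece \<open>x * gap F w\<close> lies outside \<open>G\<close>, then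
  \<open>extract_gap\<close> finishes. Otherwise some \<open>x * ed f\<close> lies outside
  \<open>G\<close> and has fewer ghost edges. The degrees are recorded because the result has to
  land in degree 0.\<close>

lemma reduce_to_gap:
  assumes G: "idl G"
  shows "x \<in> lspan (monomials n N) \<Longrightarrow> x \<notin> G \<Longrightarrow>
    \<exists>a b i j F w. a \<in> homog i \<and> b \<in> homog j \<and> i + n + j = 0 \<and> finite F \<and> F \<subseteq> A \<and> w \<in> V \<and>
      a * x * b = gap F w \<and> gap F w \<notin> G"
proof (induction N arbitrary: n x rule: less_induct)
  case (less N)
  obtain W F x1 where d: "finite W" "W \<subseteq> V" "finite F" "F \<subseteq> A" "N = 0 \<longrightarrow> F = {}"
    and dx: "x = (\<Sum>w\<in>W. x * gap F w) + (\<Sum>f\<in>F. x * ed f * gh f)"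
    and d1: "x1 \<in> lspan (reals_of n)" "\<forall>w\<in>W. x * gap F w = x1 * gap F w"
    "\<forall>f\<in>F. x * ed f \<in> lspan (monomials (n + 1) (N - 1))"
    using gap_decomposition[OF less.prems(1)] by (elim exE conjE)
  consider w where "w \<in> W" "x * gap F w \<notin> G" | f where "f \<in> F" "x * ed f * gh f \<notin> G"
  proof (rule ccontr)
    assume *: "\<not> thesis"
    have "x \<in> G"
      by (subst dx, rule idl_add[OF G]; rule idl_sum[OF G]) (use * that in blast)+
    then show False using less.prems by simp
  qed
  then show ?case
  proof cases
    case 1
    then have "x1 * gap F w \<noteq> 0" "w \<in> V" using d d1 idl_0[OF G] by auto
    then obtain a where a: "a \<in> homog (- n)" "a * (x1 * gap F w) = gap F w"
      using extract_gap[OF d1(1) d(3,4)] by blast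
    have "gap F w \<notin> G"
    proof
      assume "gap F w \<in> G"
      moreover have "x \<in> S" using lspan_monomials_homog[OF less.prems(1)] homog_subset_S by blast
      ultimately show False using 1 idl_left[OF G] by blast
    qed
    moreover have "a * x * gap F w = gap F w" using a bspec[OF d1(2) 1(1)] by (simp add: mult.assoc)
    moreover have "gap F w \<in> homog 0" using gap_homog[OF d(3,4)] \<open>w \<in> V\<close> .
    ultimately show ?thesis using a(1) d(3,4) \<open>w \<in> V\<close>
      by (intro exI[of _ a] exI[of _ "gap F w"] exI[of _ "- n"] exI[of _ 0] exI[of _ F] exI[of _ w]) simp
  next
    case 2
    have fA: "f \<in> A" using 2 d by auto
    have "x * ed f \<notin> G" using 2 idl_right[OF G] gh_S[OF fA] by blast
    moreover have "N - 1 < N" using d(5) 2 by (cases N) auto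
    ultimately obtain a b i j F' w where ab: "a \<in> homog i" "b \<in> homog j" "i + (n + 1) + j = 0"
      "finite F'" "F' \<subseteq> A" "w \<in> V" "a * (x * ed f) * b = gap F' w" "gap F' w \<notin> G"
      using less.IH[OF _ bspec[OF d1(3) 2(1)]] by blast
    have "ed f * b \<in> homog (1 + j)" using homog_mult[OF ed_homog1[OF fA] ab(2)] .
    moreover have "a * x * (ed f * b) = gap F' w" using ab by (simp add: mult.assoc)
    moreover have "i + n + (1 + j) = 0" using ab by simp
    ultimately show ?thesis using ab by blast
  qed
qed

text \<open>The unit is assembled along the orthogonal pieces of \<open>x\<close>. A gap that does
  not kill \<open>x\<close> is a multiple of \<open>x\<close> by \<open>extract_gap\<close>, hence
  lies in \<open>I\<close>, and fixes its own piece. On the piece through \<open>f\<close>, a right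
  unit \<open>u f\<close> of \<open>x * ed f\<close>, conjugated to
  \<open>ed f * u f * gh f\<close>, does the same.\<close>

lemma right_unit_depth:
  assumes I: "idl I"
  shows "x \<in> lspan (monomials n N) \<Longrightarrow> x \<in> I \<Longrightarrow> \<exists>v \<in> I \<inter> homog 0. x * v = x"
proof (induction N arbitrary: n x rule: less_induct)
  case (less N)
  obtain W F x1 where d: "finite W" "W \<subseteq> V" "finite F" "F \<subseteq> A" "N = 0 \<longrightarrow> F = {}"
    and dx: "x = (\<Sum>w\<in>W. x * gap F w) + (\<Sum>f\<in>F. x * ed f * gh f)"
    and d1: "x1 \<in> lspan (reals_of n)" "\<forall>w\<in>W. x * gap F w = x1 * gap F w"
    "\<forall>f\<in>F. x * ed f \<in> lspan (monomials (n + 1) (N - 1))"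
    using gap_decomposition[OF less.prems(1)] by (elim exE conjE)
  have "\<forall>f\<in>F. \<exists>v. v \<in> I \<inter> homog 0 \<and> (x * ed f) * v = x * ed f"
  proof
    fix f assume f: "f \<in> F"
    have "N - 1 < N" using d(5) f by (cases N) auto
    moreover have "x * ed f \<in> I" using less.prems idl_right[OF I _ ed_S] f d by auto
    ultimately show "\<exists>v. v \<in> I \<inter> homog 0 \<and> (x * ed f) * v = x * ed f"
      using less.IH[OF _ bspec[OF d1(3) f]] by blast
  qed
  then obtain u where u: "\<And>f. f \<in> F \<Longrightarrow> u f \<in> I \<and> u f \<in> homog 0 \<and> x * ed f * u f = x * ed f"
    by (auto dest!: bchoice)
  \<comment> \<open>A gap that kills \<open>x\<close> need not lie in \<open>I\<close>, so it must
    not enter the unit.\<close>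
  define W' where "W' = {w\<in>W. x * gap F w \<noteq> 0}"
  define v where "v = (\<Sum>w\<in>W'. gap F w) + (\<Sum>f\<in>F. ed f * u f * gh f)"
  have gapI: "gap F w \<in> I" if "w \<in> W'" for w
  proof -
    have w: "w \<in> V" "w \<in> W" "x * gap F w \<noteq> 0" using that d by (auto simp: W'_def)
    then obtain a where a: "a \<in> homog (- n)" "a * (x1 * gap F w) = gap F w"
      using extract_gap[OF d1(1) d(3,4) w(1)] d1(2) w(2,3) by auto
    have "a * (x * gap F w) \<in> I"
      using less.prems a(1) homog_subset_S gap_homog[OF d(3,4) w(1)]
      by (intro idl_left[OF I] idl_right[OF I]) auto
    then show ?thesis using a bspec[OF d1(2) w(2)] by simp
  qed
  have "ed f * u f * gh f \<in> I" if "f \<in> F" for f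
    using u[OF that] that d(4) ed_S gh_S by (intro idl_right[OF I] idl_left[OF I]) auto
  then have vI: "v \<in> I" unfolding v_def
    by (intro idl_add[OF I] idl_sum[OF I] gapI) auto
  have vh: "v \<in> homog 0" unfolding v_def
  proof (intro homog_add homog_sum)
    show "gap F w \<in> homog 0" if "w \<in> W'" for w
      using gap_homog[OF d(3,4)] that d(2) by (auto simp: W'_def)
    show "ed f * u f * gh f \<in> homog 0" if "f \<in> F" for f
      using homog_mult[OF homog_mult[OF ed_homog1 conjunct1[OF conjunct2[OF u]]] gh_homog1, of f f f] that d
      by auto
  qed
  have gv: "x * gap F w * v = x * gap F w" if w: "w \<in> W" for w
  proof -
    have "gap F w * (\<Sum>f\<in>F. ed f * u f * gh f) = 0"
      unfolding sum_distrib_left using w d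
      by (intro sum.neutral) (auto simp: mult.assoc[symmetric] gap_ed[OF d(3,4)] subset_iff)
    moreover have "gap F w * (\<Sum>w\<in>W'. gap F w) = (\<Sum>w'\<in>W'. if w' = w then gap F w else 0)"
      unfolding sum_distrib_left using w d
      by (intro sum.cong) (auto simp: W'_def gap_gap[OF d(3,4)] subset_iff)
    moreover have "finite W'" using d by (simp add: W'_def)
    ultimately have "gap F w * v = (if w \<in> W' then gap F w else 0)"
      by (simp add: v_def distrib_left)
    then show ?thesis using w by (auto simp: mult.assoc W'_def)
  qed
  have fv: "x * ed f * gh f * v = x * ed f * gh f" if f: "f \<in> F" for f
  proof -
    have fA: "f \<in> A" using f d by auto
    have "gh f * (\<Sum>w\<in>W'. gap F w) = 0"
      unfolding sum_distrib_left using f fA d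
      by (intro sum.neutral) (auto simp: W'_def gh_gap[OF d(3,4)] subset_iff)
    moreover have "gh f * (\<Sum>h\<in>F. ed h * u h * gh h) = (\<Sum>h\<in>F. if h = f then vx (rng f) * u f * gh f else 0)"
      unfolding sum_distrib_left using f fA d
      by (intro sum.cong) (auto simp: mult.assoc[symmetric] gh_ed subset_iff)
    ultimately have "gh f * v = vx (rng f) * u f * gh f"
      using d f by (simp add: v_def distrib_left)
    then have "x * ed f * gh f * v = x * (ed f * vx (rng f)) * u f * gh f" by (simp add: mult.assoc)
    then show ?thesis using ed_vx[OF fA] u[OF f] by simp
  qed
  have "x * v = ((\<Sum>w\<in>W. x * gap F w) + (\<Sum>f\<in>F. x * ed f * gh f)) * v"
    by (rule arg_cong[OF dx, of "\<lambda>y. y * v"])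
  also have "\<dots> = (\<Sum>w\<in>W. x * gap F w) + (\<Sum>f\<in>F. x * ed f * gh f)"
    unfolding distrib_right sum_distrib_right by (simp add: gv fv cong: sum.cong)
  also have "\<dots> = x" by (rule dx[symmetric])
  finally show ?case using vI vh by blast
qed

lemma right_unit_homog:
  assumes "idl I" "x \<in> I" "x \<in> homog n"
  shows "\<exists>v \<in> I \<inter> homog 0. x * v = x"
  using homog_depth[OF assms(3)] right_unit_depth[OF assms(1) _ assms(2)] by blast

text \<open>
  Left units are right units of the opposite family, in which \<open>ed\<close> and \<open>gh\<close> are exchanged.
\<close>

lemma left_unit_homog:
  assumes I: "idl I" and x: "x \<in> I" "x \<in> homog n"
  shows "\<exists>v \<in> I \<inter> homog 0. v * x = x"
proof -
  interpret op: leavitt_family V A src rng "\<lambda>c. Opp (\<kappa> c)" "\<lambda>v. Opp (vx v)" "\<lambda>e. Opp (gh e)" "\<lambda>e. Opp (ed e)"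
  proof
    show "x * Opp (\<kappa> c) = Opp (\<kappa> c) * x" for x c
      by (cases x) (simp add: Opp_simps(4)[symmetric] \<kappa>_commute)
    show "Opp (\<kappa> (c * d)) = Opp (\<kappa> c) * Opp (\<kappa> d)" for c d
      by (simp add: Opp_simps(4)[symmetric] \<kappa>_mult[symmetric] mult.commute)
  qed (simp_all add: Opp_simps(4)[symmetric] Opp_simps(1,2,3) src_in rng_in \<kappa>_add \<kappa>_1
      vx_vx vx_ed ed_vx gh_vx vx_gh gh_ed)
  have ep: "op.ep es = Opp (gp es)" and gp: "op.gp es = Opp (ep es)" for es
    by (induction es) (simp_all add: Opp_simps)
  \<comment> \<open>Exchanging edges and ghost edges negates the degree. A unit of degree 0 in the
    opposite family therefore comes back in degree 0.\<close>
  have h: "Opp y \<in> op.homog (- m)" if "y \<in> homog m" for y m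
    using that unfolding homog_def
  proof (induction rule: lspan.induct)
    case (add b y c)
    then obtain as bs v where b: "b = ep as * vx v * gp bs" "set as \<subseteq> A" "set bs \<subseteq> A" "v \<in> V"
      "int (length as) - int (length bs) = m"
      by (auto elim!: monomials.cases)
    have "Opp b = op.ep bs * Opp (vx v) * op.gp as"
      by (simp add: b ep gp Opp_simps mult.assoc)
    also have "\<dots> \<in> op.homog (- m)" using b by (intro op.homogI) auto
    finally show ?case using add.IH
      by (simp add: Opp_simps op.homog_add op.homog_scale op.\<kappa>_commute)
  qed (simp add: Opp_simps)
  have h': "y \<in> homog (- m)" if "Opp y \<in> op.homog m" for y m
  proof -
    have "unopp z \<in> homog (- m)" if "z \<in> op.homog m" for z
      using that unfolding op.homog_def
    proof (induction rule: op.lspan.induct)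
      case zero
      then show ?case by (simp add: zero_opp.rep_eq)
    next
      case (add b y c)
      then obtain as bs v where b: "b = op.ep as * Opp (vx v) * op.gp bs" "set as \<subseteq> A" "set bs \<subseteq> A" "v \<in> V"
        "int (length as) - int (length bs) = m"
        by (auto elim!: op.monomials.cases)
      have "unopp b = ep bs * vx v * gp as"
        by (simp add: b ep gp Opp_simps(4)[symmetric] Opp_inverse mult.assoc)
      also have "\<dots> \<in> homog (- m)" using b by (intro homogI) auto
      finally show ?case using add.IH
        by (simp add: plus_opp.rep_eq times_opp.rep_eq Opp_inverse homog_add homog_scale \<kappa>_commute)
    qed
    then show ?thesis using that by (metis Opp_inverse UNIV_I)
  qed
  have S: "op.S = Opp ` S"
  proof
    show "Opp ` S \<subseteq> op.S"
    proof clarify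
      fix y assume "y \<in> S"
      then show "Opp y \<in> op.S"
      proof (induction rule: S_induct)
        case (add n b x)
        then show ?case using h[of b n] op.homog_subset_S by (auto simp: Opp_simps intro!: op.S_add)
      qed (simp add: Opp_simps)
    qed
    show "op.S \<subseteq> Opp ` S"
    proof
      fix z assume "z \<in> op.S"
      then show "z \<in> Opp ` S"
      proof (induction rule: op.S_induct)
        case zero
        then show ?case using Opp_simps(1) S_zero by (metis imageI)
      next
        case (add n b x)
        obtain b' where b': "b = Opp b'" by (cases b)
        have "b' \<in> S" using h'[of b' n] add(1) homog_subset_S b' by blast
        then show ?case using add(3) b' by (auto simp: Opp_simps(3)[symmetric] intro: S_add)
      qed
    qed
  qed
  have "op.idl (Opp ` I)"
  proof (rule op.idlI)
    show "Opp ` I \<subseteq> op.S" using idl_S[OF I] by (auto simp: S)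
    show "0 \<in> Opp ` I" using idl_0[OF I] Opp_simps(1) by (metis imageI)
  qed (auto simp: S Opp_simps(3,4)[symmetric] intro: idl_add[OF I] idl_left[OF I] idl_right[OF I])
  from op.right_unit_homog[OF this imageI[OF x(1)] h[OF x(2)]] obtain v where
    v: "v \<in> I" "Opp v \<in> op.homog 0" "Opp x * Opp v = Opp x" by blast
  then have "v * x = x" by (simp add: Opp_simps(4)[symmetric] Opp_simps(5))
  then show ?thesis using v h'[of v 0] by auto
qed

end

section \<open>Graded families\<close>

context leavitt_family
begin

section \<open>Cancelling ghost paths against paths between vertices\<close>

lemma loop_left_inverse:
  assumes "set \<mu> \<subseteq> A" "v \<in> V" "w \<in> V" "vx v * ep \<mu> * vx w \<noteq> 0"
  shows "(vx w * gp \<mu> * vx v) * (vx v * ep \<mu> * vx w) = vx w"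
proof (cases "\<mu> = []")
  case True
  then show ?thesis using assms by (auto simp: vx_vx split: if_splits)
next
  case False
  have *: "vx v * ep \<mu> = ep \<mu>" using vx_ep[OF assms(2,1) False] assms(4) by (auto split: if_splits)
  then have ne: "ep \<mu> * vx w \<noteq> 0" using assms(4) by simp
  have "(vx w * gp \<mu> * vx v) * (vx v * ep \<mu> * vx w) = vx w * (gp \<mu> * (vx v * (vx v * ep \<mu>)) * vx w)"
    by (simp add: mult.assoc)
  also have "\<dots> = vx w * (gp \<mu> * ep \<mu> * vx w)" using * by simp
  also have "\<dots> = vx w" using gp_ep_same[OF assms(3,1)] ne assms(3) by (simp add: vx_idem)
  finally show ?thesis .
qed

lemma path_compose:
  assumes "set as \<subseteq> A" "set ds \<subseteq> A" "z \<in> V" "w \<in> V"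
  shows "ep as * vx z * ep ds * vx w = 0 \<or> ep as * vx z * ep ds * vx w = ep (as @ ds) * vx w"
proof (cases "ds = []")
  case True
  then show ?thesis using assms by (simp add: mult.assoc vx_vx)
next
  case False
  then have "vx z * ep ds = ep ds \<or> vx z * ep ds = 0" using vx_ep[OF assms(3,2)] by auto
  moreover have "ep as * vx z * ep ds * vx w = ep as * (vx z * ep ds) * vx w" by (simp add: mult.assoc)
  ultimately show ?thesis by auto
qed

text \<open>With vertices written at all three places, empty paths need no special reading. Since
  \<open>cs\<close> is at least as long as \<open>bs\<close>, every ghost edge is consumed and what
  remains, if anything, is a real path.\<close>

lemma ghost_path_cancel:
  assumes "set bs \<subseteq> A" "set cs \<subseteq> A" "length bs \<le> length cs" "z \<in> V" "v \<in> V" "w \<in> V"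
  shows "vx z * gp bs * (vx v * ep cs * vx w) = 0 \<or>
    (\<exists>ds. cs = bs @ ds \<and> vx z * gp bs * (vx v * ep cs * vx w) = vx z * ep ds * vx w)"
proof (cases "bs = []")
  case True
  show ?thesis
  proof (cases "z = v")
    case True
    then have "vx z * gp bs * (vx v * ep cs * vx w) = vx z * ep cs * vx w"
      using \<open>bs = []\<close> assms by (simp add: mult.assoc[symmetric] vx_idem)
    then show ?thesis using \<open>bs = []\<close> by auto
  next
    case False
    then show ?thesis using \<open>bs = []\<close> assms by (simp add: mult.assoc[symmetric] vx_vx)
  qed
next
  case False
  then have "cs \<noteq> []" using assms(3) by auto
  then have "vx v * ep cs = ep cs \<or> vx v * ep cs = 0" using vx_ep[OF assms(5,2)] by auto
  moreover have "vx z * gp bs * (ep cs * vx w) = 0 \<or>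
    (\<exists>ds. cs = bs @ ds \<and> vx z * gp bs * (ep cs * vx w) = vx z * ep ds * vx w)"
  proof (cases "gp bs * ep cs = 0")
    case True
    have "vx z * gp bs * (ep cs * vx w) = vx z * (gp bs * ep cs) * vx w" by (simp add: mult.assoc)
    then show ?thesis using True by simp
  next
    case nz: False
    then obtain ds where ds: "cs = bs @ ds" "gp bs * ep cs = gp bs * ep bs * ep ds"
      using gp_ep_prefix[OF assms(1-3)] by blast
    define y where "y = rng (last bs)"
    have y: "y \<in> V" using last_in_set[OF False] assms(1) rng_in by (auto simp: y_def)
    have eb: "ep bs * vx y = ep bs" using ep_vx[OF y assms(1) False] by (simp add: y_def)
    have "ep bs \<noteq> 0" using nz ds(2) by auto
    then have "gp bs * ep bs = vx y" using gp_ep_same[OF y assms(1)] eb by (auto simp: mult.assoc)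
    then have "vx z * gp bs * (ep cs * vx w) = vx z * vx y * ep ds * vx w"
      using ds(2) by (metis mult.assoc)
    then show ?thesis using ds(1) y assms(4) by (auto simp: vx_vx split: if_splits)
  qed
  ultimately show ?thesis by auto
qed

lemma common_left_unit:
  assumes I: "idl I" and "finite X" "X \<subseteq> I" "\<forall>x\<in>X. \<exists>n. x \<in> homog n"
  shows "\<exists>u \<in> I \<inter> homog 0. \<forall>x\<in>X. u * x = x"
  using assms(2-)
proof (induction X)
  case empty
  show ?case using idl_0[OF I] homog_zero by blast
next
  case (insert x X)
  then obtain u where u: "u \<in> I" "u \<in> homog 0" "\<forall>y\<in>X. u * y = y" by blast
  obtain n where n: "x \<in> homog n" using insert by blast
  have "x - u * x \<in> I" using insert u idl_S[OF I]
    by (intro idl_diff[OF I] idl_left[OF I]) auto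
  moreover have "x - u * x \<in> homog n" using homog_diff[OF n] homog_mult[OF u(2) n] by simp
  ultimately obtain v where v: "v \<in> I" "v \<in> homog 0" "v * (x - u * x) = x - u * x"
    using left_unit_homog[OF I] by blast
  \<comment> \<open>This means 1 - z = (1 - v)(1 - u): whatever \<open>u\<close> fixes is fixed by
    \<open>z\<close>, and \<open>v\<close> repairs the defect \<open>x - u * x\<close>.\<close>
  define z where "z = u + v - v * u"
  have "z \<in> I" unfolding z_def using u v idl_S[OF I]
    by (intro idl_diff[OF I] idl_add[OF I] idl_left[OF I]) auto
  moreover have "z \<in> homog 0" unfolding z_def
    using homog_diff[OF homog_add[OF u(2) v(2)]] homog_mult[OF v(2) u(2)] by simp
  moreover have "z * y = y" if "y \<in> X" for y
  proof -
    have "u * y = y" using u(3) that by blast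
    then show ?thesis by (simp add: z_def distrib_right left_diff_distrib mult.assoc)
  qed
  moreover have "z * x = u * x + v * (x - u * x)"
    by (simp add: z_def distrib_right left_diff_distrib right_diff_distrib mult.assoc)
  then have "z * x = x" by (simp add: v(3))
  ultimately show ?case by blast
qed

lemma common_right_unit:
  assumes I: "idl I" and "finite X" "X \<subseteq> I" "\<forall>x\<in>X. \<exists>n. x \<in> homog n"
  shows "\<exists>u \<in> I \<inter> homog 0. \<forall>x\<in>X. x * u = x"
  using assms(2-)
proof (induction X)
  case empty
  show ?case using idl_0[OF I] homog_zero by blast
next
  case (insert x X)
  then obtain u where u: "u \<in> I" "u \<in> homog 0" "\<forall>y\<in>X. y * u = y" by blast
  obtain n where n: "x \<in> homog n" using insert by blast
  have "x - x * u \<in> I" using insert u idl_S[OF I]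
    by (intro idl_diff[OF I] idl_left[OF I]) auto
  moreover have "x - x * u \<in> homog n" using homog_diff[OF n] homog_mult[OF n u(2)] by simp
  ultimately obtain v where v: "v \<in> I" "v \<in> homog 0" "(x - x * u) * v = x - x * u"
    using right_unit_homog[OF I] by blast
  define z where "z = u + v - u * v"
  have "z \<in> I" unfolding z_def using u v idl_S[OF I]
    by (intro idl_diff[OF I] idl_add[OF I] idl_left[OF I]) auto
  moreover have "z \<in> homog 0" unfolding z_def
    using homog_diff[OF homog_add[OF u(2) v(2)]] homog_mult[OF u(2) v(2)] by simp
  moreover have "y * z = y" if "y \<in> X" for y
  proof -
    have "y * u = y" using u(3) that by blast
    then show ?thesis by (simp add: z_def distrib_left right_diff_distrib mult.assoc[symmetric])
  qed
  moreover have "x * z = x * u + (x - x * u) * v"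
    by (simp add: z_def distrib_left left_diff_distrib right_diff_distrib mult.assoc)
  then have "x * z = x" by (simp add: v(3))
  ultimately show ?case by blast
qed

end

text \<open>The projections \<open>hc\<close> express that the sum of the \<open>homog n\<close> is
  direct: an element of two different degrees has to be 0. Nothing is said about their values
  outside \<open>S\<close>.\<close>

locale graded_leavitt_family = leavitt_family V A src rng \<kappa> vx ed gh
  for V :: "'v set" and A :: "'e set" and src rng :: "'e \<Rightarrow> 'v"
    and \<kappa> :: "'k::field \<Rightarrow> 'r::ring_1" and vx :: "'v \<Rightarrow> 'r" and ed gh :: "'e \<Rightarrow> 'r" +
  fixes hc :: "int \<Rightarrow> 'r \<Rightarrow> 'r"
  assumes hc_add: "\<lbrakk>x \<in> S; y \<in> S\<rbrakk> \<Longrightarrow> hc n (x + y) = hc n x + hc n y"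
    and hc_homog: "x \<in> homog m \<Longrightarrow> hc n x = (if n = m then x else 0)"
begin

lemma hc_0 [simp]: "hc n 0 = 0"
  using hc_homog[OF homog_zero[of "n + 1"], of n] by simp

lemma hc_in_homog: "x \<in> S \<Longrightarrow> hc n x \<in> homog n"
proof (induction rule: S_induct)
  case (add m b x)
  then have "hc n (b + x) = (if n = m then b else 0) + hc n x"
    using homog_subset_S by (subst hc_add) (auto simp: hc_homog)
  then show ?case using add by (auto intro: homog_add)
qed simp

lemma sum_hc: "x \<in> S \<Longrightarrow> \<exists>F. finite F \<and> (\<forall>n. n \<notin> F \<longrightarrow> hc n x = 0) \<and> (\<Sum>n\<in>F. hc n x) = x"
proof (induction rule: S_induct)
  case zero
  show ?case by (rule exI[of _ "{}"]) simp
next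
  case (add m b x)
  then obtain F where F: "finite F" "\<forall>n. n \<notin> F \<longrightarrow> hc n x = 0" "(\<Sum>n\<in>F. hc n x) = x"
    by (elim exE conjE)
  have eq: "hc n (b + x) = (if n = m then b else 0) + hc n x" for n
    using add homog_subset_S by (subst hc_add) (auto simp: hc_homog)
  have "(\<Sum>n\<in>insert m F. hc n x) = x"
    using sum.mono_neutral_right[of "insert m F" F "\<lambda>n. hc n x"] F by auto
  then have "(\<Sum>n\<in>insert m F. hc n (b + x)) = b + x"
    unfolding eq sum.distrib using F(1) by (simp add: sum.delta)
  moreover have "\<forall>n. n \<notin> insert m F \<longrightarrow> hc n (b + x) = 0" using F(2) by (simp add: eq)
  ultimately show ?case using F(1) by (intro exI[of _ "insert m F"] conjI) simp_all
qed

lemma hc_mult_left: assumes t: "t \<in> homog d" shows "x \<in> S \<Longrightarrow> hc n (t * x) = t * hc (n - d) x"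
proof (induction rule: S_induct)
  case (add m b x)
  have "hc n (t * b + t * x) = hc n (t * b) + hc n (t * x)"
    using add t homog_subset_S by (intro hc_add S_mult) auto
  moreover have "hc (n - d) (b + x) = hc (n - d) b + hc (n - d) x"
    using add homog_subset_S by (intro hc_add) auto
  moreover have "hc n (t * b) = t * hc (n - d) b"
    using hc_homog[OF homog_mult[OF t add(1)]] hc_homog[OF add(1)] by auto
  ultimately show ?case using add by (simp add: distrib_left)
qed simp

lemma hc_mult_right: assumes t: "t \<in> homog d" shows "x \<in> S \<Longrightarrow> hc n (x * t) = hc (n - d) x * t"
proof (induction rule: S_induct)
  case (add m b x)
  have "hc n (b * t + x * t) = hc n (b * t) + hc n (x * t)"
    using add t homog_subset_S by (intro hc_add S_mult) auto
  moreover have "hc (n - d) (b + x) = hc (n - d) b + hc (n - d) x"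
    using add homog_subset_S by (intro hc_add) auto
  moreover have "hc n (b * t) = hc (n - d) b * t"
    using hc_homog[OF homog_mult[OF add(1) t]] hc_homog[OF add(1)] by auto
  ultimately show ?case using add by (simp add: distrib_right)
qed simp

lemma hc_diff: "\<lbrakk>x \<in> S; y \<in> S\<rbrakk> \<Longrightarrow> hc n (x - y) = hc n x - hc n y"
  using hc_add[OF S_diff[of x y], of y n] by simp

definition graded :: "'r set \<Rightarrow> bool" where
  "graded I \<longleftrightarrow> idl I \<and> (\<forall>x\<in>I. \<forall>n. hc n x \<in> I)"

text \<open>Components instead of generators: for an ideal \<open>I\<close> this is the same ideal,
  and membership becomes a condition on each degree separately.\<close>

definition gr :: "'r set \<Rightarrow> 'r set" where
  "gr I = {x \<in> S. \<forall>n. hc n x \<in> I}"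

lemma graded_idl: "graded I \<Longrightarrow> idl I" by (simp add: graded_def)
lemma graded_hc: "graded I \<Longrightarrow> x \<in> I \<Longrightarrow> hc n x \<in> I" by (simp add: graded_def)

lemma mem_of_hc: assumes "idl I" "x \<in> S" "\<And>n. hc n x \<in> I" shows "x \<in> I"
proof -
  obtain F where "(\<Sum>n\<in>F. hc n x) = x" using sum_hc[OF assms(2)] by (elim exE conjE)
  then show ?thesis using idl_sum[OF assms(1), of F "\<lambda>n. hc n x"] assms(3) by simp
qed

lemma homog_mem_gr: "idl I \<Longrightarrow> x \<in> I \<Longrightarrow> x \<in> homog n \<Longrightarrow> x \<in> gr I"
  using homog_subset_S by (auto simp: gr_def hc_homog idl_0)

lemma gr_subset: "idl I \<Longrightarrow> gr I \<subseteq> I"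
  unfolding gr_def using mem_of_hc by blast

lemma graded_gr: assumes I: "idl I" shows "graded (gr I)"
proof -
  have l: "a * x \<in> gr I" if a: "a \<in> S" and x: "x \<in> gr I" for a x
    using a
  proof (induction rule: S_induct)
    case zero
    then show ?case using idl_0[OF I] by (simp add: gr_def)
  next
    case (add m b a)
    have xS: "x \<in> S" using x by (simp add: gr_def)
    have bS: "b \<in> S" using add homog_subset_S by blast
    have "hc n ((b + a) * x) \<in> I" for n
    proof -
      have "hc n (b * x + a * x) = hc n (b * x) + hc n (a * x)"
        using xS bS add by (intro hc_add S_mult)
      also have "\<dots> = b * hc (n - m) x + hc n (a * x)" by (simp add: hc_mult_left[OF add(1) xS])
      also have "\<dots> \<in> I" using add(3) x bS by (intro idl_add[OF I] idl_left[OF I]) (auto simp: gr_def)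
      finally show ?thesis by (simp add: distrib_right)
    qed
    then show ?case using S_mult[OF S_add[OF bS add(2)] xS] by (simp add: gr_def)
  qed
  have r: "x * a \<in> gr I" if a: "a \<in> S" and x: "x \<in> gr I" for a x
    using a
  proof (induction rule: S_induct)
    case zero
    then show ?case using idl_0[OF I] by (simp add: gr_def)
  next
    case (add m b a)
    have xS: "x \<in> S" using x by (simp add: gr_def)
    have bS: "b \<in> S" using add homog_subset_S by blast
    have "hc n (x * (b + a)) \<in> I" for n
    proof -
      have "hc n (x * b + x * a) = hc n (x * b) + hc n (x * a)"
        using xS bS add by (intro hc_add S_mult)
      also have "\<dots> = hc (n - m) x * b + hc n (x * a)" by (simp add: hc_mult_right[OF add(1) xS])
      also have "\<dots> \<in> I" using add(3) x bS by (intro idl_add[OF I] idl_right[OF I]) (auto simp: gr_def)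
      finally show ?thesis by (simp add: distrib_left)
    qed
    then show ?case using S_mult[OF xS S_add[OF bS add(2)]] by (simp add: gr_def)
  qed
  have "idl (gr I)"
  proof (rule idlI)
    show "x + y \<in> gr I" if "x \<in> gr I" "y \<in> gr I" for x y
      using that idl_add[OF I] by (auto simp: gr_def hc_add intro: S_add)
  qed (use l r idl_0[OF I] in \<open>auto simp: gr_def\<close>)
  moreover have "hc n x \<in> gr I" if x: "x \<in> gr I" for x n
  proof -
    have "x \<in> S" "hc n x \<in> I" using x by (auto simp: gr_def)
    then show ?thesis using homog_mem_gr[OF I] hc_in_homog by blast
  qed
  ultimately show ?thesis by (simp add: graded_def)
qed

lemma graded_left_unit: assumes I: "graded I" and x: "x \<in> I" shows "\<exists>u\<in>I. u * x = x"
proof -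
  note II = graded_idl[OF I]
  have xS: "x \<in> S" using idl_S[OF II x] .
  obtain F where F: "finite F" "(\<Sum>n\<in>F. hc n x) = x" using sum_hc[OF xS] by (elim exE conjE)
  obtain u where u: "u \<in> I" "\<forall>y\<in>(\<lambda>n. hc n x) ` F. u * y = y"
    using common_left_unit[OF II, of "(\<lambda>n. hc n x) ` F"] F(1) graded_hc[OF I x] hc_in_homog[OF xS] by blast
  have "u * (\<Sum>n\<in>F. hc n x) = (\<Sum>n\<in>F. hc n x)"
    using u(2) by (simp add: sum_distrib_left)
  then show ?thesis using u(1) F(2) by auto
qed

lemma graded_right_unit: assumes I: "graded I" and x: "x \<in> I" shows "\<exists>u\<in>I. x * u = x"
proof -
  note II = graded_idl[OF I]
  have xS: "x \<in> S" using idl_S[OF II x] .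
  obtain F where F: "finite F" "(\<Sum>n\<in>F. hc n x) = x" using sum_hc[OF xS] by (elim exE conjE)
  obtain u where u: "u \<in> I" "\<forall>y\<in>(\<lambda>n. hc n x) ` F. y * u = y"
    using common_right_unit[OF II, of "(\<lambda>n. hc n x) ` F"] F(1) graded_hc[OF I x] hc_in_homog[OF xS] by blast
  have "(\<Sum>n\<in>F. hc n x) * u = (\<Sum>n\<in>F. hc n x)"
    using u(2) by (simp add: sum_distrib_right)
  then show ?thesis using u(1) F(2) by auto
qed

end

section \<open>Ideals without homogeneous elements\<close>

context graded_leavitt_family
begin

text \<open>The support of the class of \<open>x\<close> modulo \<open>G\<close>, for a graded ideal
  \<open>G\<close>.\<close>

definition supp :: "'r set \<Rightarrow> 'r \<Rightarrow> int set" where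
  "supp G x = {n. hc n x \<notin> G}"

lemma finite_supp: "idl G \<Longrightarrow> x \<in> S \<Longrightarrow> finite (supp G x)"
proof -
  assume G: "idl G" and x: "x \<in> S"
  obtain F where F: "finite F" "\<forall>n. n \<notin> F \<longrightarrow> hc n x = 0" using sum_hc[OF x] by (elim exE conjE)
  have "supp G x \<subseteq> F" using F(2) idl_0[OF G] by (auto simp: supp_def)
  then show ?thesis using F(1) finite_subset by blast
qed

end

text \<open>
  \<open>P\<close> is not graded, but becomes free of homogeneous elements modulo \<open>G\<close>. The elements of \<open>P - G\<close>
  with the least number \<open>r\<close> of components outside \<open>G\<close> are used to find a cycle without exits.
\<close>

locale ungraded_ideal = graded_leavitt_family V A src rng \<kappa> vx ed gh hc
  for V :: "'v set" and A :: "'e set" and src rng :: "'e \<Rightarrow> 'v"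
    and \<kappa> :: "'k::field \<Rightarrow> 'r::ring_1" and vx :: "'v \<Rightarrow> 'r" and ed gh :: "'e \<Rightarrow> 'r"
    and hc :: "int \<Rightarrow> 'r \<Rightarrow> 'r" +
  fixes G P :: "'r set"
  assumes graded_G: "graded G" and idl_P: "idl P" and G_P: "G \<subseteq> P"
    and homog_P: "\<lbrakk>x \<in> P; x \<in> homog n\<rbrakk> \<Longrightarrow> x \<in> G"
    and not_P_G: "\<not> P \<subseteq> G"
begin

lemma G: "idl G" using graded_G by (rule graded_idl)
lemmas P_S = idl_S[OF idl_P]

section \<open>Elements with the fewest components outside G\<close>

definition r :: nat where "r = (LEAST c. \<exists>b. b \<in> P \<and> b \<notin> G \<and> card (supp G b) = c)"

lemma r_le: "x \<in> P \<Longrightarrow> x \<notin> G \<Longrightarrow> r \<le> card (supp G x)"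
  unfolding r_def by (rule Least_le) blast

lemma r_attained: "\<exists>b. b \<in> P \<and> b \<notin> G \<and> card (supp G b) = r"
proof -
  have "\<exists>c. \<exists>b. b \<in> P \<and> b \<notin> G \<and> card (supp G b) = c" using not_P_G by blast
  then show ?thesis unfolding r_def by (rule LeastI_ex)
qed

text \<open>The form in which minimality of \<open>r\<close> is applied: \<open>y\<close> arises
  from \<open>b\<close> by multiplication with elements of total degree \<open>d\<close>, and the
  component of \<open>b\<close> in degree \<open>m\<close> has been lost.\<close>

lemma smaller_supp:
  assumes "y \<in> P" "b \<in> S" "card (supp G b) = r" "m \<in> supp G b"
    and sub: "\<And>n. n \<in> supp G y \<Longrightarrow> n - d \<in> supp G b - {m}"
  shows "y \<in> G"
proof (rule ccontr)
  assume "y \<notin> G"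
  then have "r \<le> card (supp G y)" using r_le assms(1) by blast
  also have "supp G y \<subseteq> (\<lambda>n. n + d) ` (supp G b - {m})"
  proof
    fix n assume "n \<in> supp G y"
    then show "n \<in> (\<lambda>n. n + d) ` (supp G b - {m})" using sub[of n] by (intro image_eqI[of _ _ "n - d"]) auto
  qed
  then have "card (supp G y) \<le> card ((\<lambda>n. n + d) ` (supp G b - {m}))"
    using finite_supp[OF G assms(2)] by (intro card_mono) auto
  also have "\<dots> \<le> card (supp G b - {m})" using finite_supp[OF G assms(2)] by (intro card_image_le) auto
  also have "\<dots> < r" using finite_supp[OF G assms(2)] assms(3,4) by (metis card_Diff1_less)
  finally show False by simp
qed

text \<open>A normal form: the lowest component sits in degree 0 and equals \<open>q\<close>, later
  a gap or a vertex, and \<open>b\<close> lies in the corner at \<open>q\<close>. Comparison with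
  this component turns minimality into statements about the other components.\<close>

definition minimal_at :: "'r \<Rightarrow> 'r \<Rightarrow> bool" where
  "minimal_at q b \<longleftrightarrow> b \<in> P \<and> card (supp G b) = r \<and> (\<forall>n\<in>supp G b. 0 \<le> n) \<and>
    hc 0 b = q \<and> q \<notin> G \<and> q * b * q = b"

context
  fixes q b assumes min: "minimal_at q b"
begin

lemma min_P: "b \<in> P" and min_S: "b \<in> S" and min_card: "card (supp G b) = r"
  and min_nonneg: "n \<in> supp G b \<Longrightarrow> 0 \<le> n" and min_0: "hc 0 b = q" and min_q: "q \<notin> G"
  and min_corner: "q * b * q = b"
  using min P_S by (auto simp: minimal_at_def)

lemma min_q_homog: "q \<in> homog 0" using hc_in_homog[OF min_S, of 0] min_0 by simp

lemma zero_in_supp: "0 \<in> supp G b" using min_0 min_q by (simp add: supp_def)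

text \<open>Otherwise \<open>b\<close> agrees with \<open>q\<close> modulo \<open>G\<close>. Then
  \<open>q\<close> is a homogeneous element of \<open>P\<close>, so it lies in
  \<open>G\<close>.\<close>

lemma min_positive: "\<exists>k>0. k \<in> supp G b"
proof (rule ccontr)
  assume "\<not> ?thesis"
  then have *: "hc n b \<in> G" if "n \<noteq> 0" for n
    using min_nonneg[of n] that by (fastforce simp: supp_def)
  have "b - q \<in> G"
  proof (rule mem_of_hc[OF G])
    show "b - q \<in> S" using min_S min_q_homog homog_subset_S by (blast intro: S_diff)
    show "hc n (b - q) \<in> G" for n
    proof -
      have "hc n (b - q) = hc n b - hc n q"
        using min_S min_q_homog homog_subset_S by (blast intro: hc_diff)
      then show ?thesis
        using * hc_homog[OF min_q_homog, of n] min_0 idl_0[OF G] by (cases "n = 0") auto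
    qed
  qed
  then have "b - (b - q) \<in> P" using min_P G_P idl_diff[OF idl_P] by blast
  then have "q \<in> P" by simp
  then show False using homog_P min_q_homog min_q by blast
qed

text \<open>In \<open>t * b - b * t\<close> the terms from the component \<open>q\<close> cancel,
  because \<open>t * q = t = q * t\<close>. The support has become smaller, so the commutator lies
  in \<open>G\<close>, and so do its components.\<close>

lemma min_commute:
  assumes t: "t \<in> homog d" "t * q = t" "q * t = t"
  shows "t * hc n b - hc n b * t \<in> G"
proof -
  have tS: "t \<in> S" using t homog_subset_S by blast
  have hc: "hc m (t * b - b * t) = t * hc (m - d) b - hc (m - d) b * t" for m
    using hc_diff[OF S_mult[OF tS min_S] S_mult[OF min_S tS]]
    by (simp add: hc_mult_left[OF t(1) min_S] hc_mult_right[OF t(1) min_S])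
  have "t * b - b * t \<in> G"
  proof (rule smaller_supp[OF _ min_S min_card zero_in_supp])
    show "t * b - b * t \<in> P" using min_P tS
      by (intro idl_diff[OF idl_P] idl_left[OF idl_P] idl_right[OF idl_P])
    show "m - d \<in> supp G b - {0}" if "m \<in> supp G (t * b - b * t)" for m
    proof -
      have m: "t * hc (m - d) b - hc (m - d) b * t \<notin> G" using that by (simp add: supp_def hc)
      have "m - d \<noteq> 0" using m min_0 t(2,3) idl_0[OF G] by auto
      moreover have "hc (m - d) b \<notin> G"
        using m tS by (blast intro: idl_diff[OF G] idl_left[OF G] idl_right[OF G])
      ultimately show ?thesis by (simp add: supp_def)
    qed
  qed
  then have "hc (n + d) (t * b - b * t) \<in> G" by (rule graded_hc[OF graded_G])
  then show ?thesis using hc[of "n + d"] by simp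
qed

text \<open>If \<open>t\<close> annihilates one component of \<open>b\<close> modulo
  \<open>G\<close>, then \<open>t * b\<close> has smaller support and lies in \<open>G\<close>. Its
  component of degree \<open>d\<close> is \<open>t * q = t\<close>.\<close>

lemma min_regular:
  assumes t: "t \<in> homog d" "t * q = t" and k: "k \<in> supp G b" "t * hc k b \<in> G"
  shows "t \<in> G"
proof -
  have tS: "t \<in> S" using t homog_subset_S by blast
  have "t * b \<in> G"
  proof (rule smaller_supp[OF _ min_S min_card k(1)])
    show "t * b \<in> P" using min_P tS by (intro idl_left[OF idl_P])
    show "m - d \<in> supp G b - {k}" if "m \<in> supp G (t * b)" for m
    proof -
      have m: "t * hc (m - d) b \<notin> G" using that by (simp add: supp_def hc_mult_left[OF t(1) min_S])
      then have "m - d \<noteq> k" using k(2) by auto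
      moreover have "hc (m - d) b \<notin> G" using m tS by (blast intro: idl_left[OF G])
      ultimately show ?thesis by (simp add: supp_def)
    qed
  qed
  then have "hc d (t * b) \<in> G" by (rule graded_hc[OF graded_G])
  then show ?thesis by (simp add: hc_mult_left[OF t(1) min_S] min_0 t(2))
qed

text \<open>The compressed element still has the component \<open>q'\<close> outside
  \<open>G\<close>. Minimality of \<open>r\<close> then forbids the loss of any other
  component.\<close>

lemma min_transfer:
  assumes ac: "a \<in> homog i" "c \<in> homog (- i)" "a * q * c = q'" "q' \<notin> G" "q' * a = a" "c * q' = c"
  shows "minimal_at q' (a * b * c)" and "supp G (a * b * c) = supp G b"
    and "hc n (a * b * c) = a * hc n b * c"
proof -
  have S: "a \<in> S" "c \<in> S" using ac homog_subset_S by blast+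
  show hc: "hc n (a * b * c) = a * hc n b * c" for n
    using hc_mult_right[OF ac(2) S_mult[OF S(1) min_S]] hc_mult_left[OF ac(1) min_S] by simp
  have "a * b * c \<in> P" using min_P S by (intro idl_left[OF idl_P] idl_right[OF idl_P])
  moreover have 0: "hc 0 (a * b * c) = q'" using hc ac(3) min_0 by simp
  have "a * b * c \<notin> G" using 0 ac(4) graded_hc[OF graded_G, of "a * b * c" 0] by auto
  have sub: "supp G (a * b * c) \<subseteq> supp G b"
    using S by (auto simp: supp_def hc intro: idl_left[OF G] idl_right[OF G])
  have fin: "finite (supp G b)" by (rule finite_supp[OF G min_S])
  have "card (supp G (a * b * c)) \<le> r" using card_mono[OF fin sub] min_card by simp
  moreover have "r \<le> card (supp G (a * b * c))"
    using r_le \<open>a * b * c \<in> P\<close> \<open>a * b * c \<notin> G\<close> by blast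
  ultimately have card: "card (supp G (a * b * c)) = r" by simp
  then show eq: "supp G (a * b * c) = supp G b"
    using card_subset_eq[OF fin sub] min_card by simp
  have "q' * (a * b * c) * q' = (q' * a) * b * (c * q')" by (simp add: mult.assoc)
  then show "minimal_at q' (a * b * c)"
    using \<open>a * b * c \<in> P\<close> card 0 ac(4-6) eq min_nonneg by (auto simp: minimal_at_def)
qed

end

text \<open>Start from an element that attains \<open>r\<close> and let \<open>reduce_to_gap\<close>
  compress its lowest component, of degree \<open>m\<close>. The multipliers have total degree
  \<open>-m\<close>, so the gap appears in degree 0 and all other components above it.\<close>

lemma minimal_gap: "\<exists>F w b. finite F \<and> F \<subseteq> A \<and> w \<in> V \<and> minimal_at (gap F w) b"
proof -
  obtain b0 where b0: "b0 \<in> P" "b0 \<notin> G" "card (supp G b0) = r" using r_attained by blast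
  have b0S: "b0 \<in> S" using b0 P_S by blast
  have fin: "finite (supp G b0)" by (rule finite_supp[OF G b0S])
  have "supp G b0 \<noteq> {}" using mem_of_hc[OF G b0S] b0 by (auto simp: supp_def)
  define m where "m = Min (supp G b0)"
  have m: "m \<in> supp G b0" "\<And>n. n \<in> supp G b0 \<Longrightarrow> m \<le> n"
    using fin \<open>supp G b0 \<noteq> {}\<close> by (auto simp: m_def)
  obtain N where "hc m b0 \<in> lspan (monomials m N)" using homog_depth hc_in_homog[OF b0S] by blast
  moreover have "hc m b0 \<notin> G" using m by (simp add: supp_def)
  ultimately have "\<exists>a c i j F w. a \<in> homog i \<and> c \<in> homog j \<and> i + m + j = 0 \<and> finite F \<and>
      F \<subseteq> A \<and> w \<in> V \<and> a * hc m b0 * c = gap F w \<and> gap F w \<notin> G"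
    by (rule reduce_to_gap[OF G])
  then obtain a c i j F w where ac: "a \<in> homog i" "c \<in> homog j" "i + m + j = 0"
    "finite F" "F \<subseteq> A" "w \<in> V" "a * hc m b0 * c = gap F w" "gap F w \<notin> G"
    by (elim exE conjE)
  define q where "q = gap F w"
  have qq: "q * q = q" using gap_gap[OF ac(4,5,6,6)] by (simp add: q_def)
  have qh: "q \<in> homog 0" using gap_homog[OF ac(4-6)] by (simp add: q_def)
  \<comment> \<open>The extra factors \<open>q\<close> move the result into the corner at
    \<open>q\<close> and leave the component \<open>q\<close> as it is.\<close>
  define a' c' where "a' = q * a" and "c' = c * q"
  have a': "a' \<in> homog i" and c': "c' \<in> homog j"
    using homog_mult[OF qh ac(1)] homog_mult[OF ac(2) qh] by (simp_all add: a'_def c'_def)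
  have S: "a' \<in> S" "c' \<in> S" using a' c' homog_subset_S by blast+
  define b where "b = a' * b0 * c'"
  have hc: "hc n b = a' * hc (n + m) b0 * c'" for n
  proof -
    have "n - j - i = n + m" using ac(3) by linarith
    then have "hc (n - j) (a' * b0) = a' * hc (n + m) b0"
      using hc_mult_left[OF a' b0S, of "n - j"] by metis
    then show ?thesis
      using hc_mult_right[OF c' S_mult[OF S(1) b0S], of n] by (simp add: b_def)
  qed
  have "a' * hc m b0 * c' = q * (a * hc m b0 * c) * q" by (simp add: a'_def c'_def mult.assoc)
  then have h0: "hc 0 b = q" using hc[of 0] ac(7) qq by (simp add: q_def[symmetric])
  have bP: "b \<in> P" unfolding b_def using S b0(1) by (intro idl_left[OF idl_P] idl_right[OF idl_P])
  have bG: "b \<notin> G" using h0 ac(8) graded_hc[OF graded_G, of b 0] by (auto simp: q_def)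
  have sub: "n + m \<in> supp G b0" if "n \<in> supp G b" for n
    using that S by (auto simp: supp_def hc intro: idl_left[OF G] idl_right[OF G])
  have "supp G b \<subseteq> (\<lambda>n. n - m) ` supp G b0"
  proof
    fix n assume "n \<in> supp G b"
    then show "n \<in> (\<lambda>n. n - m) ` supp G b0" using sub[of n] by (intro image_eqI[of _ _ "n + m"]) auto
  qed
  then have "card (supp G b) \<le> card ((\<lambda>n. n - m) ` supp G b0)" using fin by (intro card_mono) auto
  also have "\<dots> \<le> r" using card_image_le[OF fin, of "\<lambda>n. n - m"] b0(3) by simp
  finally have "card (supp G b) = r" using r_le[OF bP bG] by simp
  moreover have "0 \<le> n" if "n \<in> supp G b" for n using m(2)[OF sub[OF that]] by simp
  moreover have "q * b * q = b"
  proof -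
    have "q * b * q = (q * q) * a * b0 * c * (q * q)" by (simp add: b_def a'_def c'_def mult.assoc)
    then show ?thesis by (simp add: qq b_def a'_def c'_def mult.assoc)
  qed
  ultimately have "minimal_at q b" using bP h0 ac(8) by (simp add: minimal_at_def q_def)
  then show ?thesis using ac(4-6) unfolding q_def by blast
qed

text \<open>A monomial of positive degree begins with an edge. If all edges at \<open>w\<close>
  outside \<open>F\<close> were in \<open>G\<close>, the gap would annihilate all positive
  components of \<open>b\<close> modulo \<open>G\<close>, although \<open>b\<close> has such a
  component in the corner of the gap. Along an edge outside \<open>F\<close> and \<open>G\<close>
  the gap is compressed to the vertex \<open>rng e\<close>.\<close>

lemma minimal_vertex: "\<exists>v b. v \<in> V \<and> minimal_at (vx v) b"
proof -
  obtain F w b where F: "finite F" "F \<subseteq> A" "w \<in> V" and min: "minimal_at (gap F w) b"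
    using minimal_gap by (elim exE conjE)
  define q where "q = gap F w"
  note min = min[folded q_def]
  have "\<exists>e\<in>A. src e = w \<and> e \<notin> F \<and> ed e \<notin> G"
  proof (rule ccontr)
    assume none: "\<not> ?thesis"
    obtain k where k: "k > 0" "k \<in> supp G b" using min_positive[OF min] by blast
    have qS: "q \<in> S" using min_q_homog[OF min] homog_subset_S by blast
    have "q * z \<in> G" if "z \<in> homog k" for z
    proof -
      have "q * z \<in> lspan G"
        using that unfolding homog_def
      proof (rule lspan_mult_left)
        fix c assume "c \<in> (\<Union>N. monomials k N)"
        then obtain as bs v where c: "c = ep as * vx v * gp bs" "set as \<subseteq> A" "set bs \<subseteq> A" "v \<in> V"
          "int (length as) - int (length bs) = k"
          by (auto elim!: monomials.cases)
        then obtain e as' where as: "as = e # as'" using k by (cases as) auto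
        have e: "e \<in> A" using as c by simp
        have "q * ed e \<in> G"
        proof (cases "src e = w \<and> e \<notin> F")
          case True
          then have "ed e \<in> G" using none e by blast
          then show ?thesis using qS by (intro idl_left[OF G])
        next
          case False
          then have "q * ed e = 0" unfolding q_def by (subst gap_ed[OF F e]) (rule if_not_P)
          then show ?thesis using idl_0[OF G] by simp
        qed
        moreover have "set as' \<subseteq> A" using c(2) as by simp
        ultimately have "(q * ed e) * ep as' * vx v * gp bs \<in> G"
          using c(3,4) by (blast intro: idl_gp_right[OF G] idl_right[OF G _ vx_S] idl_ep_right[OF G])
        then show "q * c \<in> lspan G" using c as by (auto simp: mult.assoc intro: lspan_base)
      qed
      then show ?thesis using idl_lspan[OF G order_refl] by blast
    qed
    then have "q * hc k b \<in> G" using hc_in_homog[OF min_S[OF min]] by blast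
    moreover have "hc k b = q * hc k b * q"
      using hc_mult_right[OF min_q_homog[OF min] S_mult[OF qS min_S[OF min]], of k]
        hc_mult_left[OF min_q_homog[OF min] min_S[OF min], of k] min_corner[OF min] by simp
    ultimately have "hc k b \<in> G" using qS idl_right[OF G] by metis
    then show False using k by (simp add: supp_def)
  qed
  then obtain e where e: "e \<in> A" "src e = w" "e \<notin> F" "ed e \<notin> G" by blast
  have qe: "gh e * q * ed e = vx (rng e)"
    using gh_gap[OF F e(1)] e gh_ed[OF e(1,1)] by (simp add: q_def)
  have "vx (rng e) \<notin> G"
  proof
    assume "vx (rng e) \<in> G"
    then have "ed e * vx (rng e) \<in> G" using ed_S[OF e(1)] by (intro idl_left[OF G])
    then show False using ed_vx[OF e(1)] e(4) by simp
  qed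
  then have "minimal_at (vx (rng e)) (gh e * b * ed e)"
    using ed_homog1[OF e(1)] vx_gh[OF e(1)] ed_vx[OF e(1)] qe
    by (intro min_transfer(1)[OF min gh_homog1[OF e(1)]]) auto
  then show ?thesis using rng_in[OF e(1)] by blast
qed

text \<open>The counterpart of \<open>extract_gap\<close> in the corner at \<open>w\<close>. As
  \<open>k > 0\<close>, the path that is found is not empty, and its value in the corner cannot be 0
  because its ghost path detects a nonzero coefficient.\<close>

lemma closed_path_coeff:
  assumes u: "u \<in> lspan {vx w * ep \<delta> * vx w | \<delta>. set \<delta> \<subseteq> A \<and> int (length \<delta>) = k}" "u \<noteq> 0"
    and w: "w \<in> V" and k: "k > 0"
  shows "\<exists>\<delta> c. set \<delta> \<subseteq> A \<and> int (length \<delta>) = k \<and> c \<noteq> 0 \<and> vx w * ep \<delta> * vx w \<noteq> 0 \<and>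
    (vx w * gp \<delta> * vx w) * u = \<kappa> c * vx w"
proof -
  have "{vx w * ep \<delta> * vx w | \<delta>. set \<delta> \<subseteq> A \<and> int (length \<delta>) = k} \<subseteq> lspan (reals_of k)"
  proof clarify
    fix \<delta> assume \<delta>: "set \<delta> \<subseteq> A" "k = int (length \<delta>)"
    then have "\<delta> \<noteq> []" using k by auto
    then have "vx w * ep \<delta> = ep \<delta> \<or> vx w * ep \<delta> = 0" using vx_ep[OF w \<delta>(1)] by auto
    moreover have "ep \<delta> * vx w \<in> reals_of (int (length \<delta>))" using \<delta> w by (intro reals_of.intros) auto
    ultimately show "vx w * ep \<delta> * vx w \<in> lspan (reals_of (int (length \<delta>)))"
      by (auto intro: lspan_base lspan.zero)
  qed
  then have "u \<in> lspan (reals_of k)" using lspan_subset u(1) by blast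
  moreover have wu: "vx w * u * vx w = u"
  proof (rule lspan_eqI[OF u(1)])
    fix b assume "b \<in> {vx w * ep \<delta> * vx w | \<delta>. set \<delta> \<subseteq> A \<and> int (length \<delta>) = k}"
    then obtain \<delta> where "b = vx w * ep \<delta> * vx w" by blast
    moreover have "vx w * (vx w * ep \<delta> * vx w) * vx w = (vx w * vx w) * ep \<delta> * (vx w * vx w)"
      by (simp add: mult.assoc)
    ultimately show "vx w * b * vx w = b" by (simp add: vx_idem[OF w])
  qed
  have uw: "u * vx w = u" "vx w * u = u"
    using wu vx_idem[OF w] by (metis mult.assoc)+
  obtain \<Lambda> c where c: "finite \<Lambda>"
    "\<forall>\<alpha>\<in>\<Lambda>. set \<alpha> \<subseteq> A \<and> int (length \<alpha>) = k \<and> c \<alpha> \<noteq> 0 \<and> gp \<alpha> * ep \<alpha> * vx w = vx w"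
    "u * vx w = (\<Sum>\<alpha>\<in>\<Lambda>. \<kappa> (c \<alpha>) * (ep \<alpha> * vx w))"
    using reals_of_coeffs[OF \<open>u \<in> lspan (reals_of k)\<close> w] by (elim exE conjE)
  have "\<Lambda> \<noteq> {}" using c(3) uw u(2) by auto
  then obtain \<delta> where \<delta>: "\<delta> \<in> \<Lambda>" by blast
  have \<delta>': "set \<delta> \<subseteq> A" "int (length \<delta>) = k" "c \<delta> \<noteq> 0" "gp \<delta> * ep \<delta> * vx w = vx w"
    using c(2) \<delta> by auto
  have "gp \<delta> * (u * vx w) = \<kappa> (c \<delta>) * vx w"
    unfolding c(3) by (rule reals_of_coeff_extract[OF c(1) \<delta>, of k]) (use c(2) in blast)
  then have gu: "gp \<delta> * u = \<kappa> (c \<delta>) * vx w" using uw by simp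
  have eq: "(vx w * gp \<delta> * vx w) * u = \<kappa> (c \<delta>) * vx w"
  proof -
    have "(vx w * gp \<delta> * vx w) * u = vx w * (gp \<delta> * (vx w * u))" by (simp add: mult.assoc)
    also have "\<dots> = vx w * (\<kappa> (c \<delta>) * vx w)" using uw gu by simp
    also have "\<dots> = \<kappa> (c \<delta>) * vx w" by (simp add: mult_\<kappa>_left vx_idem[OF w])
    finally show ?thesis .
  qed
  have "vx w * ep \<delta> * vx w \<noteq> 0"
  proof
    assume z: "vx w * ep \<delta> * vx w = 0"
    have ne: "\<delta> \<noteq> []" using \<delta>'(2) k by auto
    have "vx w \<noteq> 0" using uw u(2) by auto
    then have "ep \<delta> * vx w \<noteq> 0" using \<delta>'(4) by (auto simp: mult.assoc)
    then have "src (hd \<delta>) \<noteq> w" using z vx_ep[OF w \<delta>'(1) ne] by auto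
    then have "gp \<delta> * vx w = 0" using gp_vx[OF w \<delta>'(1) ne] by simp
    then have "\<kappa> (c \<delta>) * vx w = 0" using eq by (simp add: mult.assoc)
    then show False using \<kappa>_inverse[OF \<delta>'(3), of "vx w"] \<open>vx w \<noteq> 0\<close> by simp
  qed
  then show ?thesis using \<delta>' eq by blast
qed

text \<open>By \<open>min_regular\<close> the powers of the component of degree \<open>k\<close>
  stay outside \<open>G\<close>. The monomials of the N-th power begin with at least
  \<open>N\<close> edges, so one of these initial paths of length \<open>N\<close> stays outside
  \<open>G\<close>.\<close>

lemma long_path:
  assumes min: "minimal_at (vx v) b" and v: "v \<in> V" and k: "k \<in> supp G b" "k > 0"
  shows "\<exists>\<mu>. set \<mu> \<subseteq> A \<and> length \<mu> = N \<and> vx v * ep \<mu> \<notin> G"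
proof (rule ccontr)
  assume none: "\<not> ?thesis"
  define c where "c = hc k b"
  have c: "c \<in> homog k" using hc_in_homog[OF min_S[OF min]] by (simp add: c_def)
  have cv: "c = vx v * c * vx v"
    using hc_mult_right[OF vx_homog0[OF v] S_mult[OF vx_S[OF v] min_S[OF min]], of k]
      hc_mult_left[OF vx_homog0[OF v] min_S[OF min], of k] min_corner[OF min] by (simp add: c_def)
  have cv': "c * vx v = c"
    using vx_idem[OF v] by (subst (1 2) cv) (simp add: mult.assoc)
  define t where "t m = vx v * c ^ m" for m
  have t: "t m \<in> homog (int m * k) \<and> t m * vx v = t m \<and> t m \<notin> G" for m
  proof (induction m)
    case 0
    show ?case using vx_homog0[OF v] vx_idem[OF v] min_q[OF min] by (simp add: t_def)
  next
    case (Suc m)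
    have Suc': "t (Suc m) = t m * c" by (simp add: t_def mult.assoc power_commutes)
    have "t (Suc m) \<in> homog (int (Suc m) * k)"
      using homog_mult[of "t m" "int m * k" c k] Suc c by (simp add: Suc' algebra_simps)
    moreover have "t m * c \<notin> G"
      using min_regular[OF min _ _ k(1), of "t m" "int m * k"] Suc by (auto simp: c_def)
    ultimately show ?case using cv' by (simp add: Suc' mult.assoc)
  qed
  have "vx v * t N \<in> lspan G"
    using conjunct1[OF t, of N] unfolding homog_def
  proof (rule lspan_mult_left)
    fix y assume "y \<in> (\<Union>M. monomials (int N * k) M)"
    then obtain as bs z where y: "y = ep as * vx z * gp bs" "set as \<subseteq> A" "set bs \<subseteq> A" "z \<in> V"
      "int (length as) - int (length bs) = int N * k"
      by (auto elim!: monomials.cases)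
    have "int N * 1 \<le> int N * k" using k(2) by (intro mult_left_mono) auto
    then have len: "N \<le> length as" using y(5) by simp
    define as1 as2 where "as1 = take N as" and "as2 = drop N as"
    have as: "as = as1 @ as2" "length as1 = N" "set as1 \<subseteq> A" "set as2 \<subseteq> A"
      using len y(2) set_take_subset[of N as] set_drop_subset[of N as] by (auto simp: as1_def as2_def)
    have "vx v * ep as1 \<in> G" using none as(2,3) by blast
    then have "vx v * ep as1 * ep as2 * vx z * gp bs \<in> G"
      by (rule idl_gp_right[OF G y(3) idl_right[OF G idl_ep_right[OF G as(4)] vx_S[OF y(4)]]])
    then show "vx v * y \<in> lspan G" using y(1) as(1) by (auto simp: mult.assoc intro: lspan_base)
  qed
  then have "vx v * t N \<in> G" using idl_lspan[OF G order_refl] by blast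
  moreover have "vx v * t N = t N" by (simp add: t_def mult.assoc[symmetric] vx_idem[OF v])
  ultimately show False using t[of N] by simp
qed

text \<open>Conjugation by a path \<mu> as long as the bound on the ghost edges of
  \<open>hc k b\<close> turns this component into a combination \<open>u\<close> of closed paths at
  \<open>w\<close>. One of these paths satisfies \<open>d' * u = \<kappa> c * vx w\<close>, and
  \<open>min_commute\<close> lets \<open>u\<close> and \<open>d'\<close> change places modulo
  \<open>G\<close>, which makes \<open>d'\<close> a right inverse of \<open>d\<close> as
  well.\<close>

theorem cycle_without_exits:
  "\<exists>w \<delta> b. w \<in> V \<and> set \<delta> \<subseteq> A \<and> \<delta> \<noteq> [] \<and> vx w \<notin> G \<and>
    vx w - (vx w * ep \<delta> * vx w) * (vx w * gp \<delta> * vx w) \<in> G \<and>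
    b \<in> P \<and> b \<notin> G \<and> vx w * b * vx w = b"
proof -
  obtain v b where v: "v \<in> V" and min: "minimal_at (vx v) b" using minimal_vertex by blast
  obtain k where k: "k > 0" "k \<in> supp G b" using min_positive[OF min] by blast
  obtain N where N: "hc k b \<in> lspan (monomials k N)"
    using homog_depth hc_in_homog[OF min_S[OF min]] by blast
  obtain \<mu> where \<mu>: "set \<mu> \<subseteq> A" "length \<mu> = N" "vx v * ep \<mu> \<notin> G"
    using long_path[OF min v k(2,1)] by blast
  define w where "w = (if \<mu> = [] then v else rng (last \<mu>))"
  have w: "w \<in> V" using v \<mu>(1) rng_in last_in_set[of \<mu>] by (auto simp: w_def subset_iff)
  have pw: "vx v * ep \<mu> * vx w = vx v * ep \<mu>"
    using ep_vx[OF w \<mu>(1)] vx_idem[OF v] by (cases "\<mu> = []") (auto simp: w_def mult.assoc)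
  define p p' where "p = vx v * ep \<mu> * vx w" and "p' = vx w * gp \<mu> * vx v"
  have pG: "p \<notin> G" using \<mu>(3) pw by (simp add: p_def)
  have p'p: "p' * p = vx w"
    using pG idl_0[OF G] unfolding p_def p'_def by (intro loop_left_inverse \<mu> v w) auto
  have vp: "vx v * p = p" "p * vx w = p" "vx w * p' = p'" "p' * vx v = p'"
    using vx_idem[OF v] vx_idem[OF w] by (simp_all add: p_def p'_def mult.assoc) (simp_all add: mult.assoc[symmetric])
  have ph: "p \<in> homog (int N)"
    using vx_homog[OF v homogI[of \<mu> "[]" w "int N"]] \<mu> w by (simp add: p_def mult.assoc)
  have "ep [] * vx w * gp \<mu> \<in> homog (- int N)" using \<mu> w by (intro homogI) auto
  then have p'h: "p' \<in> homog (- int N)" using homog_mult[OF _ vx_homog0[OF v]] by (simp add: p'_def)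
  have wG: "vx w \<notin> G"
    using pG vp(2) idl_left[OF G, of p "vx w"] ph homog_subset_S by auto
  define b' where "b' = p' * b * p"
  have tr: "minimal_at (vx w) b'" "supp G b' = supp G b" "hc k b' = p' * hc k b * p"
    unfolding b'_def using vp p'p wG by (intro min_transfer[OF min p'h]; simp add: ph)+
  define u where "u = hc k b'"
  have uG: "u \<notin> G" using tr(2) k by (auto simp: supp_def u_def)
  have uw: "u * vx w = u"
    using tr(3) vp(2) by (simp add: u_def mult.assoc)
  define D where "D = {vx w * ep \<delta> * vx w | \<delta>. set \<delta> \<subseteq> A \<and> int (length \<delta>) = k}"
  \<comment> \<open>Multiplication by \<open>p\<close> on the right consumes the ghost edges;
    multiplication by \<open>p'\<close> on the left then removes the first \<open>N\<close> edges
    and leaves closed paths of length \<open>k\<close>.\<close>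
  have "hc k b * p \<in> lspan {ep \<gamma> * vx w | \<gamma>. set \<gamma> \<subseteq> A \<and> int (length \<gamma>) = k + int N}"
  proof (rule lspan_mult_right[OF N])
    fix c assume "c \<in> monomials k N"
    then obtain as bs z where c: "c = ep as * vx z * gp bs" "set as \<subseteq> A" "set bs \<subseteq> A" "z \<in> V"
      "int (length as) - int (length bs) = k" "length bs \<le> N"
      by (auto elim!: monomials.cases)
    have cp: "c * p = ep as * (vx z * gp bs * (vx v * ep \<mu> * vx w))"
      by (simp add: c(1) p_def mult.assoc)
    consider "vx z * gp bs * (vx v * ep \<mu> * vx w) = 0"
      | ds where "\<mu> = bs @ ds" "vx z * gp bs * (vx v * ep \<mu> * vx w) = vx z * ep ds * vx w"
      using ghost_path_cancel[OF c(3) \<mu>(1) _ c(4) v w] c(6) \<mu>(2) by blast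
    then show "c * p \<in> lspan {ep \<gamma> * vx w | \<gamma>. set \<gamma> \<subseteq> A \<and> int (length \<gamma>) = k + int N}"
    proof cases
      case 1
      then show ?thesis using cp by (simp add: lspan.zero)
    next
      case 2
      then have ds: "set ds \<subseteq> A" using \<mu>(1) by auto
      have "c * p = ep as * vx z * ep ds * vx w" using cp 2(2) by (simp add: mult.assoc)
      then consider "c * p = 0" | "c * p = ep (as @ ds) * vx w"
        using path_compose[OF c(2) ds c(4) w] by auto
      then show ?thesis
      proof cases
        case 1
        then show ?thesis by (simp add: lspan.zero)
      next
        case b: 2
        have "set (as @ ds) \<subseteq> A" "int (length (as @ ds)) = k + int N"
          using c 2(1) ds \<mu>(2) by auto
        then show ?thesis using b by (intro lspan_base) blast
      qed
    qed
  qed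
  then have "p' * (hc k b * p) \<in> lspan D"
  proof (rule lspan_mult_left)
    fix c assume "c \<in> {ep \<gamma> * vx w | \<gamma>. set \<gamma> \<subseteq> A \<and> int (length \<gamma>) = k + int N}"
    then obtain \<gamma> where c: "c = ep \<gamma> * vx w" "set \<gamma> \<subseteq> A" "int (length \<gamma>) = k + int N" by blast
    have "length \<mu> \<le> length \<gamma>" using c(3) k(1) \<mu>(2) by simp
    moreover have "p' * c = vx w * gp \<mu> * (vx v * ep \<gamma> * vx w)"
      by (simp add: p'_def c(1) mult.assoc)
    ultimately consider "p' * c = 0" | ds where "\<gamma> = \<mu> @ ds" "p' * c = vx w * ep ds * vx w"
      using ghost_path_cancel[OF \<mu>(1) c(2) _ w v w] by auto
    then show "p' * c \<in> lspan D"
    proof cases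
      case 1
      then show ?thesis by (simp add: lspan.zero)
    next
      case 2
      then have "set ds \<subseteq> A" "int (length ds) = k" using c(2,3) \<mu>(2) by auto
      then show ?thesis using 2(2) by (auto simp: D_def intro: lspan_base)
    qed
  qed
  then have uD: "u \<in> lspan D" using tr(3) by (simp add: u_def mult.assoc)
  have "u \<noteq> 0" using uG idl_0[OF G] by auto
  from closed_path_coeff[OF uD[unfolded D_def] this w k(1)]
  obtain \<delta> c where \<delta>: "set \<delta> \<subseteq> A" "int (length \<delta>) = k" "c \<noteq> 0" "vx w * ep \<delta> * vx w \<noteq> 0"
    "(vx w * gp \<delta> * vx w) * u = \<kappa> c * vx w"
    by (elim exE conjE)
  define d d' where "d = vx w * ep \<delta> * vx w" and "d' = vx w * gp \<delta> * vx w"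
  have d'd: "d' * d = vx w" unfolding d_def d'_def by (rule loop_left_inverse[OF \<delta>(1) w w \<delta>(4)])
  have "ep \<delta> * vx w * gp [] \<in> homog k" using \<delta> w by (intro homogI) auto
  then have dh: "d \<in> homog k" using vx_homog[OF w] by (simp add: d_def mult.assoc)
  have "ep [] * vx w * gp \<delta> \<in> homog (- k)" using \<delta> w by (intro homogI) auto
  then have d'h: "d' \<in> homog (- k)" using homog_mult[OF _ vx_homog0[OF w]] by (simp add: d'_def)
  have S: "d \<in> S" "d' \<in> S" using dh d'h homog_subset_S by blast+
  have wd': "vx w * d' = d'" "d' * vx w = d'"
    using vx_idem[OF w] by (simp_all add: d'_def mult.assoc) (simp add: mult.assoc[symmetric])
  have comm: "\<kappa> c * vx w - u * d' \<in> G"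
    using min_commute[OF tr(1) d'h wd'(2,1), of k] \<delta>(5) by (simp add: u_def d'_def)
  \<comment> \<open>Multiplying by \<open>d * d'\<close> turns c w into c d d' but leaves
    \<open>u * d'\<close> unchanged, as \<open>d' * d = vx w\<close>. The difference of the two
    memberships is c (w - d d').\<close>
  then have "(\<kappa> c * vx w - u * d') * d * d' \<in> G" using S by (intro idl_right[OF G])
  moreover have "(\<kappa> c * vx w - u * d') * d * d' = \<kappa> c * (vx w * d) * d' - u * (d' * d) * d'"
    by (simp add: left_diff_distrib mult.assoc)
  moreover have "vx w * d = d" using vx_idem[OF w] by (simp add: d_def mult.assoc[symmetric])
  ultimately have 2: "\<kappa> c * (d * d') - u * d' \<in> G" using d'd uw by (simp add: mult.assoc)
  have "(\<kappa> c * vx w - u * d') - (\<kappa> c * (d * d') - u * d') \<in> G"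
    by (rule idl_diff[OF G comm 2])
  moreover have "(\<kappa> c * vx w - u * d') - (\<kappa> c * (d * d') - u * d') = \<kappa> c * (vx w - d * d')"
    by (simp add: right_diff_distrib)
  ultimately have "\<kappa> c * (vx w - d * d') \<in> G" by simp
  then have "vx w - d * d' \<in> G" by (rule idl_unscale[OF G _ \<delta>(3)])
  moreover have "\<delta> \<noteq> []" using \<delta>(2) k(1) by auto
  moreover have "b' \<in> P" "vx w * b' * vx w = b'" using tr(1) by (auto simp: minimal_at_def)
  moreover have "b' \<notin> G"
    using min_0[OF tr(1)] wG graded_hc[OF graded_G, of b' 0] by auto
  ultimately show ?thesis using w \<delta>(1) wG unfolding d_def d'_def by blast
qed

end

section \<open>Cycles without exits\<close>

context leavitt_family
begin

lemma closed_prefix: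
  assumes w: "w \<in> V" and \<delta>: "set \<delta> \<subseteq> A" and \<tau>: "set \<tau> \<subseteq> A" and len: "length \<delta> \<le> length \<tau>"
    and ne: "vx w * ep \<delta> * vx w \<noteq> 0"
  shows "(vx w * gp \<delta> * vx w) * (vx w * ep \<tau> * vx w) = 0 \<or>
    (\<exists>ds. \<tau> = \<delta> @ ds \<and> vx w * ep \<tau> * vx w = (vx w * ep \<delta> * vx w) * (vx w * ep ds * vx w))"
proof -
  have eq: "(vx w * gp \<delta> * vx w) * (vx w * ep \<tau> * vx w) = vx w * gp \<delta> * (vx w * ep \<tau> * vx w)"
    using vx_idem[OF w] by (simp add: mult.assoc) (metis mult.assoc)
  have *: "vx w * ep \<delta> * vx w = vx w * ep \<delta>"
    using ne ep_vx[OF w \<delta>] vx_idem[OF w] by (cases "\<delta> = []") (auto simp: mult.assoc split: if_splits)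
  have "vx w * ep (\<delta> @ ds) * vx w = (vx w * ep \<delta> * vx w) * (vx w * ep ds * vx w)" for ds
  proof -
    have "(vx w * ep \<delta> * vx w) * (vx w * ep ds * vx w) = vx w * ep \<delta> * (vx w * vx w) * ep ds * vx w"
      by (simp add: mult.assoc)
    also have "\<dots> = vx w * ep \<delta> * ep ds * vx w" using * vx_idem[OF w] by simp
    finally show ?thesis by (simp add: mult.assoc)
  qed
  then show ?thesis unfolding eq using ghost_path_cancel[OF \<delta> \<tau> len w w w] by blast
qed

lemma gp_ep_same':
  "v \<in> V \<Longrightarrow> set es \<subseteq> A \<Longrightarrow> vx v * gp es * ep es = vx v \<or> vx v * gp es = 0"
proof (induction es)
  case (Cons e es)
  then have IH: "vx v * gp es * ep es = vx v \<or> vx v * gp es = 0" and e: "e \<in> A" by auto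
  have eq: "vx v * gp (e # es) * ep (e # es) = vx v * gp es * vx (rng e) * ep es"
  proof -
    have "vx v * gp (e # es) * ep (e # es) = vx v * gp es * (gh e * ed e) * ep es"
      by (simp add: mult.assoc)
    then show ?thesis using gh_ed[OF e e] by simp
  qed
  have eq2: "vx v * gp (e # es) = vx v * gp es * vx (rng e) * gh e"
    using vx_gh[OF e] by (simp add: mult.assoc)
  have "vx v * gp es * vx (rng e) = vx v * gp es \<or> vx v * gp es * vx (rng e) = 0"
    using Cons.prems e gp_vx[of "rng e" es] rng_in[OF e]
    by (cases "es = []") (auto simp: mult.assoc vx_vx split: if_splits)
  then show ?case using IH eq eq2 by (metis mult_zero_left)
qed simp

end

text \<open>The assumption \<open>shortest\<close> keeps \<delta> from being a proper power of
  another closed path, so that all closed paths at \<open>w\<close> can be powers of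
  \<open>d\<close>.\<close>

locale exitless_cycle = graded_leavitt_family V A src rng \<kappa> vx ed gh hc
  for V :: "'v set" and A :: "'e set" and src rng :: "'e \<Rightarrow> 'v"
    and \<kappa> :: "'k::field \<Rightarrow> 'r::ring_1" and vx :: "'v \<Rightarrow> 'r" and ed gh :: "'e \<Rightarrow> 'r"
    and hc :: "int \<Rightarrow> 'r \<Rightarrow> 'r" +
  fixes G :: "'r set" and w :: 'v and \<delta> :: "'e list"
  assumes graded_G: "graded G" and w: "w \<in> V" and \<delta>: "set \<delta> \<subseteq> A" "\<delta> \<noteq> []"
    and w_G: "vx w \<notin> G"
    and exitless: "vx w - (vx w * ep \<delta> * vx w) * (vx w * gp \<delta> * vx w) \<in> G"
    and shortest: "\<lbrakk>set \<tau> \<subseteq> A; \<tau> \<noteq> []; vx w * ep \<tau> * vx w \<noteq> 0\<rbrakk> \<Longrightarrow> length \<delta> \<le> length \<tau>"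

text \<open>The shortest closed path inherits the absence of exits. The given \<delta> begins with
  it, so \<open>d = c * (c' * d)\<close> and \<open>vx w - c * c'\<close> annihilates
  \<open>d\<close>. Hence multiplying \<open>vx w - d * d'\<close> by \<open>vx w - c * c'\<close>
  gives back \<open>vx w - c * c'\<close>.\<close>

lemma (in graded_leavitt_family) ex_exitless_cycle:
  assumes G: "graded G" and w: "w \<in> V" and \<delta>: "set \<delta> \<subseteq> A" "\<delta> \<noteq> []" and wG: "vx w \<notin> G"
    and exitless: "vx w - (vx w * ep \<delta> * vx w) * (vx w * gp \<delta> * vx w) \<in> G"
  shows "\<exists>\<delta>. exitless_cycle V A src rng \<kappa> vx ed gh hc G w \<delta>"
proof -
  note GI = graded_idl[OF G]
  have w2: "vx w * vx w = vx w" using vx_idem[OF w] .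
  define Q where "Q \<tau> \<longleftrightarrow> set \<tau> \<subseteq> A \<and> \<tau> \<noteq> [] \<and> vx w * ep \<tau> * vx w \<noteq> 0" for \<tau>
  have Q\<delta>: "Q \<delta>" using \<delta> wG exitless by (auto simp: Q_def)
  define \<delta>0 where "\<delta>0 = arg_min length Q"
  have Q0: "Q \<delta>0" and least: "\<And>\<tau>. Q \<tau> \<Longrightarrow> length \<delta>0 \<le> length \<tau>"
    unfolding \<delta>0_def using arg_min_nat_lemma[of Q \<delta> length] Q\<delta> by auto
  have \<delta>0: "set \<delta>0 \<subseteq> A" "vx w * ep \<delta>0 * vx w \<noteq> 0" using Q0 by (simp_all add: Q_def)
  define d d' c c' where "d = vx w * ep \<delta> * vx w" and "d' = vx w * gp \<delta> * vx w"
    and "c = vx w * ep \<delta>0 * vx w" and "c' = vx w * gp \<delta>0 * vx w"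
  have S: "c \<in> S" "c' \<in> S"
  proof -
    have "ep \<delta>0 * vx w * gp [] \<in> S" "ep [] * vx w * gp \<delta>0 \<in> S"
      using homogI[of \<delta>0 "[]" w] homogI[of "[]" \<delta>0 w] Q0 w homog_subset_S by (auto simp: Q_def)
    then show "c \<in> S" "c' \<in> S"
      using S_mult[OF vx_S[OF w], of "ep \<delta>0 * vx w"] S_mult[OF _ vx_S[OF w], of "vx w * gp \<delta>0"]
      by (simp_all add: c_def c'_def mult.assoc)
  qed
  have c'c: "c' * c = vx w"
    unfolding c_def c'_def by (rule loop_left_inverse[OF \<delta>0(1) w w \<delta>0(2)])
  have c'w: "c' * vx w = c'" using w2 by (simp add: c'_def mult.assoc)
  have ex: "vx w - d * d' \<in> G" using exitless by (simp add: d_def d'_def)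
  have dd: "d = c * (c' * d)"
  proof -
    consider "c' * d = 0" | ds where "d = c * (vx w * ep ds * vx w)"
      using closed_prefix[OF w \<delta>0(1) \<delta>(1) least[OF Q\<delta>] \<delta>0(2)] unfolding c_def c'_def d_def by blast
    then show ?thesis
    proof cases
      \<comment> \<open>If \<delta> did not begin with the shorter path, then \<open>c'\<close>
        would equal its product with \<open>vx w - d * d'\<close> and lie in \<open>G\<close>,
        together with \<open>c' * c = vx w\<close>.\<close>
      case 1
      have "c' * (vx w - d * d') \<in> G" using ex S by (intro idl_left[OF GI])
      moreover have "c' * (vx w - d * d') = c'"
        using c'w 1 by (simp add: right_diff_distrib mult.assoc[symmetric])
      ultimately have "c' \<in> G" by simp
      then have "c' * c \<in> G" using S by (intro idl_right[OF GI])
      then show ?thesis using c'c wG by simp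
    next
      case 2
      have "c * (c' * d) = c * (c' * c) * (vx w * ep ds * vx w)" by (simp add: 2 mult.assoc)
      also have "\<dots> = c * (vx w * vx w) * ep ds * vx w" by (simp add: c'c mult.assoc)
      finally have "c * (c' * d) = c * (vx w * ep ds * vx w)" by (simp add: w2 mult.assoc)
      then show ?thesis using 2 by simp
    qed
  qed
  have "(vx w - c * c') * (vx w - d * d') \<in> G"
    using ex S vx_S[OF w] by (intro idl_left[OF GI] S_diff S_mult)
  moreover have "(vx w - c * c') * (vx w - d * d') = vx w - c * c'"
  proof -
    have "vx w * d = d" using w2 by (simp add: d_def mult.assoc[symmetric])
    then have "(vx w - c * c') * d = 0" using dd by (simp add: left_diff_distrib mult.assoc)
    then have "(vx w - c * c') * (d * d') = 0" by (simp add: mult.assoc[symmetric])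
    moreover have "(vx w - c * c') * vx w = vx w - c * c'"
      using c'w w2 by (simp add: left_diff_distrib mult.assoc)
    ultimately show ?thesis by (simp add: right_diff_distrib)
  qed
  ultimately have "vx w - c * c' \<in> G" by simp
  then have "exitless_cycle V A src rng \<kappa> vx ed gh hc G w \<delta>0"
    using G w Q0 wG least by unfold_locales (auto simp: Q_def c_def c'_def)
  then show ?thesis by blast
qed

context exitless_cycle
begin

lemma G: "idl G" using graded_G by (rule graded_idl)

definition d :: 'r where "d = vx w * ep \<delta> * vx w"
definition d' :: 'r where "d' = vx w * gp \<delta> * vx w"
text \<open>The power with exponent 0 is the 1 of the ambient ring and not the unit of the corner,
  hence the factor \<open>vx w\<close>.\<close>

abbreviation (input) pw :: "nat \<Rightarrow> 'r" where "pw j \<equiv> vx w * d ^ j"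
abbreviation (input) pw' :: "nat \<Rightarrow> 'r" where "pw' j \<equiv> vx w * d' ^ j"

lemma ww: "vx w * vx w = vx w" using vx_idem[OF w] .
lemma ww': "vx w * (vx w * x) = vx w * x" using ww by (simp add: mult.assoc[symmetric])
lemma wd: "vx w * d = d" "d * vx w = d" "vx w * d' = d'" "d' * vx w = d'"
  by (simp_all add: d_def d'_def mult.assoc ww ww')

lemma d_neq_0: "vx w * ep \<delta> * vx w \<noteq> 0"
proof
  assume "vx w * ep \<delta> * vx w = 0"
  then show False using exitless w_G by simp
qed

lemma d'd: "d' * d = vx w"
  unfolding d_def d'_def by (rule loop_left_inverse[OF \<delta>(1) w w d_neq_0])

lemma d_homog: "d \<in> homog (int (length \<delta>))"
proof -
  have "ep \<delta> * vx w * gp [] \<in> homog (int (length \<delta>))" using \<delta> w by (intro homogI) auto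
  then show ?thesis using vx_homog[OF w] by (simp add: d_def mult.assoc)
qed

lemma d'_homog: "d' \<in> homog (- int (length \<delta>))"
proof -
  have "ep [] * vx w * gp \<delta> \<in> homog (- int (length \<delta>))" using \<delta> w by (intro homogI) auto
  then show ?thesis using homog_mult[OF _ vx_homog0[OF w]] by (simp add: d'_def)
qed

lemma d_S: "d \<in> S" and d'_S: "d' \<in> S"
  using d_homog d'_homog homog_subset_S by blast+

lemma pw_S: "pw j \<in> S" and pw'_S: "pw' j \<in> S"
proof -
  show "pw j \<in> S"
    by (induction j) (use w vx_S in \<open>auto simp: power_Suc2 mult.assoc[symmetric] simp del: power_Suc intro: S_mult d_S\<close>)
  show "pw' j \<in> S"
    by (induction j) (use w vx_S in \<open>auto simp: power_Suc2 mult.assoc[symmetric] simp del: power_Suc intro: S_mult d'_S\<close>)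
qed

lemma d_pow_w: "d ^ j * vx w = vx w * d ^ j"
  by (induction j) (simp_all add: mult.assoc wd, simp add: mult.assoc[symmetric] wd)

lemma d_pw: "d * pw j = pw (Suc j)"
  by (simp add: mult.assoc[symmetric] wd)

lemma pw'_pw: "pw' j * pw j = vx w"
proof (induction j)
  case (Suc j)
  have "pw' (Suc j) * pw (Suc j) = vx w * d' ^ j * (d' * vx w) * (d * d ^ j)"
    by (simp only: power_Suc2[of d'] power_Suc[of d] mult.assoc)
  also have "\<dots> = vx w * d' ^ j * ((d' * d) * d ^ j)" by (simp add: wd mult.assoc)
  also have "\<dots> = pw' j * pw j" by (simp add: d'd mult.assoc)
  finally show ?case using Suc by simp
qed (simp add: ww)

lemma pw_pw': "vx w - pw j * pw' j \<in> G"
proof (induction j)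
  case 0
  then show ?case using idl_0[OF G] by (simp add: ww)
next
  case (Suc j)
  have "vx w - d * d' \<in> G" using exitless by (simp add: d_def d'_def)
  then have "pw j * (vx w - d * d') * pw' j \<in> G"
    by (rule idl_right[OF G idl_left[OF G pw_S] pw'_S])
  moreover have "pw j * (vx w - d * d') * pw' j = pw j * pw' j - pw (Suc j) * pw' (Suc j)"
  proof -
    have "pw (Suc j) * pw' (Suc j) = vx w * d ^ j * d * (vx w * d') * d' ^ j"
      by (simp only: power_Suc2[of d] power_Suc[of d'] mult.assoc)
    also have "\<dots> = pw j * d * d' * pw' j"
      by (simp add: wd mult.assoc) (simp add: mult.assoc[symmetric] wd)
    moreover have "pw j * vx w = pw j" by (simp add: mult.assoc d_pow_w ww')
    ultimately show ?thesis by (simp add: right_diff_distrib left_diff_distrib mult.assoc)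
  qed
  ultimately have "(vx w - pw j * pw' j) + (pw j * pw' j - pw (Suc j) * pw' (Suc j)) \<in> G"
    using idl_add[OF G Suc] by metis
  then show ?case by simp
qed

text \<open>Modulo \<open>G\<close> the element \<open>d\<close> is invertible in the corner. This
  is why ordinary polynomials can stand in for Laurent polynomials: negative powers are cleared by a
  power of \<open>d\<close>, which is cancelled again here.\<close>

lemma pw_cancel:
  assumes "idl J" "G \<subseteq> J" "a \<in> S" "a * vx w = a" "a * pw j \<in> J"
  shows "a \<in> J"
proof -
  have "a * (vx w - pw j * pw' j) \<in> J" using assms(2,3) pw_pw' idl_left[OF G] by blast
  moreover have "(a * pw j) * pw' j \<in> J" using idl_right[OF assms(1,5) pw'_S] .
  ultimately have "a * (vx w - pw j * pw' j) + (a * pw j) * pw' j \<in> J" by (rule idl_add[OF assms(1)])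
  then show ?thesis using assms(4) by (simp add: right_diff_distrib mult.assoc)
qed

text \<open>A nonzero closed path is at least as long as \<delta>. If it did not begin with
  \<delta>, then \<open>d'\<close> would annihilate it, so it would lie in \<open>G\<close>, and so
  would \<open>vx w\<close>. Stripping \<delta> leaves a shorter closed path.\<close>

lemma closed_path_power:
  "set \<tau> \<subseteq> A \<Longrightarrow> vx w * ep \<tau> * vx w = 0 \<or> (\<exists>j. vx w * ep \<tau> * vx w = pw j)"
proof (induction "length \<tau>" arbitrary: \<tau> rule: less_induct)
  case less
  define X where "X = vx w * ep \<tau> * vx w"
  show ?case
  proof (cases "X = 0 \<or> \<tau> = []")
    case True
    then show ?thesis by (auto simp: X_def ww intro: exI[of _ 0])
  next
    case False
    then have ne: "vx w * ep \<tau> * vx w \<noteq> 0" "\<tau> \<noteq> []" by (auto simp: X_def)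
    consider "d' * X = 0" | ds where "\<tau> = \<delta> @ ds" "X = d * (vx w * ep ds * vx w)"
      using closed_prefix[OF w \<delta>(1) less.prems shortest[OF less.prems ne(2,1)] d_neq_0]
      unfolding X_def d_def d'_def by blast
    then show ?thesis
    proof cases
      case 1
      have "ep \<tau> * vx w * gp [] \<in> S" using homogI[of \<tau> "[]" w] less.prems w homog_subset_S by auto
      then have XS: "X \<in> S" using S_mult[OF vx_S[OF w]] by (simp add: X_def mult.assoc)
      have "ep [] * vx w * gp \<tau> \<in> S" using homogI[of "[]" \<tau> w] less.prems w homog_subset_S by auto
      then have X'S: "vx w * gp \<tau> * vx w \<in> S" using S_mult[OF _ vx_S[OF w]] by simp
      have "(vx w - d * d') * X \<in> G"
        using exitless XS by (intro idl_right[OF G]) (simp_all add: d_def d'_def)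
      moreover have "(vx w - d * d') * X = X"
        using 1 by (simp add: left_diff_distrib mult.assoc) (simp add: X_def ww' mult.assoc)
      ultimately have "X \<in> G" by simp
      then have "(vx w * gp \<tau> * vx w) * X \<in> G" using X'S by (intro idl_left[OF G])
      then show ?thesis using loop_left_inverse[OF less.prems w w ne(1)] w_G by (simp add: X_def)
    next
      case 2
      have "length ds < length \<tau>" "set ds \<subseteq> A" using 2(1) \<delta>(2) less.prems by auto
      then consider "vx w * ep ds * vx w = 0" | j where "vx w * ep ds * vx w = pw j"
        using less.hyps by blast
      then show ?thesis
      proof cases
        case 1
        then show ?thesis using 2(2) by (simp add: X_def)
      next
        case b: 2
        then have "X = pw (Suc j)" using 2(2) d_pw[of j] by simp
        then show ?thesis unfolding X_def by blast
      qed
    qed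
  qed
qed

text \<open>Horner's scheme at \<open>d\<close>, with \<open>vx w\<close> as the unit of the corner
  in place of 1.\<close>

definition ev :: "'k poly \<Rightarrow> 'r" where
  "ev p = fold_coeffs (\<lambda>a y. \<kappa> a * vx w + d * y) p 0"

lemma ev_0 [simp]: "ev 0 = 0" by (simp add: ev_def)

lemma ev_pCons: "ev (pCons a p) = \<kappa> a * vx w + d * ev p"
  by (cases "p = 0 \<and> a = 0") (auto simp: ev_def \<kappa>_0)

lemma w_ev: "vx w * ev p = ev p" "ev p * vx w = ev p"
proof -
  show "vx w * ev p = ev p"
  proof (induction p)
    case (pCons a p)
    have "vx w * (d * ev p) = d * ev p" by (simp add: mult.assoc[symmetric] wd)
    then show ?case by (simp add: ev_pCons distrib_left mult_\<kappa>_left[of "vx w"] ww)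
  qed simp
  show "ev p * vx w = ev p"
    by (induction p) (simp_all add: ev_pCons distrib_right mult.assoc ww)
qed

lemma ev_S: "ev p \<in> S"
  by (induction p) (auto simp: ev_pCons intro: S_add S_mult S_scale d_S vx_S w)

lemma ev_add: "ev (p + q) = ev p + ev q"
  by (induction p q rule: poly_induct2) (simp_all add: ev_pCons \<kappa>_add distrib_left distrib_right add_ac)

lemma ev_smult: "ev (Polynomial.smult c p) = \<kappa> c * ev p"
  by (induction p) (simp_all add: ev_pCons \<kappa>_mult distrib_left mult.assoc mult_\<kappa>_left[of d])

lemma ev_1: "ev 1 = vx w" by (simp add: one_pCons ev_pCons \<kappa>_1)

lemma ev_mult: "ev (p * q) = ev p * ev q"
proof (induction p)
  case (pCons a p)
  have "ev (pCons a p * q) = \<kappa> a * ev q + (\<kappa> 0 * vx w + d * ev (p * q))"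
    by (simp add: ev_add ev_smult ev_pCons)
  also have "\<dots> = \<kappa> a * (vx w * ev q) + d * ev p * ev q"
    by (simp add: pCons w_ev \<kappa>_0 mult.assoc)
  finally show ?case by (simp add: ev_pCons distrib_right mult.assoc)
qed simp

lemma ev_commute: "ev p * ev q = ev q * ev p"
  by (metis ev_mult mult.commute)

lemma ev_monom: "ev (monom 1 j) = pw j"
  by (induction j) (simp_all add: monom_0 monom_Suc ev_pCons \<kappa>_1 \<kappa>_0 d_pw)

lemma hc_ev_neg: "n < 0 \<Longrightarrow> hc n (ev p) = 0"
proof (induction p arbitrary: n)
  case (pCons a p)
  have "hc n (ev (pCons a p)) = hc n (\<kappa> a * vx w) + hc n (d * ev p)"
    unfolding ev_pCons by (intro hc_add S_scale S_mult vx_S w d_S ev_S)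
  also have "hc n (\<kappa> a * vx w) = 0"
    using hc_homog[OF homog_scale[OF vx_homog0[OF w]], of n a] pCons.prems by simp
  also have "hc n (d * ev p) = 0"
    using hc_mult_left[OF d_homog ev_S] pCons by simp
  finally show ?case by simp
qed simp

text \<open>Polynomials in \<open>d\<close> remain independent modulo \<open>G\<close> since
  \<open>G\<close> is graded: the component of degree 0 isolates the constant term, and
  \<open>d'\<close> shifts the remaining polynomial down.\<close>

lemma ev_in_G: "ev p \<in> G \<Longrightarrow> p = 0"
proof (induction p)
  case (pCons a p)
  have "hc 0 (ev (pCons a p)) = hc 0 (\<kappa> a * vx w) + hc 0 (d * ev p)"
    unfolding ev_pCons by (intro hc_add S_scale S_mult vx_S w d_S ev_S)
  also have "hc 0 (\<kappa> a * vx w) = \<kappa> a * vx w"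
    using hc_homog[OF homog_scale[OF vx_homog0[OF w]], of 0 a] by simp
  also have "hc 0 (d * ev p) = 0"
    using hc_mult_left[OF d_homog ev_S] hc_ev_neg \<delta>(2) by simp
  finally have "\<kappa> a * vx w \<in> G"
    using graded_hc[OF graded_G pCons.prems, of 0] by simp
  then have a: "a = 0" using idl_unscale[OF G] w_G by blast
  then have "d * ev p \<in> G" using pCons.prems by (simp add: ev_pCons \<kappa>_0)
  then have "d' * (d * ev p) \<in> G" by (rule idl_left[OF G d'_S])
  then have "ev p \<in> G" by (simp add: mult.assoc[symmetric] d'd w_ev)
  then show ?case using a pCons by simp
qed simp

lemma pw_path: "pw n = vx w * ep (concat (replicate n \<delta>)) * vx w"
proof (induction n)
  case (Suc n)
  have *: "vx w * ep \<delta> * vx w = vx w * ep \<delta>"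
    using ep_vx[OF w \<delta>] d_neq_0 by (auto simp: mult.assoc split: if_splits)
  have "pw (Suc n) = d * pw n" by (simp add: d_pw)
  also have "\<dots> = vx w * ep \<delta> * vx w * (vx w * ep (concat (replicate n \<delta>)) * vx w)"
    using Suc by (simp add: d_def)
  also have "\<dots> = (vx w * ep \<delta> * vx w) * ep (concat (replicate n \<delta>)) * vx w"
    by (simp add: mult.assoc ww')
  finally show ?case by (simp only: *) (simp add: mult.assoc)
qed (simp add: ww)

text \<open>A high power of \<open>d\<close> consumes all ghost edges of \<open>t\<close>, and the
  closed paths that remain are powers of \<open>d\<close>. The equation is exact and not only modulo
  \<open>G\<close>. It is claimed for all large exponents so that the finitely many terms of
  \<open>t\<close> can share one.\<close>

lemma corner_poly: "t \<in> S \<Longrightarrow> \<exists>N0. \<forall>N\<ge>N0. \<exists>p. vx w * t * pw N = ev p"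
  unfolding S_def
proof (induction rule: lspan.induct)
  case zero
  show ?case by (rule exI[of _ 0]) (auto intro: exI[of _ 0])
next
  case (add b x c)
  obtain n M where "b \<in> monomials n M" using add(1) by blast
  then obtain as bs z where b: "b = ep as * vx z * gp bs" "set as \<subseteq> A" "set bs \<subseteq> A" "z \<in> V"
    by (auto elim!: monomials.cases)
  obtain N0 where N0: "\<forall>N\<ge>N0. \<exists>p. vx w * x * pw N = ev p" using add.IH by (elim exE)
  show ?case
  proof (intro exI[of _ "max N0 (length bs)"] allI impI)
    fix N assume N: "max N0 (length bs) \<le> N"
    define \<gamma> where "\<gamma> = concat (replicate N \<delta>)"
    have \<gamma>: "set \<gamma> \<subseteq> A" using \<delta>(1) by (auto simp: \<gamma>_def)
    have "length \<gamma> = N * length \<delta>" by (simp add: \<gamma>_def length_concat sum_list_replicate)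
    moreover have "N \<le> N * length \<delta>" using \<delta>(2) by (cases \<delta>) auto
    ultimately have len: "length bs \<le> length \<gamma>" using N by linarith
    have eq: "vx w * b * pw N = vx w * ep as * (vx z * gp bs * (vx w * ep \<gamma> * vx w))"
      unfolding b(1) pw_path \<gamma>_def by (simp add: mult.assoc)
    have "\<exists>q. vx w * b * pw N = ev q"
    proof -
      consider "vx z * gp bs * (vx w * ep \<gamma> * vx w) = 0"
        | ds where "\<gamma> = bs @ ds" "vx z * gp bs * (vx w * ep \<gamma> * vx w) = vx z * ep ds * vx w"
        using ghost_path_cancel[OF b(3) \<gamma> len b(4) w w] by blast
      then show ?thesis
      proof cases
        case 1
        then show ?thesis using eq by (intro exI[of _ 0]) simp
      next
        case 2
        then have ds: "set ds \<subseteq> A" using \<gamma> by auto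
        have "vx w * b * pw N = vx w * (ep as * vx z * ep ds * vx w)"
          using eq 2(2) by (simp add: mult.assoc)
        then consider "vx w * b * pw N = 0" | "vx w * b * pw N = vx w * ep (as @ ds) * vx w"
          using path_compose[OF b(2) ds b(4) w] by (auto simp: mult.assoc)
        then show ?thesis
        proof cases
          case 1
          then show ?thesis by (intro exI[of _ 0]) simp
        next
          case c: 2
          have "set (as @ ds) \<subseteq> A" using b(2) ds by simp
          then consider "vx w * ep (as @ ds) * vx w = 0" | j where "vx w * ep (as @ ds) * vx w = pw j"
            using closed_path_power by blast
          then show ?thesis
          proof cases
            case 1
            then show ?thesis using c by (intro exI[of _ 0]) simp
          next
            case (2 j)
            then show ?thesis using c by (intro exI[of _ "monom 1 j"]) (simp add: ev_monom)
          qed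
        qed
      qed
    qed
    then obtain q where q: "vx w * b * pw N = ev q" by blast
    obtain p where p: "vx w * x * pw N = ev p" using N0 N by auto
    have "vx w * (\<kappa> c * b + x) * pw N = \<kappa> c * (vx w * b * pw N) + vx w * x * pw N"
      by (simp add: distrib_left distrib_right mult_\<kappa>_left mult.assoc)
    then have "vx w * (\<kappa> c * b + x) * pw N = ev (Polynomial.smult c q + p)"
      using p q by (simp add: ev_add ev_smult)
    then show "\<exists>p. vx w * (\<kappa> c * b + x) * pw N = ev p" by blast
  qed
qed

text \<open>\<open>pw N\<close> commutes with \<open>ev p\<close>, so its inverse does so modulo
  \<open>G\<close>; the defect is a multiple of \<open>vx w - pw N * pw' N\<close>.\<close>

lemma ev_pw'_commute: "ev p * pw' N - pw' N * ev p \<in> G"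
proof -
  have "ev p * pw' N = vx w * ev p * pw' N" by (simp add: w_ev)
  also have "\<dots> = pw' N * (pw N * ev p) * pw' N"
    by (subst pw'_pw[of N, symmetric]) (simp add: mult.assoc)
  also have "pw N * ev p = ev p * pw N" using ev_commute[of "monom 1 N" p] by (simp add: ev_monom)
  finally have "ev p * pw' N - pw' N * ev p = - (pw' N * ev p * (vx w - pw N * pw' N))"
    by (simp add: right_diff_distrib mult.assoc w_ev)
  moreover have "- (pw' N * ev p * (vx w - pw N * pw' N)) \<in> G"
    by (rule idl_minus[OF G idl_left[OF G S_mult[OF pw'_S ev_S] pw_pw']])
  ultimately show ?thesis by simp
qed

end

section \<open>Prime ideals\<close>

context graded_leavitt_family
begin

text \<open>Primeness by elements is the form that the arguments in corners consume. It is derived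
  from primeness by ideals through principal ideals.\<close>

definition prime_idl :: "'r set \<Rightarrow> bool" where
  "prime_idl P \<longleftrightarrow> idl P \<and> P \<noteq> S \<and>
    (\<forall>a\<in>S. \<forall>b\<in>S. (\<forall>s\<in>S. a * s * b \<in> P) \<longrightarrow> a \<in> P \<or> b \<in> P)"

lemma prime_idlD: "prime_idl P \<Longrightarrow> a \<in> S \<Longrightarrow> b \<in> S \<Longrightarrow> (\<And>s. s \<in> S \<Longrightarrow> a * s * b \<in> P) \<Longrightarrow> a \<in> P \<or> b \<in> P"
  unfolding prime_idl_def by blast

lemma prime_idl_idl: "prime_idl P \<Longrightarrow> idl P" by (simp add: prime_idl_def)

text \<open>For homogeneous \<open>q\<close> this is the span of S q S. Homogeneous factors on both
  sides make it visible that the ideal is graded.\<close>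

definition gen :: "'r \<Rightarrow> 'r set" where
  "gen q = lspan {a * q * b | a b. \<exists>i j. a \<in> homog i \<and> b \<in> homog j}"

lemma graded_gen: assumes q: "q \<in> homog n" shows "graded (gen q)"
proof -
  define B where "B = {a * q * b | a b. \<exists>i j. a \<in> homog i \<and> b \<in> homog j}"
  have Bh: "\<exists>m. y \<in> homog m" if "y \<in> B" for y
    using that homog_mult[OF homog_mult[OF _ q]] unfolding B_def by blast
  then have BS: "B \<subseteq> S" using homog_subset_S by blast
  have sub: "lspan B \<subseteq> S" using BS lspan_subset[of B "\<Union>n N. monomials n N"] by (simp add: S_def)
  have l: "t * x \<in> lspan B" if t: "t \<in> S" and x: "x \<in> lspan B" for t x
    using t
  proof (induction rule: S_induct)
    case (add m c t)
    have "c * x \<in> lspan B"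
    proof (rule lspan_mult_left[OF x])
      fix y assume "y \<in> B"
      then obtain a b i j where y: "y = a * q * b" "a \<in> homog i" "b \<in> homog j" unfolding B_def by blast
      have "c * y = (c * a) * q * b" by (simp add: y(1) mult.assoc)
      then have "c * y \<in> B" using homog_mult[OF add(1) y(2)] y(3) unfolding B_def by blast
      then show "c * y \<in> lspan B" by (rule lspan_base)
    qed
    then show ?case using add by (simp add: distrib_right lspan_add)
  qed (simp add: lspan.zero)
  have r: "x * t \<in> lspan B" if t: "t \<in> S" and x: "x \<in> lspan B" for t x
    using t
  proof (induction rule: S_induct)
    case (add m c t)
    have "x * c \<in> lspan B"
    proof (rule lspan_mult_right[OF x])
      fix y assume "y \<in> B"
      then obtain a b i j where y: "y = a * q * b" "a \<in> homog i" "b \<in> homog j" unfolding B_def by blast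
      have "y * c = a * q * (b * c)" by (simp add: y(1) mult.assoc)
      then have "y * c \<in> B" using homog_mult[OF y(3) add(1)] y(2) unfolding B_def by blast
      then show "y * c \<in> lspan B" by (rule lspan_base)
    qed
    then show ?case using add by (simp add: distrib_left lspan_add)
  qed (simp add: lspan.zero)
  have I: "idl (lspan B)" using sub l r by (intro idlI) (auto intro: lspan.zero lspan_add)
  have "hc k x \<in> lspan B" if "x \<in> lspan B" for k x
    using that
  proof (induction rule: lspan.induct)
    case (add b x c)
    obtain m where m: "b \<in> homog m" using Bh add(1) by blast
    have "hc k (\<kappa> c * b + x) = hc k (\<kappa> c * b) + hc k x"
      using add BS sub by (intro hc_add S_scale) auto
    moreover have "hc k (\<kappa> c * b) = (if k = m then \<kappa> c * b else 0)"
      by (rule hc_homog[OF homog_scale[OF m]])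
    ultimately show ?case using add lspan_add[OF lspan_scale[OF lspan_base]]
      by (auto split: if_splits)
  qed (simp add: lspan.zero)
  then show ?thesis using I unfolding graded_def gen_def B_def by blast
qed

lemma mem_gen: assumes q: "q \<in> homog 0" "q * q = q" and x: "x \<in> S" shows "x * q \<in> gen q"
proof -
  have "q * q * q \<in> gen q" unfolding gen_def using q(1) by (intro lspan_base) blast
  then have "q \<in> gen q" using q(2) by simp
  then show ?thesis using graded_idl[OF graded_gen[OF q(1)]] x by (intro idl_left)
qed

end

text \<open>In the application \<open>G\<close> is \<open>gr P\<close>. The element in
  \<open>corner_P\<close> ensures that \<open>P\<close> contains a nonzero polynomial in
  \<open>d\<close>.\<close>

locale prime_at_cycle = exitless_cycle V A src rng \<kappa> vx ed gh hc G w \<delta>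
  for V :: "'v set" and A :: "'e set" and src rng :: "'e \<Rightarrow> 'v"
    and \<kappa> :: "'k::field \<Rightarrow> 'r::ring_1" and vx :: "'v \<Rightarrow> 'r" and ed gh :: "'e \<Rightarrow> 'r"
    and hc :: "int \<Rightarrow> 'r \<Rightarrow> 'r" and G :: "'r set" and w :: 'v and \<delta> :: "'e list" +
  fixes P :: "'r set"
  assumes prime_P: "prime_idl P" and G_P: "G \<subseteq> P" and w_P: "vx w \<notin> P"
    and corner_P: "\<exists>b\<in>P. b \<notin> G \<and> vx w * b * vx w = b"
begin

lemma P: "idl P" using prime_P by (rule prime_idl_idl)
lemmas P_S = idl_S[OF P]

text \<open>Up to a power of \<open>d\<close> the corner is commutative: for every \<open>s\<close>,
  the product \<open>ev p * s * ev q * pw N\<close> is a multiple of \<open>ev (p * q)\<close>, and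
  the power of \<open>d\<close> can be cancelled.\<close>

lemma ev_prod_P: assumes "ev (p * q) \<in> P" shows "ev p \<in> P \<or> ev q \<in> P"
proof (rule prime_idlD[OF prime_P ev_S ev_S])
  fix s assume s: "s \<in> S"
  obtain N h where h: "vx w * s * pw N = ev h" using corner_poly[OF s] by blast
  have "ev p * s * ev q * pw N = ev p * (vx w * s * pw N) * ev q"
  proof -
    have "ev q * pw N = pw N * ev q" using ev_commute[of q "monom 1 N"] by (simp add: ev_monom)
    then have "ev p * s * ev q * pw N = ev p * s * (pw N * ev q)" by (simp add: mult.assoc)
    also have "\<dots> = ev p * vx w * s * (pw N * ev q)" by (simp add: w_ev)
    finally show ?thesis by (simp add: mult.assoc)
  qed
  also have "\<dots> = ev p * ev h * ev q" by (simp only: h)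
  also have "\<dots> = ev (h * (p * q))" by (simp only: ev_mult ev_commute[of p h] mult.assoc)
  also have "\<dots> \<in> P" unfolding ev_mult[of h] by (rule idl_left[OF P ev_S assms])
  finally show "ev p * s * ev q \<in> P"
    by (rule pw_cancel[OF P G_P S_mult[OF S_mult[OF ev_S s] ev_S], rotated])
      (simp add: mult.assoc w_ev)
qed

lemma ex_generator: "\<exists>f. f \<noteq> 0 \<and> (\<forall>p. ev p \<in> P \<longleftrightarrow> f dvd p)"
proof -
  obtain b where b: "b \<in> P" "b \<notin> G" "vx w * b * vx w = b" using corner_P by blast
  obtain N p where p: "vx w * b * pw N = ev p" using corner_poly[OF P_S[OF b(1)]] by blast
  have bS: "b \<in> S" using P_S b by blast
  have bw: "b * vx w = b" using b(3) by (metis mult.assoc ww)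
  have wb: "vx w * b = b" using b(3) by (metis mult.assoc ww)
  have "b * pw N \<notin> G"
    using pw_cancel[OF G order_refl bS bw] b(2) by blast
  then have "p \<noteq> 0" using p idl_0[OF G] by (auto simp: wb)
  moreover have "ev p \<in> P" unfolding p[symmetric]
    using idl_right[OF P idl_left[OF P vx_S[OF w] b(1)] pw_S] .
  ultimately have ex: "\<exists>p. ev p \<in> P \<and> p \<noteq> 0" by blast
  define f where "f = arg_min degree (\<lambda>p. ev p \<in> P \<and> p \<noteq> 0)"
  have f: "ev f \<in> P" "f \<noteq> 0" and least: "\<And>p. ev p \<in> P \<Longrightarrow> p \<noteq> 0 \<Longrightarrow> degree f \<le> degree p"
    unfolding f_def using arg_min_nat_lemma[of "\<lambda>p. ev p \<in> P \<and> p \<noteq> 0" _ degree] ex by auto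
  have "f dvd p" if p: "ev p \<in> P" for p
  proof -
    have "ev p = ev (p div f * f) + ev (p mod f)" by (simp flip: ev_add)
    then have "ev (p mod f) = ev p - ev (p div f) * ev f" by (simp add: ev_mult)
    also have "\<dots> \<in> P" by (rule idl_diff[OF P p idl_left[OF P ev_S f(1)]])
    finally have "p mod f = 0"
      using least[of "p mod f"] degree_mod_less[OF f(2), of p] by fastforce
    then show ?thesis by (simp add: mod_eq_0_iff_dvd)
  qed
  moreover have "ev p \<in> P" if "f dvd p" for p
    using that idl_right[OF P f(1) ev_S] by (auto simp: ev_mult elim!: dvdE)
  ultimately show ?thesis using f(2) by blast
qed

section \<open>The prime polynomial and its valuation\<close>

definition f :: "'k poly" where "f = (SOME f. f \<noteq> 0 \<and> (\<forall>p. ev p \<in> P \<longleftrightarrow> f dvd p))"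

lemma f_0: "f \<noteq> 0" and ev_P_iff: "ev p \<in> P \<longleftrightarrow> f dvd p"
proof -
  have *: "f \<noteq> 0 \<and> (\<forall>p. ev p \<in> P \<longleftrightarrow> f dvd p)"
    unfolding f_def by (rule someI_ex[OF ex_generator])
  show "f \<noteq> 0" by (rule conjunct1[OF *])
  show "ev p \<in> P \<longleftrightarrow> f dvd p" by (rule spec[OF conjunct2[OF *]])
qed

lemma f_prime: "f dvd p * q \<Longrightarrow> f dvd p \<or> f dvd q"
  using ev_prod_P[of p q] by (simp only: ev_P_iff)

lemma f_not_dvd_1: "\<not> f dvd 1"
  using w_P ev_P_iff[of 1] by (simp add: ev_1)

lemma f_not_dvd_monom: "\<not> f dvd monom 1 j"
proof
  assume "f dvd monom 1 j"
  then have "ev (monom 1 j) \<in> P" by (simp only: ev_P_iff)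
  then have "pw j \<in> P" by (simp only: ev_monom)
  then have "pw' j * pw j \<in> P" by (rule idl_left[OF P pw'_S])
  then show False using w_P by (simp only: pw'_pw)
qed

text \<open>Primeness, applied on both sides, moves an element of \<open>J\<close> into the corner
  at \<open>w\<close> while it stays outside \<open>P\<close>. A power of \<open>d\<close> makes it
  a polynomial and, being cancellable, cannot bring it into \<open>P\<close>.\<close>

lemma corner_meets:
  assumes J: "idl J" and not: "\<not> J \<subseteq> P"
  shows "\<exists>p. ev p \<in> J \<and> \<not> f dvd p"
proof -
  obtain z where z: "z \<in> J" "z \<notin> P" using not by blast
  have zS: "z \<in> S" using idl_S[OF J z(1)] .
  obtain s where s: "s \<in> S" "vx w * s * z \<notin> P"
    using prime_idlD[OF prime_P vx_S[OF w] zS] w_P z(2) by blast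
  have S: "vx w * s * z \<in> S" using s(1) zS vx_S[OF w] by (intro S_mult)
  obtain t where t: "t \<in> S" "vx w * s * z * t * vx w \<notin> P"
    using prime_idlD[OF prime_P S vx_S[OF w]] w_P s(2) by blast
  define y where "y = vx w * s * z * t * vx w"
  have yJ: "y \<in> J" unfolding y_def using s t vx_S[OF w] z(1)
    by (intro idl_right[OF J] idl_left[OF J] S_mult)
  have yS: "y \<in> S" using idl_S[OF J yJ] .
  obtain N p where p: "vx w * y * pw N = ev p" using corner_poly[OF yS] by blast
  have yw: "y * vx w = y" "vx w * y = y" by (simp_all add: y_def mult.assoc ww ww')
  have yp: "y * pw N = ev p" using p yw by simp
  have "y * pw N \<notin> P" using pw_cancel[OF P G_P yS yw(1)] t(2) unfolding y_def by blast
  then have "\<not> f dvd p" using yp ev_P_iff by simp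
  moreover have "ev p \<in> J" using idl_right[OF J yJ pw_S, of N] yp by simp
  ultimately show ?thesis by blast
qed

text \<open>The f-adic filtration of the left module S w modulo \<open>G\<close>, carried over to
  the elements that act on it. The quantifier over \<open>t\<close> covers all of S w and not only
  the corner, so that products with arbitrary elements of \<open>S\<close> are under
  control.\<close>

definition N :: "nat \<Rightarrow> 'r set" where
  "N s = {x \<in> S. \<forall>t\<in>S. \<exists>y\<in>S. x * t * vx w - y * ev (f ^ s) \<in> G}"

definition E :: "nat \<Rightarrow> 'r set" where
  "E s = {ev (f ^ s * h) | h. \<not> f dvd h}"

lemma N_0: "N 0 = S"
proof -
  have "\<exists>y\<in>S. x * t * vx w - y * ev (f ^ 0) \<in> G" if "x \<in> S" "t \<in> S" for x t
    using that idl_0[OF G] by (intro bexI[of _ "x * t"]) (auto simp: ev_1 intro: S_mult)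
  then show ?thesis by (auto simp: N_def)
qed

text \<open>A power of \<open>d\<close> turns \<open>z\<close> into a polynomial in
  \<open>P\<close>, which is a multiple of \<open>f\<close>. The matching power of \<open>d'\<close>
  restores \<open>z\<close> modulo \<open>G\<close>, and it commutes with \<open>ev f\<close> modulo
  \<open>G\<close>.\<close>

lemma corner_P_multiple:
  assumes z: "z \<in> P" "vx w * z = z" "z * vx w = z"
  shows "\<exists>y\<in>S. z - y * ev f \<in> G"
proof -
  obtain M p where p: "vx w * z * pw M = ev p" using corner_poly[OF P_S[OF z(1)]] by blast
  have zp: "z * pw M = ev p" using p z(2) by simp
  then have "ev p \<in> P" using idl_right[OF P z(1) pw_S, of M] by simp
  then obtain h where h: "p = f * h" using ev_P_iff by (auto elim: dvdE)
  have "z * (vx w - pw M * pw' M) \<in> G" using P_S[OF z(1)] pw_pw' by (rule idl_left[OF G])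
  then have 1: "z - ev p * pw' M \<in> G" using z(3) zp by (simp add: right_diff_distrib mult.assoc[symmetric])
  have "ev p = ev h * ev f" by (simp add: h ev_mult ev_commute)
  moreover have "ev h * (ev f * pw' M - pw' M * ev f) \<in> G"
    by (rule idl_left[OF G ev_S ev_pw'_commute])
  ultimately have 2: "ev p * pw' M - (ev h * pw' M) * ev f \<in> G"
    by (simp add: right_diff_distrib mult.assoc)
  have "z - (ev h * pw' M) * ev f \<in> G" using idl_add[OF G 1 2] by simp
  then show ?thesis using S_mult[OF ev_S pw'_S] by blast
qed

text \<open>The element z = x t w need not lie in the corner. But it lies in the graded ideal
  generated by \<open>vx w\<close>, so it has a left unit that is a combination of products a w a'
  there. Each w a' z lies in \<open>P\<close> and in the corner, where
  \<open>corner_P_multiple\<close> applies.\<close>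

lemma P_subset_N_1: "P \<subseteq> N 1"
proof
  fix x assume x: "x \<in> P"
  have "\<exists>y\<in>S. x * t * vx w - y * ev f \<in> G" if t: "t \<in> S" for t
  proof -
    define z where "z = x * t * vx w"
    have zP: "z \<in> P" unfolding z_def by (rule idl_right[OF P idl_right[OF P x t] vx_S[OF w]])
    have zw: "z * vx w = z" by (simp add: z_def mult.assoc ww)
    have "z \<in> gen (vx w)"
      unfolding z_def using mem_gen[OF vx_homog0[OF w] ww S_mult[OF P_S[OF x] t]] .
    then obtain u where u: "u \<in> gen (vx w)" "u * z = z"
      using graded_left_unit[OF graded_gen[OF vx_homog0[OF w]]] by blast
    have "\<exists>y\<in>S. u * z - y * ev f \<in> G"
      using u(1) unfolding gen_def
    proof (induction rule: lspan.induct)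
      case zero
      show ?case using idl_0[OF G] by (intro bexI[of _ 0]) auto
    next
      case (add b v c)
      then obtain a a' i j where b: "b = a * vx w * a'" "a \<in> homog i" "a' \<in> homog j" by blast
      have aS: "a \<in> S" "a' \<in> S" using b homog_subset_S by blast+
      obtain y1 where y1: "y1 \<in> S" "v * z - y1 * ev f \<in> G" using add.IH by blast
      obtain y2 where y2: "y2 \<in> S" "vx w * a' * z - y2 * ev f \<in> G"
        using corner_P_multiple[OF idl_left[OF P S_mult[OF vx_S[OF w] aS(2)] zP]] zw
        by (auto simp: mult.assoc ww')
      have "\<kappa> c * (a * (vx w * a' * z - y2 * ev f)) + (v * z - y1 * ev f) \<in> G"
        by (rule idl_add[OF G idl_scale[OF G idl_left[OF G aS(1) y2(2)]] y1(2)])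
      moreover have "\<kappa> c * (a * (vx w * a' * z - y2 * ev f)) + (v * z - y1 * ev f)
        = (\<kappa> c * b + v) * z - (\<kappa> c * (a * y2) + y1) * ev f"
        by (simp add: b(1) right_diff_distrib distrib_right mult.assoc)
      moreover have "\<kappa> c * (a * y2) + y1 \<in> S" using aS y1 y2 by (intro S_add S_scale S_mult)
      ultimately show ?case by metis
    qed
    then show ?thesis using u(2) by (simp add: z_def)
  qed
  then show "x \<in> N 1" using P_S[OF x] by (simp add: N_def)
qed

lemma N_Suc_subset: "N (Suc s) \<subseteq> N s"
proof
  fix x assume x: "x \<in> N (Suc s)"
  have "\<exists>y\<in>S. x * t * vx w - y * ev (f ^ s) \<in> G" if t: "t \<in> S" for t
  proof -
    obtain y where y: "y \<in> S" "x * t * vx w - y * ev (f ^ Suc s) \<in> G"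
      using x t by (auto simp: N_def)
    have "y * ev (f ^ Suc s) = (y * ev f) * ev (f ^ s)" by (simp add: ev_mult mult.assoc)
    then show ?thesis using y S_mult[OF y(1) ev_S, of f] by (intro bexI[of _ "y * ev f"]) simp_all
  qed
  then show "x \<in> N s" using x by (simp add: N_def)
qed

lemma N_add: assumes "x \<in> N s" "x' \<in> N s" shows "x + x' \<in> N s"
proof -
  have "\<exists>y\<in>S. (x + x') * t * vx w - y * ev (f ^ s) \<in> G" if t: "t \<in> S" for t
  proof -
    obtain y where y: "y \<in> S" "x * t * vx w - y * ev (f ^ s) \<in> G" using assms(1) t by (auto simp: N_def)
    obtain y' where y': "y' \<in> S" "x' * t * vx w - y' * ev (f ^ s) \<in> G" using assms(2) t by (auto simp: N_def)
    have "(x * t * vx w - y * ev (f ^ s)) + (x' * t * vx w - y' * ev (f ^ s)) \<in> G"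
      by (rule idl_add[OF G y(2) y'(2)])
    then have "(x + x') * t * vx w - (y + y') * ev (f ^ s) \<in> G" by (simp add: distrib_right algebra_simps)
    then show ?thesis using S_add[OF y(1) y'(1)] by blast
  qed
  then show ?thesis using assms by (auto simp: N_def intro: S_add)
qed

lemma N_mult: assumes a: "a \<in> S" and x: "x \<in> N s" shows "a * x \<in> N s"
proof -
  have "\<exists>y\<in>S. a * x * t * vx w - y * ev (f ^ s) \<in> G" if t: "t \<in> S" for t
  proof -
    obtain y where y: "y \<in> S" "x * t * vx w - y * ev (f ^ s) \<in> G" using x t by (auto simp: N_def)
    have "a * (x * t * vx w - y * ev (f ^ s)) \<in> G" by (rule idl_left[OF G a y(2)])
    then have "a * x * t * vx w - (a * y) * ev (f ^ s) \<in> G" by (simp add: right_diff_distrib mult.assoc)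
    then show ?thesis using S_mult[OF a y(1)] by blast
  qed
  then show ?thesis using a x by (auto simp: N_def intro: S_mult)
qed

text \<open>Modulo \<open>G\<close>, n t w = y f^s and x y w = y' f, hence x n t w = y' f^(s+1). The
  second equation is the membership of \<open>x\<close> in \<open>N 1\<close>, used at the element
  \<open>y\<close>.\<close>

lemma P_mult_N: assumes x: "x \<in> P" and n: "n \<in> N s" shows "x * n \<in> N (Suc s)"
proof -
  have xS: "x \<in> S" using P_S[OF x] .
  have "\<exists>y\<in>S. x * n * t * vx w - y * ev (f ^ Suc s) \<in> G" if t: "t \<in> S" for t
  proof -
    obtain y where y: "y \<in> S" "n * t * vx w - y * ev (f ^ s) \<in> G" using n t by (auto simp: N_def)
    obtain y' where y': "y' \<in> S" "x * y * vx w - y' * ev f \<in> G"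
      using P_subset_N_1 x y(1) by (auto simp: N_def)
    have "x * (n * t * vx w - y * ev (f ^ s)) + (x * y * vx w - y' * ev f) * ev (f ^ s) \<in> G"
      by (rule idl_add[OF G idl_left[OF G xS y(2)] idl_right[OF G y'(2) ev_S]])
    moreover have "x * (n * t * vx w - y * ev (f ^ s)) + (x * y * vx w - y' * ev f) * ev (f ^ s)
      = x * n * t * vx w - y' * ev (f ^ Suc s)"
      by (simp add: right_diff_distrib left_diff_distrib mult.assoc w_ev ev_mult)
    ultimately show ?thesis using y'(1) by metis
  qed
  then show ?thesis using xS n by (auto simp: N_def intro: S_mult)
qed

lemma P_meets_E_1: "\<exists>x. x \<in> P \<and> x \<in> E 1"
proof -
  have "ev (f ^ 1 * 1) \<in> E 1" unfolding E_def using f_not_dvd_1 by blast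
  then show ?thesis using ev_P_iff[of f] by auto
qed

lemma meets_E_0: "idl J \<Longrightarrow> \<not> J \<subseteq> P \<Longrightarrow> \<exists>x. x \<in> J \<and> x \<in> E 0"
  using corner_meets[of J] by (auto simp: E_def)

lemma E_mult: assumes "x \<in> E s" "y \<in> E t" shows "x * y \<in> E (s + t)"
proof -
  obtain h k where h: "x = ev (f ^ s * h)" "\<not> f dvd h" and k: "y = ev (f ^ t * k)" "\<not> f dvd k"
    using assms by (auto simp: E_def)
  have "x * y = ev (f ^ (s + t) * (h * k))"
    by (simp add: h k power_add ac_simps flip: ev_mult)
  then show ?thesis using f_prime h k by (auto simp: E_def)
qed

text \<open>The choice t = w and a power of \<open>d\<close> produce an element of \<open>G\<close>
  that is a polynomial in \<open>d\<close>, hence the zero polynomial. After cancelling f^s, the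
  prime \<open>f\<close> divides h X^M, but neither \<open>h\<close> nor X^M, because
  \<open>d\<close> is left invertible and \<open>vx w\<close> is not in \<open>P\<close>.\<close>

lemma E_disjoint: "E s \<inter> N (Suc s) = {}"
proof (rule ccontr)
  assume "E s \<inter> N (Suc s) \<noteq> {}"
  then obtain h where h: "\<not> f dvd h" "ev (f ^ s * h) \<in> N (Suc s)" by (auto simp: E_def)
  obtain y where y: "y \<in> S" "ev (f ^ s * h) * vx w * vx w - y * ev (f ^ Suc s) \<in> G"
    using h(2) vx_S[OF w] by (auto simp: N_def)
  obtain M g where g: "vx w * y * pw M = ev g" using corner_poly[OF y(1)] by blast
  have "vx w * (ev (f ^ s * h) * vx w * vx w - y * ev (f ^ Suc s)) * pw M \<in> G"
    by (rule idl_right[OF G idl_left[OF G vx_S[OF w] y(2)] pw_S])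
  moreover have "vx w * (ev (f ^ s * h) * vx w * vx w - y * ev (f ^ Suc s)) * pw M
    = ev (f ^ s * h * monom 1 M - g * f ^ Suc s)"
  proof -
    have "vx w * (ev (f ^ s * h) * vx w * vx w - y * ev (f ^ Suc s)) * pw M
      = ev (f ^ s * h) * pw M - vx w * y * (ev (f ^ Suc s) * pw M)"
      by (simp add: right_diff_distrib left_diff_distrib mult.assoc) (simp add: w_ev mult.assoc[symmetric])
    also have "ev (f ^ Suc s) * pw M = pw M * ev (f ^ Suc s)"
      using ev_commute[of "f ^ Suc s" "monom 1 M"] by (simp only: ev_monom)
    also have "vx w * y * (pw M * ev (f ^ Suc s)) = ev (g * f ^ Suc s)"
      by (simp only: ev_mult g[symmetric] mult.assoc)
    also have "ev (f ^ s * h) * pw M = ev (f ^ s * h * monom 1 M)"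
      by (simp only: ev_mult ev_monom)
    finally show ?thesis
      using ev_add[of "f ^ s * h * monom 1 M - g * f ^ Suc s" "g * f ^ Suc s"] by (simp add: algebra_simps)
  qed
  ultimately have "f ^ s * h * monom 1 M - g * f ^ Suc s = 0" using ev_in_G by metis
  then have "f ^ s * (h * monom 1 M) = f ^ s * (g * f)" by (simp add: ac_simps)
  then have "h * monom 1 M = g * f" using f_0 by simp
  then have "f dvd h * monom 1 M" by simp
  then show False using f_prime h(1) f_not_dvd_monom by blast
qed

text \<open>The polynomials of \<open>Q\<close> form an ideal (g) strictly above (f). From f = g h,
  where \<open>f\<close> does not divide \<open>g\<close>, it follows that \<open>f\<close> divides
  \<open>h\<close>, so \<open>g\<close> is a unit: nonzero prime ideals of K[X] are maximal.\<close>

lemma larger_prime: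
  assumes Q: "prime_idl Q" and PQ: "P \<subset> Q"
  shows "vx w \<in> Q"
proof -
  note QI = prime_idl_idl[OF Q]
  obtain p where p: "ev p \<in> Q" "\<not> f dvd p" using corner_meets[OF QI] PQ by blast
  obtain g where g: "g \<noteq> 0" "ev g \<in> Q" "\<And>q. q \<noteq> 0 \<Longrightarrow> ev q \<in> Q \<Longrightarrow> degree g \<le> degree q"
  proof -
    have "\<exists>q. q \<noteq> 0 \<and> ev q \<in> Q" using p by (intro exI[of _ p]) auto
    then show ?thesis
      using that arg_min_nat_lemma[of "\<lambda>q. q \<noteq> 0 \<and> ev q \<in> Q" _ degree] by blast
  qed
  have div: "g dvd q" if q: "ev q \<in> Q" for q
  proof -
    have "ev q = ev (q div g * g) + ev (q mod g)" by (simp flip: ev_add)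
    then have "ev (q mod g) = ev q - ev (q div g) * ev g" by (simp add: ev_mult)
    also have "\<dots> \<in> Q" by (rule idl_diff[OF QI q idl_left[OF QI ev_S g(2)]])
    finally have "q mod g = 0"
      using g(3)[of "q mod g"] degree_mod_less[OF g(1), of q] by fastforce
    then show ?thesis by (simp add: mod_eq_0_iff_dvd)
  qed
  have "ev f \<in> Q" using ev_P_iff[of f] PQ by auto
  then obtain h where h: "f = g * h" using div by (auto elim: dvdE)
  then have "f dvd g * h" by simp
  moreover have "\<not> f dvd g" using p(2) div[OF p(1)] dvd_trans by blast
  ultimately have "f dvd h" using f_prime by blast
  then have "g * h dvd 1 * h" using h by simp
  moreover have "h \<noteq> 0" using h f_0 by auto
  ultimately have "g dvd 1" using dvd_times_right_cancel_iff by blast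
  then obtain k where "1 = g * k" by (rule dvdE)
  then have "vx w = ev g * ev k" by (metis ev_1 ev_mult)
  then show ?thesis using idl_right[OF QI g(2) ev_S] by simp
qed

end

context graded_leavitt_family
begin

text \<open>\<open>P\<close> is an arbitrary ideal here and not a prime, because
  \<open>prime_chain\<close> applies this to a sum of two ideals.\<close>

lemma ex_cycle:
  assumes "graded G" "idl P" "G \<subseteq> P" "\<And>x n. x \<in> P \<Longrightarrow> x \<in> homog n \<Longrightarrow> x \<in> G" "\<not> P \<subseteq> G"
  shows "\<exists>w \<delta>. exitless_cycle V A src rng \<kappa> vx ed gh hc G w \<delta> \<and>
    (\<exists>b\<in>P. b \<notin> G \<and> vx w * b * vx w = b)"
proof -
  interpret ungraded_ideal V A src rng \<kappa> vx ed gh hc G P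
    by unfold_locales (use assms in auto)
  obtain w \<delta> b where w: "w \<in> V" "set \<delta> \<subseteq> A" "\<delta> \<noteq> []" "vx w \<notin> G"
    "vx w - (vx w * ep \<delta> * vx w) * (vx w * gp \<delta> * vx w) \<in> G"
    and b: "b \<in> P" "b \<notin> G" "vx w * b * vx w = b"
    using cycle_without_exits by (elim exE conjE)
  then show ?thesis using ex_exitless_cycle[OF assms(1) w] by blast
qed

theorem ex_prime_at_cycle:
  assumes P: "prime_idl P" and ungraded: "\<not> P \<subseteq> gr P"
  shows "\<exists>w \<delta>. prime_at_cycle V A src rng \<kappa> vx ed gh hc (gr P) w \<delta> P"
proof -
  note PI = prime_idl_idl[OF P]
  have "\<exists>w \<delta>. exitless_cycle V A src rng \<kappa> vx ed gh hc (gr P) w \<delta> \<and>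
      (\<exists>b\<in>P. b \<notin> gr P \<and> vx w * b * vx w = b)"
    by (rule ex_cycle[OF graded_gr[OF PI] PI gr_subset[OF PI] _ ungraded]) (rule homog_mem_gr[OF PI])
  then obtain w \<delta> where c: "exitless_cycle V A src rng \<kappa> vx ed gh hc (gr P) w \<delta>"
    and b: "\<exists>b\<in>P. b \<notin> gr P \<and> vx w * b * vx w = b" by blast
  interpret c: exitless_cycle V A src rng \<kappa> vx ed gh hc "gr P" w \<delta> by (rule c)
  have "vx w \<notin> P" using homog_mem_gr[OF PI _ vx_homog0[OF c.w]] c.w_G by blast
  then have "prime_at_cycle V A src rng \<kappa> vx ed gh hc (gr P) w \<delta> P"
    using P b gr_subset[OF PI] by unfold_locales auto
  then show ?thesis by blast
qed

lemma idl_sum_set: assumes I: "idl I" and J: "idl J" shows "idl {x + y | x y. x \<in> I \<and> y \<in> J}"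
proof (rule idlI)
  show "{x + y | x y. x \<in> I \<and> y \<in> J} \<subseteq> S" using idl_S[OF I] idl_S[OF J] S_add by blast
  show "0 \<in> {x + y | x y. x \<in> I \<and> y \<in> J}"
    using idl_0[OF I] idl_0[OF J] by (intro CollectI exI[of _ 0]) simp
  show "x + y \<in> {x + y | x y. x \<in> I \<and> y \<in> J}"
    if xy: "x \<in> {x + y | x y. x \<in> I \<and> y \<in> J}" "y \<in> {x + y | x y. x \<in> I \<and> y \<in> J}" for x y
  proof -
    obtain a b c d where "x = a + b" "y = c + d" "a \<in> I" "b \<in> J" "c \<in> I" "d \<in> J" using xy by blast
    then have "x + y = (a + c) + (b + d)" "a + c \<in> I" "b + d \<in> J"
      using idl_add[OF I] idl_add[OF J] by (auto simp: add_ac)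
    then show ?thesis by blast
  qed
  show "a * x \<in> {x + y | x y. x \<in> I \<and> y \<in> J}"
    if a: "a \<in> S" and x: "x \<in> {x + y | x y. x \<in> I \<and> y \<in> J}" for a x
  proof -
    obtain b c where "x = b + c" "b \<in> I" "c \<in> J" using x by blast
    then have "a * x = a * b + a * c" "a * b \<in> I" "a * c \<in> J"
      using a idl_left[OF I] idl_left[OF J] by (auto simp: distrib_left)
    then show ?thesis by blast
  qed
  show "x * a \<in> {x + y | x y. x \<in> I \<and> y \<in> J}"
    if a: "a \<in> S" and x: "x \<in> {x + y | x y. x \<in> I \<and> y \<in> J}" for a x
  proof -
    obtain b c where "x = b + c" "b \<in> I" "c \<in> J" using x by blast
    then have "x * a = b * a + c * a" "b * a \<in> I" "c * a \<in> J"
      using a idl_right[OF I] idl_right[OF J] by (auto simp: distrib_right)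
    then show ?thesis by blast
  qed
qed

text \<open>
  The prime \<open>P\<close> contains neither vertex, so some path leads from \<open>w'\<close> to a vertex \<open>z\<close> that is reached
  from \<open>w\<close>. Modulo \<open>G\<close> this path cannot leave the cycle at \<open>w'\<close>, hence \<open>z\<close> and \<open>w'\<close> generate the same
  ideal.
\<close>

lemma exitless_vertex_transfer:
  assumes P: "prime_idl P" and Q: "idl Q" and GQ: "G \<subseteq> Q" and GP: "G \<subseteq> P"
    and c: "exitless_cycle V A src rng \<kappa> vx ed gh hc G w' \<delta>'"
    and w: "w \<in> V" "vx w \<notin> P" "vx w \<in> Q" and w': "vx w' \<notin> P"
  shows "vx w' \<in> Q"
proof -
  interpret c: exitless_cycle V A src rng \<kappa> vx ed gh hc G w' \<delta>' by (rule c)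
  note PI = prime_idl_idl[OF P]
  have "\<exists>s\<in>S. vx w' * s * vx w \<notin> P"
    using prime_idlD[OF P vx_S[OF c.w] vx_S[OF w(1)]] w w' by blast
  then obtain s where s: "s \<in> S" "vx w' * s * vx w \<notin> P" by blast
  \<comment> \<open>\<open>S\<close> is spanned by monomials, so \<open>s\<close> can be replaced by
    a single one. It splits into a path \<open>as\<close> from \<open>w'\<close> to \<open>z\<close>
    and the ghost of a path \<open>bs\<close> from \<open>w\<close> to \<open>z\<close>.\<close>
  have "\<exists>y\<in>(\<Union>n N. monomials n N). vx w' * y * vx w \<notin> P"
  proof (rule ccontr)
    assume "\<not> ?thesis"
    then have *: "vx w' * y * vx w \<in> P" if "y \<in> (\<Union>n N. monomials n N)" for y using that by blast
    have "vx w' * s * vx w \<in> P"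
      using s(1) unfolding S_def
    proof (induction rule: lspan.induct)
      case (add b x k)
      have "\<kappa> k * (vx w' * b * vx w) + vx w' * x * vx w \<in> P"
        by (rule idl_add[OF PI idl_scale[OF PI *[OF add(1)]] add(3)])
      then show ?case by (simp add: distrib_left distrib_right mult_\<kappa>_left[of "vx w'"] mult.assoc)
    qed (simp add: idl_0[OF PI])
    then show False using s(2) by blast
  qed
  then obtain as bs z where m: "vx w' * (ep as * vx z * gp bs) * vx w \<notin> P"
    and as: "set as \<subseteq> A" and bs: "set bs \<subseteq> A" and z: "z \<in> V"
    by (auto elim!: monomials.cases)
  define x x' where "x = vx w' * ep as * vx z" and "x' = vx z * gp as * vx w'"
  have m_eq: "vx w' * (ep as * vx z * gp bs) * vx w = x * (vx z * gp bs * vx w)"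
    using vx_idem[OF z] by (simp add: x_def mult.assoc) (metis mult.assoc)
  have x0: "x \<noteq> 0" and y0: "vx z * gp bs * vx w \<noteq> 0" using m idl_0[OF PI] unfolding m_eq by auto
  have "ep as * vx z * gp [] \<in> S" "ep [] * vx z * gp as \<in> S" "ep [] * vx z * gp bs \<in> S"
    using homogI[OF as _ z, of "[]"] homogI[OF _ as z, of "[]"] homogI[OF _ bs z, of "[]"] homog_subset_S by auto
  then have xS: "x \<in> S" "x' \<in> S" and yS: "vx z * gp bs * vx w \<in> S"
    using S_mult[OF vx_S[OF c.w], of "ep as * vx z"] S_mult[OF _ vx_S[OF c.w], of "vx z * gp as"]
      S_mult[OF _ vx_S[OF w(1)], of "vx z * gp bs"] by (simp_all add: x_def x'_def mult.assoc)
  have x'x: "x' * x = vx z" unfolding x_def x'_def using x0 by (intro loop_left_inverse[OF as c.w z]) (simp add: x_def)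
  have x'w: "x' * vx w' = x'" using c.ww by (simp add: x'_def mult.assoc)
  have xz: "x * vx z = x" using vx_idem[OF z] by (simp add: x_def mult.assoc)
  \<comment> \<open>The power with exponent \<open>n\<close> of the cycle is at least as long as
    \<open>as\<close>, since the cycle is not empty; the two paths can thus be compared.\<close>
  define n where "n = length as"
  define \<gamma> where "\<gamma> = concat (replicate n \<delta>')"
  have \<gamma>: "set \<gamma> \<subseteq> A" using c.\<delta>(1) by (auto simp: \<gamma>_def)
  have "length \<gamma> = n * length \<delta>'" by (simp add: \<gamma>_def length_concat sum_list_replicate)
  moreover have "n \<le> n * length \<delta>'" using c.\<delta>(2) by (cases \<delta>') auto
  ultimately have len: "length as \<le> length \<gamma>" by (simp add: n_def)
  define pn where "pn = vx w' * c.d ^ n"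
  have pn: "pn = vx w' * ep \<gamma> * vx w'" using c.pw_path[of n] by (simp add: pn_def \<gamma>_def)
  have x'pn: "x' * pn = vx z * gp as * (vx w' * ep \<gamma> * vx w')"
    unfolding x'_def pn by (simp add: mult.assoc c.ww')
  have pnx: "(vx w' - x * x') * pn = 0"
  proof -
    consider "x' * pn = 0" | ds where "\<gamma> = as @ ds" "x' * pn = vx z * ep ds * vx w'"
      unfolding x'pn using ghost_path_cancel[OF as \<gamma> len z c.w c.w] by blast
    then show ?thesis
    proof cases
      case 1
      \<comment> \<open>If \<open>as\<close> left the cycle, \<open>x'\<close> would annihilate this
        power and lie in \<open>G\<close>. Then \<open>vx z\<close>, \<open>x\<close> and the
        monomial outside \<open>P\<close> would lie in \<open>G\<close> as well.\<close>
      have "x' \<in> G" by (rule c.pw_cancel[OF c.G order_refl xS(2) x'w, where j = n]) (use 1 c.G idl_0 in \<open>simp add: pn_def\<close>)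
      then have "x' * x \<in> G" using xS(1) by (rule idl_right[OF c.G])
      then have "x * vx z \<in> G" unfolding x'x using xS(1) by (rule idl_left[OF c.G, rotated])
      then have "x * (vx z * gp bs * vx w) \<in> G" unfolding xz using yS by (rule idl_right[OF c.G])
      then show ?thesis using m GP unfolding m_eq by blast
    next
      case 2
      have "x * (x' * pn) = vx w' * (ep as * vx z * ep ds * vx w')"
        using 2(2) by (simp add: x_def mult.assoc) (metis mult.assoc vx_idem[OF z])
      moreover have "ep as * (vx z * (ep ds * vx w')) = ep as * (ep ds * vx w') \<or> as = []"
      proof (cases "as = []")
        case False
        then have "ep as * vx z = ep as"
          using ep_vx[OF z as] x0 by (auto simp: x_def mult.assoc split: if_splits)
        then show ?thesis by (metis mult.assoc)
      qed simp
      moreover have "as = [] \<Longrightarrow> z = w'" using x0 vx_vx[OF c.w z] by (auto simp: x_def split: if_splits)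
      ultimately have "x * (x' * pn) = vx w' * (ep (as @ ds) * vx w')"
        by (auto simp: mult.assoc c.ww')
      then have "x * (x' * pn) = pn" using 2(1) pn by (simp add: mult.assoc)
      moreover have "vx w' * pn = pn" by (simp add: pn_def c.ww')
      ultimately show ?thesis by (simp add: left_diff_distrib mult.assoc)
    qed
  qed
  have "vx w' - x * x' \<in> G"
  proof (rule c.pw_cancel[OF c.G order_refl])
    show "vx w' - x * x' \<in> S" using vx_S[OF c.w] xS by (intro S_diff S_mult)
    show "(vx w' - x * x') * vx w' = vx w' - x * x'" using x'w c.ww by (simp add: left_diff_distrib mult.assoc)
    show "(vx w' - x * x') * (vx w' * c.d ^ n) \<in> G" using pnx idl_0[OF c.G] by (simp add: pn_def)
  qed
  \<comment> \<open>The path \<open>bs\<close> leads from \<open>w\<close> to \<open>z\<close>, so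
    \<open>vx z\<close> is a multiple of \<open>vx w\<close>.\<close>
  moreover have "vx z \<in> Q"
  proof (cases "bs = []")
    case True
    then have "z = w" using y0 vx_vx[OF z w(1)] by (auto split: if_splits)
    then show ?thesis using w(3) by simp
  next
    case False
    then have y: "vx z * gp bs * vx w = vx z * gp bs"
      using gp_vx[OF w(1) bs] y0 by (auto simp: mult.assoc split: if_splits)
    have "ep [] * vx z * gp bs \<in> S" using homogI[OF _ bs z, of "[]"] homog_subset_S by auto
    then have "vx z * gp bs * vx w \<in> Q" using idl_left[OF Q _ w(3)] by simp
    then have "vx z * gp bs * ep bs \<in> Q" unfolding y using bs by (intro idl_ep_right[OF Q])
    moreover have "vx z * gp bs * ep bs = vx z" using gp_ep_same'[OF z bs] y y0 by auto
    ultimately show ?thesis by simp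
  qed
  then have "x * vx z * x' \<in> Q" using xS by (intro idl_left[OF Q] idl_right[OF Q])
  ultimately have "(vx w' - x * x') + x * x' \<in> Q" using GQ xz by (intro idl_add[OF Q]) auto
  then show ?thesis by simp
qed

text \<open>Otherwise two cycles exist: one at \<open>w\<close> for \<open>P\<close>, with
  \<open>vx w\<close> in \<open>Q\<close> by \<open>larger_prime\<close>, and one at
  \<open>w'\<close> for \<open>P + gr Q\<close>, with \<open>vx w'\<close> outside \<open>Q\<close>.
  The cycle at \<open>w'\<close> is shown to be without exits already modulo \<open>gr P\<close>;
  then \<open>exitless_vertex_transfer\<close> carries membership in \<open>Q\<close> from
  \<open>w\<close> to \<open>w'\<close>.\<close>

theorem prime_chain:
  assumes P: "prime_idl P" and Q: "prime_idl Q" and PQ: "P \<subset> Q"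
  shows "P \<subseteq> gr Q"
proof (rule ccontr)
  assume not: "\<not> P \<subseteq> gr Q"
  note PI = prime_idl_idl[OF P] and QI = prime_idl_idl[OF Q]
  note grQ = graded_gr[OF QI] and grP = graded_gr[OF PI]
  note gQ = graded_idl[OF grQ] and gP = graded_idl[OF grP]
  have "\<not> P \<subseteq> gr P"
  proof
    assume "P \<subseteq> gr P"
    then have "P \<subseteq> gr Q" using PQ by (auto simp: gr_def)
    then show False using not by blast
  qed
  then obtain w \<delta> where wc: "prime_at_cycle V A src rng \<kappa> vx ed gh hc (gr P) w \<delta> P"
    using ex_prime_at_cycle[OF P] by blast
  interpret c: prime_at_cycle V A src rng \<kappa> vx ed gh hc "gr P" w \<delta> P by (rule wc)
  have wQ: "vx w \<in> Q" using c.larger_prime[OF Q PQ] .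
  \<comment> \<open>This sum lies in \<open>Q\<close>, so all its homogeneous elements lie in
    \<open>gr Q\<close>, which is what the search for a cycle modulo \<open>gr Q\<close>
    requires.\<close>
  define P' where "P' = {x + y | x y. x \<in> P \<and> y \<in> gr Q}"
  have P': "idl P'" unfolding P'_def by (rule idl_sum_set[OF PI gQ])
  have sub: "gr Q \<subseteq> P'" "P \<subseteq> P'" unfolding P'_def using idl_0[OF PI] idl_0[OF gQ] by force+
  have P'Q: "P' \<subseteq> Q" unfolding P'_def using PQ gr_subset[OF QI] idl_add[OF QI] by blast
  have "\<exists>w' \<delta>'. exitless_cycle V A src rng \<kappa> vx ed gh hc (gr Q) w' \<delta>' \<and>
      (\<exists>b\<in>P'. b \<notin> gr Q \<and> vx w' * b * vx w' = b)"
    by (rule ex_cycle[OF grQ P' sub(1)]) (use P'Q homog_mem_gr[OF QI] sub not in blast)+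
  then obtain w' \<delta>' b where c': "exitless_cycle V A src rng \<kappa> vx ed gh hc (gr Q) w' \<delta>'"
    and b: "b \<in> P'" "b \<notin> gr Q" "vx w' * b * vx w' = b" by blast
  interpret c': exitless_cycle V A src rng \<kappa> vx ed gh hc "gr Q" w' \<delta>' by (rule c')
  have bS: "b \<in> S" using idl_S[OF P' b(1)] .
  have w'Q: "vx w' \<notin> Q" using homog_mem_gr[OF QI _ vx_homog0[OF c'.w]] c'.w_G by blast
  obtain n g where g: "vx w' * b * (vx w' * c'.d ^ n) = c'.ev g" using c'.corner_poly[OF bS] by blast
  have gP': "c'.ev g \<in> P'" unfolding g[symmetric]
    by (rule idl_right[OF P' idl_left[OF P' vx_S[OF c'.w] b(1)] c'.pw_S])
  have "g \<noteq> 0"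
  proof
    assume "g = 0"
    moreover have "vx w' * b * (vx w' * c'.d ^ n) = b * (vx w' * c'.d ^ n)"
      using b(3) c'.ww by (metis mult.assoc)
    ultimately have "b * (vx w' * c'.d ^ n) \<in> gr Q" using g idl_0[OF gQ] by simp
    moreover have "b * vx w' = b" using b(3) c'.ww by (metis mult.assoc)
    ultimately show False using c'.pw_cancel[OF gQ order_refl bS] b(2) by blast
  qed
  \<comment> \<open>\<open>d'\<close> strips factors \<open>d\<close> from the left until the
    constant term is nonzero. This term is the one that survives the multiplication by
    \<open>q\<close> below.\<close>
  have "\<exists>a p. a \<noteq> 0 \<and> c'.ev (pCons a p) \<in> P'"
    using \<open>g \<noteq> 0\<close> gP'
  proof (induction g)
    case (pCons a p)
    show ?case
    proof (cases "a = 0")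
      case True
      then have "c'.d' * (c'.d * c'.ev p) \<in> P'"
        using pCons.prems(2) by (intro idl_left[OF P' c'.d'_S]) (simp add: c'.ev_pCons \<kappa>_0)
      then have "c'.ev p \<in> P'" by (simp add: mult.assoc[symmetric] c'.d'd c'.w_ev)
      then show ?thesis using pCons True by auto
    qed (use pCons in blast)
  qed simp
  then obtain a p where a: "a \<noteq> 0" "c'.ev (pCons a p) \<in> P'" by blast
  then obtain x y where xy: "x \<in> P" "y \<in> gr Q" "c'.ev (pCons a p) = x + y" unfolding P'_def by blast
  obtain m h where h: "vx w' * y * (vx w' * c'.d ^ m) = c'.ev h"
    using c'.corner_poly[OF idl_S[OF gQ xy(2)]] by blast
  have "c'.ev h \<in> gr Q" unfolding h[symmetric]
    by (rule idl_right[OF gQ idl_left[OF gQ vx_S[OF c'.w] xy(2)] c'.pw_S])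
  \<comment> \<open>A polynomial in \<open>gr Q\<close> is exactly 0. After multiplication by a
    power of the cycle, the summand from \<open>gr Q\<close> has therefore disappeared, and the
    polynomial lies in \<open>P\<close> itself.\<close>
  then have "h = 0" by (rule c'.ev_in_G)
  then have h0: "vx w' * y * (vx w' * c'.d ^ m) = 0" using h by simp
  have "vx w' * x * (vx w' * c'.d ^ m) = vx w' * (x + y) * (vx w' * c'.d ^ m)"
    using h0 by (simp add: distrib_left distrib_right)
  also have "\<dots> = c'.ev (pCons a p) * (vx w' * c'.d ^ m)" by (simp only: xy(3)[symmetric] c'.w_ev)
  also have "\<dots> = (vx w' * c'.d ^ m) * c'.ev (pCons a p)"
    using c'.ev_commute[of "pCons a p" "monom 1 m"] by (simp only: c'.ev_monom)
  finally have "(vx w' * c'.d ^ m) * c'.ev (pCons a p) \<in> P"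
    using idl_right[OF PI idl_left[OF PI vx_S[OF c'.w] xy(1)] c'.pw_S, of m] by simp
  then have "(vx w' * c'.d' ^ m) * ((vx w' * c'.d ^ m) * c'.ev (pCons a p)) \<in> P"
    by (rule idl_left[OF PI c'.pw'_S])
  then have evP: "c'.ev (pCons a p) \<in> P"
    by (simp only: mult.assoc[symmetric] c'.pw'_pw[unfolded mult.assoc[symmetric]] c'.w_ev)
  \<comment> \<open>This element measures the exits of the cycle and annihilates \<open>d\<close>
    from the left. The polynomial in \<open>P\<close> is thereby reduced to its constant term times
    \<open>q\<close>, so \<open>q\<close> is a homogeneous element of \<open>P\<close>.\<close>
  define q where "q = vx w' - c'.d * c'.d'"
  have qS: "q \<in> S" unfolding q_def by (intro S_diff S_mult vx_S c'.w c'.d_S c'.d'_S)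
  have qh: "q \<in> homog 0"
    unfolding q_def using homog_diff[OF vx_homog0[OF c'.w]] homog_mult[OF c'.d_homog c'.d'_homog] by simp
  have "q * c'.d = 0" by (simp add: q_def left_diff_distrib mult.assoc c'.d'd c'.wd)
  moreover have "q * vx w' = q" by (simp add: q_def left_diff_distrib mult.assoc c'.wd c'.ww)
  moreover have "q * c'.ev (pCons a p) = \<kappa> a * (q * vx w') + (q * c'.d) * c'.ev p"
    by (simp add: c'.ev_pCons distrib_left mult_\<kappa>_left mult.assoc)
  ultimately have "\<kappa> a * q \<in> P" using idl_left[OF PI qS evP] by simp
  then have "q \<in> P" by (rule idl_unscale[OF PI _ a(1)])
  then have "q \<in> gr P" using qh by (rule homog_mem_gr[OF PI])
  moreover have "vx w' \<notin> gr P" using w'Q gr_subset[OF PI] PQ by blast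
  ultimately obtain \<delta>'' where c'': "exitless_cycle V A src rng \<kappa> vx ed gh hc (gr P) w' \<delta>''"
    using ex_exitless_cycle[OF grP c'.w c'.\<delta>] by (auto simp: q_def c'.d_def c'.d'_def)
  have "gr P \<subseteq> Q" "vx w' \<notin> P" using w'Q PQ gr_subset[OF PI] by blast+
  then have "vx w' \<in> Q"
    using exitless_vertex_transfer[OF P QI _ gr_subset[OF PI] c'' c.w c.w_P wQ] by blast
  then show False using w'Q by blast
qed

end

section \<open>Transport to rings given by a record\<close>

text \<open>The bridge between the ring given by a record, in which the statement lives, and the
  subring \<open>S\<close> of a type of class \<open>ring_1\<close>, in which the arguments
  live.\<close>

locale leavitt_embedding = graded_leavitt_family V A src rng \<kappa> vx ed gh hc + L: nonunital_ring L
  for V :: "'v set" and A :: "'e set" and src rng :: "'e \<Rightarrow> 'v"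
    and \<kappa> :: "'k::field \<Rightarrow> 'r::ring_1" and vx :: "'v \<Rightarrow> 'r" and ed gh :: "'e \<Rightarrow> 'r"
    and hc :: "int \<Rightarrow> 'r \<Rightarrow> 'r" and L :: "('a, 'm) ring_scheme" +
  fixes \<Phi> :: "'a \<Rightarrow> 'r"
  assumes \<Phi>_add: "\<lbrakk>x \<in> carrier L; y \<in> carrier L\<rbrakk> \<Longrightarrow> \<Phi> (x \<oplus>\<^bsub>L\<^esub> y) = \<Phi> x + \<Phi> y"
    and \<Phi>_mult: "\<lbrakk>x \<in> carrier L; y \<in> carrier L\<rbrakk> \<Longrightarrow> \<Phi> (x \<otimes>\<^bsub>L\<^esub> y) = \<Phi> x * \<Phi> y"
    and \<Phi>_inj: "inj_on \<Phi> (carrier L)" and \<Phi>_image: "\<Phi> ` carrier L = S"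
begin

lemma \<Phi>_S: "x \<in> carrier L \<Longrightarrow> \<Phi> x \<in> S" using \<Phi>_image by blast

lemma \<Phi>_zero: "\<Phi> \<zero>\<^bsub>L\<^esub> = 0"
proof -
  have "\<Phi> (\<zero>\<^bsub>L\<^esub> \<oplus>\<^bsub>L\<^esub> \<zero>\<^bsub>L\<^esub>) = \<Phi> \<zero>\<^bsub>L\<^esub> + \<Phi> \<zero>\<^bsub>L\<^esub>" by (rule \<Phi>_add) simp_all
  then show ?thesis by simp
qed

lemma \<Phi>_minus: assumes x: "x \<in> carrier L" shows "\<Phi> (\<ominus>\<^bsub>L\<^esub> x) = - \<Phi> x"
proof -
  have "\<Phi> (\<ominus>\<^bsub>L\<^esub> x \<oplus>\<^bsub>L\<^esub> x) = \<Phi> (\<ominus>\<^bsub>L\<^esub> x) + \<Phi> x" using x by (intro \<Phi>_add) simp_all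
  then show ?thesis using x by (simp add: L.l_neg \<Phi>_zero eq_neg_iff_add_eq_0)
qed

definition pre :: "'r set \<Rightarrow> 'a set" where "pre K = {x \<in> carrier L. \<Phi> x \<in> K}"

lemma \<Phi>_mem: "J \<subseteq> carrier L \<Longrightarrow> x \<in> carrier L \<Longrightarrow> \<Phi> x \<in> \<Phi> ` J \<longleftrightarrow> x \<in> J"
  using inj_on_image_mem_iff[OF \<Phi>_inj] by blast

lemma idl_image: assumes J: "two_sided_ideal L J" shows "idl (\<Phi> ` J)"
proof (rule idlI)
  note JD = L.two_sided_idealD[OF J]
  show "\<Phi> ` J \<subseteq> S" using JD(1) \<Phi>_S by blast
  show "0 \<in> \<Phi> ` J" using JD(2) \<Phi>_zero by (metis imageI)
  show "x + y \<in> \<Phi> ` J" if x: "x \<in> \<Phi> ` J" and y: "y \<in> \<Phi> ` J" for x y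
  proof -
    obtain a b where "a \<in> J" "b \<in> J" "x = \<Phi> a" "y = \<Phi> b" using x y by blast
    then show ?thesis using JD(1,3) \<Phi>_add[of a b] by (metis imageI subsetD)
  qed
  show "a * x \<in> \<Phi> ` J" if a: "a \<in> S" and x: "x \<in> \<Phi> ` J" for a x
  proof -
    obtain b c where "b \<in> carrier L" "a = \<Phi> b" "c \<in> J" "x = \<Phi> c" using a x \<Phi>_image by blast
    then show ?thesis using JD(1,5) \<Phi>_mult[of b c] by (metis imageI subsetD)
  qed
  show "x * a \<in> \<Phi> ` J" if a: "a \<in> S" and x: "x \<in> \<Phi> ` J" for a x
  proof -
    obtain b c where "b \<in> carrier L" "a = \<Phi> b" "c \<in> J" "x = \<Phi> c" using a x \<Phi>_image by blast
    then show ?thesis using JD(1,6) \<Phi>_mult[of c b] by (metis imageI subsetD)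
  qed
qed

lemma two_sided_ideal_pre: assumes K: "idl K" shows "two_sided_ideal L (pre K)"
proof (rule L.two_sided_idealI)
  show "\<zero>\<^bsub>L\<^esub> \<in> pre K" using idl_0[OF K] by (simp add: pre_def \<Phi>_zero)
qed (auto simp: pre_def \<Phi>_add \<Phi>_mult \<Phi>_minus L.m_closed \<Phi>_S
    intro: idl_add[OF K] idl_minus[OF K] idl_left[OF K] idl_right[OF K])

section \<open>Principal ideals, and primeness by elements\<close>

definition principal :: "'r \<Rightarrow> 'r set" where
  "principal a = lspan {s * a * t | s t. s \<in> S \<and> t \<in> S}"

lemma idl_principal: assumes a: "a \<in> S" shows "idl (principal a)"
proof (rule idlI)
  have "{s * a * t | s t. s \<in> S \<and> t \<in> S} \<subseteq> S" using a S_mult by blast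
  then show "principal a \<subseteq> S"
    unfolding principal_def using lspan_subset[of _ "\<Union>n N. monomials n N"] S_def by simp
  show "s * x \<in> principal a" if s: "s \<in> S" and x: "x \<in> principal a" for s x
    using x unfolding principal_def
  proof (rule lspan_mult_left)
    fix b assume "b \<in> {s * a * t | s t. s \<in> S \<and> t \<in> S}"
    then obtain u t where "b = u * a * t" "u \<in> S" "t \<in> S" by blast
    then have "s * b = (s * u) * a * t" "s * u \<in> S" "t \<in> S" using s by (auto simp: mult.assoc intro: S_mult)
    then show "s * b \<in> lspan {s * a * t | s t. s \<in> S \<and> t \<in> S}" by (intro lspan_base) blast
  qed
  show "x * s \<in> principal a" if s: "s \<in> S" and x: "x \<in> principal a" for s x
    using x unfolding principal_def
  proof (rule lspan_mult_right)
    fix b assume "b \<in> {s * a * t | s t. s \<in> S \<and> t \<in> S}"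
    then obtain u t where "b = u * a * t" "u \<in> S" "t \<in> S" by blast
    then have "b * s = u * a * (t * s)" "u \<in> S" "t * s \<in> S" using s by (auto simp: mult.assoc intro: S_mult)
    then show "b * s \<in> lspan {s * a * t | s t. s \<in> S \<and> t \<in> S}" by (intro lspan_base) blast
  qed
qed (auto simp: principal_def intro: lspan.zero lspan_add)

lemma mem_principal: assumes a: "a \<in> S" shows "a \<in> principal a"
proof -
  obtain u where u: "u \<in> homog 0" "u * a = a" "a * u = a" using local_unit_S[OF a] by blast
  then have "u \<in> S" using homog_subset_S by blast
  then have "u * a * u \<in> principal a" unfolding principal_def by (intro lspan_base) blast
  then show ?thesis using u by simp
qed

text \<open>If a S b lies in the image of \<open>P\<close>, the ideals generated by \<open>a\<close>
  and \<open>b\<close> multiply into \<open>P\<close>, so one of them lies in \<open>P\<close>.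
  Local units ensure that this ideal contains its generator.\<close>

lemma prime_idl_image: assumes P: "prime_two_sided_ideal L P" shows "prime_idl (\<Phi> ` P)"
proof -
  have PI: "two_sided_ideal L P" and proper: "P \<noteq> carrier L"
    and prime: "\<And>I J. two_sided_ideal L I \<Longrightarrow> two_sided_ideal L J \<Longrightarrow> I \<cdot>\<^bsub>L\<^esub> J \<subseteq> P \<Longrightarrow> I \<subseteq> P \<or> J \<subseteq> P"
    using P by (simp_all add: prime_two_sided_ideal_def)
  have PL: "P \<subseteq> carrier L" using L.two_sided_idealD(1)[OF PI] .
  have I: "idl (\<Phi> ` P)" using idl_image[OF PI] .
  have "\<Phi> ` P \<noteq> S"
  proof
    assume "\<Phi> ` P = S"
    then have "carrier L \<subseteq> P" using \<Phi>_mem[OF PL] \<Phi>_S by blast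
    then show False using proper PL by blast
  qed
  moreover have "a \<in> \<Phi> ` P \<or> b \<in> \<Phi> ` P"
    if a: "a \<in> S" and b: "b \<in> S" and ab: "\<forall>s\<in>S. a * s * b \<in> \<Phi> ` P" for a b
  proof -
    have mult: "x * y \<in> \<Phi> ` P" if x: "x \<in> principal a" and y: "y \<in> principal b" for x y
    proof -
      have "x * y \<in> lspan (\<Phi> ` P)"
        using x unfolding principal_def
      proof (rule lspan_mult_right)
        fix c assume "c \<in> {s * a * t | s t. s \<in> S \<and> t \<in> S}"
        then obtain s t where c: "c = s * a * t" "s \<in> S" "t \<in> S" by blast
        show "c * y \<in> lspan (\<Phi> ` P)"
          using y unfolding principal_def
        proof (rule lspan_mult_left)
          fix d assume "d \<in> {s * b * t | s t. s \<in> S \<and> t \<in> S}"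
          then obtain s' t' where d: "d = s' * b * t'" "s' \<in> S" "t' \<in> S" by blast
          have "a * (t * s') * b \<in> \<Phi> ` P" using ab S_mult[OF c(3) d(2)] by blast
          then have "s * (a * (t * s') * b) * t' \<in> \<Phi> ` P"
            by (rule idl_right[OF I idl_left[OF I c(2)] d(3)])
          then show "c * d \<in> lspan (\<Phi> ` P)" by (simp add: c(1) d(1) mult.assoc lspan_base)
        qed
      qed
      then show ?thesis using idl_lspan[OF I order_refl] by blast
    qed
    have "pre (principal a) \<cdot>\<^bsub>L\<^esub> pre (principal b) \<subseteq> P"
    proof
      fix x assume "x \<in> pre (principal a) \<cdot>\<^bsub>L\<^esub> pre (principal b)"
      then show "x \<in> P"
      proof induction
        case (prod i j)
        then have "i \<in> carrier L" "j \<in> carrier L" "\<Phi> i * \<Phi> j \<in> \<Phi> ` P"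
          using mult by (auto simp: pre_def)
        then show ?case using \<Phi>_mem[OF PL L.m_closed, of i j] by (simp add: \<Phi>_mult)
      next
        case (sum s1 s2)
        then show ?case by (intro L.two_sided_idealD(3)[OF PI])
      qed
    qed
    then consider "pre (principal a) \<subseteq> P" | "pre (principal b) \<subseteq> P"
      using prime two_sided_ideal_pre idl_principal a b by blast
    then show ?thesis
    proof cases
      case 1
      obtain x where "x \<in> carrier L" "a = \<Phi> x" using a \<Phi>_image by blast
      then show ?thesis using 1 mem_principal[OF a] by (auto simp: pre_def)
    next
      case 2
      obtain x where "x \<in> carrier L" "b = \<Phi> x" using b \<Phi>_image by blast
      then show ?thesis using 2 mem_principal[OF b] by (auto simp: pre_def)
    qed
  qed
  ultimately show ?thesis using I by (simp add: prime_idl_def)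
qed

lemma absorbs_of_graded:
  assumes P: "two_sided_ideal L P" and Q: "two_sided_ideal L Q" and sub: "\<Phi> ` P \<subseteq> gr (\<Phi> ` Q)"
  shows "L.absorbs Q P"
  unfolding L.absorbs_def
proof (intro ballI conjI)
  fix x assume x: "x \<in> P"
  note QL = L.two_sided_idealD(1)[OF Q]
  have xL: "x \<in> carrier L" using L.two_sided_idealD(1)[OF P] x by blast
  have QI: "idl (\<Phi> ` Q)" using idl_image[OF Q] .
  have xg: "\<Phi> x \<in> gr (\<Phi> ` Q)" using sub x by blast
  obtain u where u: "u \<in> gr (\<Phi> ` Q)" "u * \<Phi> x = \<Phi> x"
    using graded_left_unit[OF graded_gr[OF QI] xg] by blast
  obtain v where v: "v \<in> gr (\<Phi> ` Q)" "\<Phi> x * v = \<Phi> x"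
    using graded_right_unit[OF graded_gr[OF QI] xg] by blast
  obtain u' v' where u': "u' \<in> Q" "u = \<Phi> u'" and v': "v' \<in> Q" "v = \<Phi> v'"
    using u(1) v(1) gr_subset[OF QI] by blast
  have "u' \<in> carrier L" "v' \<in> carrier L" using u' v' QL by auto
  then have "u' \<otimes>\<^bsub>L\<^esub> x = x" "x \<otimes>\<^bsub>L\<^esub> v' = x"
    using inj_onD[OF \<Phi>_inj, of "u' \<otimes>\<^bsub>L\<^esub> x" x] inj_onD[OF \<Phi>_inj, of "x \<otimes>\<^bsub>L\<^esub> v'" x] xL u u' v v'
    by (simp_all add: \<Phi>_mult L.m_closed)
  then show "\<exists>u\<in>Q. x \<otimes>\<^bsub>L\<^esub> u = x" "\<exists>u\<in>Q. u \<otimes>\<^bsub>L\<^esub> x = x" using u' v' by blast+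
qed

lemma ideal_valuation_of_cycle:
  assumes P: "two_sided_ideal L P"
    and c: "prime_at_cycle V A src rng \<kappa> vx ed gh hc (gr (\<Phi> ` P)) w \<delta> (\<Phi> ` P)"
  shows "\<exists>N E. ideal_valuation L P N E"
proof -
  interpret c: prime_at_cycle V A src rng \<kappa> vx ed gh hc "gr (\<Phi> ` P)" w \<delta> "\<Phi> ` P" by (rule c)
  note PL = L.two_sided_idealD(1)[OF P]
  have "ideal_valuation L P (\<lambda>s. pre (c.N s)) (\<lambda>s. pre (c.E s))"
  proof unfold_locales
    show "pre (c.N 0) = carrier L" using \<Phi>_S by (auto simp: pre_def c.N_0)
    show "P \<subseteq> pre (c.N 1)" using PL c.P_subset_N_1 by (auto simp: pre_def)
    show "pre (c.N (Suc s)) \<subseteq> pre (c.N s)" for s using c.N_Suc_subset by (auto simp: pre_def)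
    show "x \<oplus>\<^bsub>L\<^esub> y \<in> pre (c.N s)" if "x \<in> pre (c.N s)" "y \<in> pre (c.N s)" for x y s
      using that c.N_add by (simp add: pre_def \<Phi>_add)
    show "x \<otimes>\<^bsub>L\<^esub> y \<in> pre (c.N s)" if "x \<in> carrier L" "y \<in> pre (c.N s)" for x y s
      using that c.N_mult \<Phi>_S by (simp add: pre_def \<Phi>_mult L.m_closed)
    show "x \<otimes>\<^bsub>L\<^esub> y \<in> pre (c.N (Suc s))" if "x \<in> P" "y \<in> pre (c.N s)" for x y s
      using that c.P_mult_N[of "\<Phi> x" "\<Phi> y" s] PL by (auto simp: pre_def \<Phi>_mult subset_iff intro: L.m_closed)
    show "\<exists>x. x \<in> J \<and> x \<in> pre (c.E 0)" if J: "two_sided_ideal L J" "\<not> J \<subseteq> P" for J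
    proof -
      have JL: "J \<subseteq> carrier L" by (rule L.two_sided_idealD(1)[OF J(1)])
      obtain x where x: "x \<in> J" "x \<notin> P" using J(2) by blast
      then have "\<Phi> x \<notin> \<Phi> ` P" using \<Phi>_mem[OF PL] JL by blast
      then have "\<not> \<Phi> ` J \<subseteq> \<Phi> ` P" using x by blast
      then obtain y where "y \<in> \<Phi> ` J" "y \<in> c.E 0" using c.meets_E_0[OF idl_image[OF J(1)]] by blast
      then show ?thesis using JL by (auto simp: pre_def)
    qed
    show "\<exists>x. x \<in> P \<and> x \<in> pre (c.E 1)"
    proof -
      obtain y where "y \<in> \<Phi> ` P" "y \<in> c.E 1" using c.P_meets_E_1 by blast
      then show ?thesis using PL by (auto simp: pre_def)
    qed
    show "x \<otimes>\<^bsub>L\<^esub> y \<in> pre (c.E (s + t))" if "x \<in> pre (c.E s)" "y \<in> pre (c.E t)" for x y s t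
      using that c.E_mult by (simp add: pre_def \<Phi>_mult L.m_closed)
    show "pre (c.E s) \<inter> pre (c.N (Suc s)) = {}" for s
      using c.E_disjoint[of s] by (auto simp: pre_def)
  qed
  then show ?thesis by blast
qed

theorem irredundant_prime_products_unique:
  assumes "Ps \<noteq> []" "\<forall>P\<in>set Ps. prime_two_sided_ideal L P" "irredundant_product L Ps"
    and "Qs \<noteq> []" "\<forall>Q\<in>set Qs. prime_two_sided_ideal L Q" "irredundant_product L Qs"
    and "ideal_list_prod L Ps = ideal_list_prod L Qs"
  shows "mset Ps = mset Qs"
proof (rule L.irredundant_prime_products_unique[OF _ _ assms])
  fix P Q assume PQ: "prime_two_sided_ideal L P" "prime_two_sided_ideal L Q" "P \<subset> Q"
  have I: "two_sided_ideal L P" "two_sided_ideal L Q" using PQ by (simp_all add: prime_two_sided_ideal_def)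
  obtain x where x: "x \<in> Q" "x \<notin> P" using PQ(3) by blast
  then have "\<Phi> x \<notin> \<Phi> ` P"
    using \<Phi>_mem[OF L.two_sided_idealD(1)[OF I(1)]] L.two_sided_idealD(1)[OF I(2)] by blast
  then have "\<Phi> ` P \<subset> \<Phi> ` Q" using PQ(3) x by blast
  then have "\<Phi> ` P \<subseteq> gr (\<Phi> ` Q)" using prime_chain prime_idl_image PQ by blast
  then show "L.absorbs Q P" by (rule absorbs_of_graded[OF I])
next
  fix P assume P: "prime_two_sided_ideal L P"
  then have I: "two_sided_ideal L P" by (simp add: prime_two_sided_ideal_def)
  show "L.absorbs P P \<or> (\<exists>N E. ideal_valuation L P N E)"
  proof (cases "\<Phi> ` P \<subseteq> gr (\<Phi> ` P)")
    case True
    then show ?thesis using absorbs_of_graded[OF I I] by blast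
  next
    case False
    then show ?thesis
      using ex_prime_at_cycle[OF prime_idl_image[OF P]] ideal_valuation_of_cycle[OF I] by blast
  qed
qed

end

section \<open>The ring of words and its linear maps\<close>

text \<open>With concatenation as the addition of exponents, the ring structure on
  \<open>\<Rightarrow>\<^sub>0\<close> becomes that of the free algebra, with the empty word as its
  1.\<close>

instantiation list :: (type) monoid_add
begin

definition zero_list :: "'a list" where "zero_list = []"
definition plus_list :: "'a list \<Rightarrow> 'a list \<Rightarrow> 'a list" where "plus_list = (@)"

instance by standard (simp_all add: zero_list_def plus_list_def)

end

type_synonym ('x, 'k) words = "'x list \<Rightarrow>\<^sub>0 'k"

abbreviation scal :: "'k::field \<Rightarrow> ('x, 'k) words \<Rightarrow> ('x, 'k) words" where
  "scal c f \<equiv> Poly_Mapping.single 0 c * f"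

lemma words_sum: "(\<Sum>w\<in>Poly_Mapping.keys f. Poly_Mapping.single w (Poly_Mapping.lookup f w)) = f"
  for f :: "('x, 'k::field) words"
proof (rule poly_mapping_eqI)
  fix k
  have "Poly_Mapping.lookup (\<Sum>w\<in>Poly_Mapping.keys f. Poly_Mapping.single w (Poly_Mapping.lookup f w)) k
    = (\<Sum>w\<in>Poly_Mapping.keys f. if w = k then Poly_Mapping.lookup f k else 0)"
    unfolding lookup_sum by (intro sum.cong refl) (auto simp: lookup_single when_def)
  also have "\<dots> = Poly_Mapping.lookup f k"
    by (simp add: sum.delta in_keys_iff)
  finally show "Poly_Mapping.lookup (\<Sum>w\<in>Poly_Mapping.keys f. Poly_Mapping.single w (Poly_Mapping.lookup f w)) k
    = Poly_Mapping.lookup f k" .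
qed

lemma words_induct [case_names zero add]:
  fixes f :: "('x, 'k::field) words"
  assumes "Q 0" "\<And>w c f. w \<in> K \<Longrightarrow> Poly_Mapping.keys f \<subseteq> K \<Longrightarrow> Q f \<Longrightarrow> Q (Poly_Mapping.single w c + f)"
    and "Poly_Mapping.keys f \<subseteq> K"
  shows "Q f"
proof -
  have "Q (\<Sum>w\<in>W. Poly_Mapping.single w (Poly_Mapping.lookup f w)) \<and>
    Poly_Mapping.keys (\<Sum>w\<in>W. Poly_Mapping.single w (Poly_Mapping.lookup f w)) \<subseteq> K"
    if "finite W" "W \<subseteq> K" for W
    using that
  proof (induction W)
    case (insert w W)
    have "Poly_Mapping.keys (Poly_Mapping.single w (Poly_Mapping.lookup f w) + (\<Sum>w\<in>W. Poly_Mapping.single w (Poly_Mapping.lookup f w))) \<subseteq> K"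
      using insert by (intro order_trans[OF keys_add]) (auto split: if_splits)
    then show ?case using insert assms(2)[of w] by simp
  qed (simp add: assms(1))
  from this[of "Poly_Mapping.keys f"] show ?thesis using assms(3) by (simp add: words_sum)
qed

lemma words_mult: "f * g = (\<Sum>u\<in>Poly_Mapping.keys f. \<Sum>v\<in>Poly_Mapping.keys g.
    Poly_Mapping.single (u @ v) (Poly_Mapping.lookup f u * Poly_Mapping.lookup g v))"
  for f g :: "('x, 'k::field) words"
proof -
  have "f * g = (\<Sum>u\<in>Poly_Mapping.keys f. Poly_Mapping.single u (Poly_Mapping.lookup f u)) *
      (\<Sum>v\<in>Poly_Mapping.keys g. Poly_Mapping.single v (Poly_Mapping.lookup g v))"
    by (simp only: words_sum)
  also have "\<dots> = (\<Sum>u\<in>Poly_Mapping.keys f. \<Sum>v\<in>Poly_Mapping.keys g.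
      Poly_Mapping.single (u @ v) (Poly_Mapping.lookup f u * Poly_Mapping.lookup g v))"
    by (simp only: sum_product mult_single plus_list_def)
  finally show ?thesis .
qed

lemma lookup_map_times:
  "Poly_Mapping.lookup (Poly_Mapping.map ((*) c) f) k = c * Poly_Mapping.lookup f k"
  for c :: "'k::field"
  by (simp add: Poly_Mapping.map.rep_eq when_def)

lemma scal_map: "Poly_Mapping.map ((*) c) f = scal c f" for f :: "('x, 'k::field) words"
proof (induction f rule: words_induct[where K = UNIV])
  case zero
  show ?case by (rule poly_mapping_eqI) (simp add: lookup_map_times)
next
  case (add w d f)
  have "Poly_Mapping.map ((*) c) (Poly_Mapping.single w d + f)
    = Poly_Mapping.single w (c * d) + Poly_Mapping.map ((*) c) f"
  proof (rule poly_mapping_eqI)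
    fix k
    show "Poly_Mapping.lookup (Poly_Mapping.map ((*) c) (Poly_Mapping.single w d + f)) k
      = Poly_Mapping.lookup (Poly_Mapping.single w (c * d) + Poly_Mapping.map ((*) c) f) k"
      unfolding lookup_map_times lookup_add by (simp add: lookup_single when_def distrib_left)
  qed
  then show ?case using add by (simp add: distrib_left mult_single)
qed simp

lemma scal_central: "f * scal c g = scal c (f * g)" for f :: "('x, 'k::field) words"
proof -
  have "f * Poly_Mapping.single 0 c = Poly_Mapping.single 0 c * f"
  proof (induction f rule: words_induct[where K = UNIV])
    case (add w d f)
    then show ?case by (simp add: distrib_left distrib_right mult_single mult.commute[of c d])
  qed simp_all
  then show ?thesis by (simp only: mult.assoc[symmetric])
qed

lemma scal_simps: "scal c (x + y) = scal c x + scal c y" "scal (c + d) x = scal c x + scal d x"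
  "scal c (scal d x) = scal (c * d) x" "scal 1 x = x" for x :: "('x, 'k::field) words"
  by (simp_all add: distrib_left distrib_right single_add mult.assoc[symmetric] mult_single)

interpretation words: vector_space "scal :: 'k::field \<Rightarrow> ('x, 'k) words \<Rightarrow> _"
  by unfold_locales (simp_all only: scal_simps)

text \<open>A quotient that depends on the graph is not a type, but the linear endomorphisms of the
  word space form one. The quotient is found inside it as a set of operators.\<close>

typedef (overloaded) ('x, 'k::field) endo =
  "{f :: ('x, 'k) words \<Rightarrow> ('x, 'k) words. (\<forall>x y. f (x + y) = f x + f y) \<and> (\<forall>c x. f (scal c x) = scal c (f x))}"
  morphisms app Endo by (rule exI[of _ id]) simp

setup_lifting type_definition_endo

lemma app_add: "app f (x + y) = app f x + app f y"
  using app[of f] by simp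
lemma app_scal: "app f (scal c x) = scal c (app f x)"
  using app[of f] by simp

instantiation endo :: (type, field) ring_1
begin

lift_definition zero_endo :: "('a, 'b) endo" is "\<lambda>_. 0" by simp
lift_definition one_endo :: "('a, 'b) endo" is "\<lambda>x. x" by simp
lift_definition plus_endo :: "('a, 'b) endo \<Rightarrow> ('a, 'b) endo \<Rightarrow> ('a, 'b) endo" is "\<lambda>f g x. f x + g x"
  by (auto simp: distrib_left add_ac)
lift_definition minus_endo :: "('a, 'b) endo \<Rightarrow> ('a, 'b) endo \<Rightarrow> ('a, 'b) endo" is "\<lambda>f g x. f x - g x"
  by (auto simp: right_diff_distrib)
lift_definition uminus_endo :: "('a, 'b) endo \<Rightarrow> ('a, 'b) endo" is "\<lambda>f x. - f x"
  by auto
lift_definition times_endo :: "('a, 'b) endo \<Rightarrow> ('a, 'b) endo \<Rightarrow> ('a, 'b) endo" is "\<lambda>f g x. f (g x)"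
  by auto

lemmas endo_simps = zero_endo.rep_eq one_endo.rep_eq plus_endo.rep_eq minus_endo.rep_eq
  uminus_endo.rep_eq times_endo.rep_eq

instance
proof
  show "(0 :: ('a, 'b) endo) \<noteq> 1"
  proof
    assume "(0 :: ('a, 'b) endo) = 1"
    then have "app (0 :: ('a, 'b) endo) 1 = app 1 1" by simp
    then show False by (simp add: zero_endo.rep_eq one_endo.rep_eq)
  qed
next
  fix f g h :: "('a, 'b) endo"
  have eqI: "f = g" if "\<And>x. app f x = app g x" for f g :: "('a, 'b) endo"
    using that by (simp add: app_inject[symmetric] fun_eq_iff)
  show "f + g + h = f + (g + h)" by (rule eqI) (simp add: endo_simps add.assoc)
  show "f + g = g + f" by (rule eqI) (simp add: endo_simps add.commute)
  show "0 + f = f" by (rule eqI) (simp add: endo_simps)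
  show "- f + f = 0" by (rule eqI) (simp add: endo_simps)
  show "f - g = f + - g" by (rule eqI) (simp add: endo_simps)
  show "f * g * h = f * (g * h)" by (rule eqI) (simp add: endo_simps)
  show "(f + g) * h = f * h + g * h" by (rule eqI) (simp add: endo_simps)
  show "f * (g + h) = f * g + f * h" by (rule eqI) (simp add: endo_simps app_add)
  show "1 * f = f" by (rule eqI) (simp add: endo_simps)
  show "f * 1 = f" by (rule eqI) (simp add: endo_simps)
qed

end

lemma endo_eqI: "(\<And>x. app f x = app g x) \<Longrightarrow> f = g"
  by (simp add: app_inject[symmetric] fun_eq_iff)

lift_definition scalar_endo :: "'k::field \<Rightarrow> ('x, 'k) endo" is "\<lambda>c x. scal c x"
  by (intro conjI allI; simp only: scal_simps(1,3)) (simp only: mult.commute)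

lemma scalar_endo_simps:
  "scalar_endo (c + d) = scalar_endo c + scalar_endo d" "scalar_endo (c * d) = scalar_endo c * scalar_endo d"
  "scalar_endo 1 = 1" "x * scalar_endo c = scalar_endo c * x"
proof -
  show "scalar_endo (c + d) = scalar_endo c + scalar_endo d"
    by (rule endo_eqI) (simp only: scalar_endo.rep_eq endo_simps scal_simps(2))
  show "scalar_endo (c * d) = scalar_endo c * scalar_endo d"
    by (rule endo_eqI) (simp only: scalar_endo.rep_eq endo_simps scal_simps(3))
  show "scalar_endo 1 = 1"
    by (rule endo_eqI) (simp only: scalar_endo.rep_eq endo_simps scal_simps(4))
  show "x * scalar_endo c = scalar_endo c * x"
    by (rule endo_eqI) (simp only: scalar_endo.rep_eq endo_simps app_scal)
qed

text \<open>A basis of \<open>N\<close> is extended to the whole space; \<pi> kills its part in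
  \<open>N\<close> and fixes the added vectors. This is a linear choice of representatives modulo
  \<open>N\<close>.\<close>

lemma ex_reduction:
  fixes N :: "('x, 'k::field) words set"
  assumes "words.subspace N"
  shows "\<exists>\<pi>. (\<forall>x y. \<pi> (x + y) = \<pi> x + \<pi> y) \<and> (\<forall>c x. \<pi> (scal c x) = scal c (\<pi> x)) \<and>
    (\<forall>x\<in>N. \<pi> x = 0) \<and> (\<forall>x. x - \<pi> x \<in> N)"
proof -
  interpret pair: Vector_Spaces.vector_space_pair "scal :: 'k \<Rightarrow> ('x, 'k) words \<Rightarrow> ('x, 'k) words"
      "scal :: 'k \<Rightarrow> ('x, 'k) words \<Rightarrow> ('x, 'k) words"
    by unfold_locales
  obtain B where B: "B \<subseteq> N" "words.independent B" "N \<subseteq> words.span B"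
      "card B = words.dim N"
    by (rule words.basis_exists[of N])
  define B' where "B' = words.extend_basis B"
  have B': "words.independent B'" "words.span B' = UNIV" "B \<subseteq> B'"
    using words.independent_extend_basis[OF B(2)] words.span_extend_basis[OF B(2)]
      words.extend_basis_superset[OF B(2)] by (simp_all add: B'_def)
  define \<pi> where "\<pi> = pair.construct B' (\<lambda>b. if b \<in> B then 0 else b)"
  have lin: "Vector_Spaces.linear scal scal \<pi>"
    unfolding \<pi>_def by (rule pair.linear_construct[OF B'(1)])
  interpret \<pi>: Vector_Spaces.linear scal scal \<pi> by (rule lin)
  have basis: "\<pi> b = (if b \<in> B then 0 else b)" if "b \<in> B'" for b
    unfolding \<pi>_def using pair.construct_basis[OF B'(1) that] .
  have "\<pi> x = 0" if "x \<in> N" for x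
    by (rule pair.linear_eq_0_on_span[OF lin, of B]) (use that B(3) basis B'(3) in auto)
  moreover have "x - \<pi> x \<in> N" for x
  proof -
    have "x \<in> words.span B'" using B'(2) by simp
    then show ?thesis
    proof (induction rule: words.span_induct_alt)
      case base
      show ?case using words.subspace_0[OF assms] by (simp add: \<pi>.zero)
    next
      case (step c b y)
      have "b - \<pi> b \<in> N" using basis[OF step(1)] B(1) words.subspace_0[OF assms] by auto
      then have "scal c (b - \<pi> b) + (y - \<pi> y) \<in> N"
        by (intro words.subspace_add[OF assms] words.subspace_scale[OF assms] step)
      moreover have "scal c b + y - \<pi> (scal c b + y) = scal c (b - \<pi> b) + (y - \<pi> y)"
        by (simp only: \<pi>.add \<pi>.scale right_diff_distrib add_diff_eq diff_add_eq diff_diff_eq2 diff_diff_eq ac_simps)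
      ultimately show ?case by (simp only:)
    qed
  qed
  ultimately show ?thesis
    by (intro exI[of _ \<pi>] conjI allI ballI \<pi>.add \<pi>.scale)
qed

section \<open>Quotients of free algebras\<close>

lemma free_algebra_simps [simp]:
  "carrier (free_algebra X) = {f :: ('x, 'k::field) words. \<forall>w\<in>Poly_Mapping.keys f. w \<noteq> [] \<and> set w \<subseteq> X}"
  "f \<otimes>\<^bsub>free_algebra X\<^esub> g = f * g"
  "f \<oplus>\<^bsub>free_algebra X\<^esub> g = f + g"
  "\<zero>\<^bsub>free_algebra X\<^esub> = 0"
  "c \<odot>\<^bsub>free_algebra X\<^esub> f = scal c f"
  unfolding free_algebra_def by (simp_all add: words_mult[symmetric] scal_map)

lemma keys_uminus [simp]: "Poly_Mapping.keys (- f) = Poly_Mapping.keys f" for f :: "('x, 'k::field) words"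
  by (auto simp: in_keys_iff)

lemma mult_keys:
  fixes f g :: "('x, 'k::field) words"
  assumes "w \<in> Poly_Mapping.keys (f * g)"
  obtains u v where "u \<in> Poly_Mapping.keys f" "v \<in> Poly_Mapping.keys g" "w = u @ v"
  using subsetD[OF keys_mult assms] by (auto simp: plus_list_def)

lemma scal_keys: "Poly_Mapping.keys (scal c f) \<subseteq> Poly_Mapping.keys f" for f :: "('x, 'k::field) words"
  unfolding scal_map[symmetric] by (auto simp: in_keys_iff lookup_map_times)

lemma free_algebra_nonunital_ring: "nonunital_ring (free_algebra X :: ('k::field, ('x, 'k) words) module)"
proof -
  let ?R = "free_algebra X :: ('k, ('x, 'k) words) module"
  have add: "f + g \<in> carrier ?R" if "f \<in> carrier ?R" "g \<in> carrier ?R" for f g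
    using that keys_add[of f g] by auto
  have "abelian_group ?R"
  proof (rule abelian_groupI)
    show "f \<oplus>\<^bsub>?R\<^esub> g \<in> carrier ?R" if "f \<in> carrier ?R" "g \<in> carrier ?R" for f g
      using add[OF that] by simp
    show "\<exists>g\<in>carrier ?R. g \<oplus>\<^bsub>?R\<^esub> f = \<zero>\<^bsub>?R\<^esub>" if "f \<in> carrier ?R" for f
      using that by (intro bexI[of _ "- f"]) simp_all
  qed (simp_all add: add_ac)
  moreover have "nonunital_ring_axioms ?R"
  proof
    show "f \<otimes>\<^bsub>?R\<^esub> g \<in> carrier ?R" if "f \<in> carrier ?R" "g \<in> carrier ?R" for f g
    proof -
      have "w \<noteq> [] \<and> set w \<subseteq> X" if w: "w \<in> Poly_Mapping.keys (f * g)" for w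
        using w by (rule mult_keys) (use \<open>f \<in> carrier ?R\<close> \<open>g \<in> carrier ?R\<close> in auto)
      then show ?thesis by simp
    qed
  qed (simp_all add: mult.assoc distrib_left distrib_right)
  ultimately show ?thesis by (rule nonunital_ring.intro)
qed

lemma free_algebra_minus:
  assumes "f \<in> carrier (free_algebra X)"
  shows "\<ominus>\<^bsub>free_algebra X\<^esub> f = - (f :: ('x, 'k::field) words)"
proof -
  interpret nonunital_ring "free_algebra X :: ('k, ('x, 'k) words) module"
    by (rule free_algebra_nonunital_ring)
  show ?thesis using assms by (intro minus_equality) simp_all
qed

locale word_quotient =
  fixes X :: "'x set" and N :: "('x, 'k::field) words set"
  assumes ideal_N: "two_sided_ideal (free_algebra X) N"
    and N_scal: "f \<in> N \<Longrightarrow> scal c f \<in> N"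
begin

definition W :: "('x, 'k) words set" where "W = carrier (free_algebra X)"

lemma W_iff: "f \<in> W \<longleftrightarrow> (\<forall>w\<in>Poly_Mapping.keys f. w \<noteq> [] \<and> set w \<subseteq> X)"
  by (simp add: W_def)

interpretation FA: nonunital_ring "free_algebra X :: ('k, ('x, 'k) words) module"
  by (rule free_algebra_nonunital_ring)

lemma W_0: "0 \<in> W" by (simp add: W_iff)
lemma W_add: "f \<in> W \<Longrightarrow> g \<in> W \<Longrightarrow> f + g \<in> W"
  using FA.a_closed[of f g] by (simp only: W_def free_algebra_simps(3))
lemma W_minus: "f \<in> W \<Longrightarrow> - f \<in> W" by (simp add: W_iff)
lemma W_mult: "f \<in> W \<Longrightarrow> g \<in> W \<Longrightarrow> f * g \<in> W"
  using FA.m_closed[of f g] by (simp only: W_def free_algebra_simps(2))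
lemma W_scal: "f \<in> W \<Longrightarrow> scal c f \<in> W"
  using scal_keys[of c f] unfolding W_iff by blast

lemma N_W: "f \<in> N \<Longrightarrow> f \<in> W"
  using FA.two_sided_idealD(1)[OF ideal_N] by (auto simp only: W_def)
lemma N_0: "0 \<in> N"
  using FA.two_sided_idealD(2)[OF ideal_N] by (simp only: free_algebra_simps(4))
lemma N_add: "f \<in> N \<Longrightarrow> g \<in> N \<Longrightarrow> f + g \<in> N"
  using FA.two_sided_idealD(3)[OF ideal_N, of f g] by (simp only: free_algebra_simps(3))
lemma N_minus: assumes "f \<in> N" shows "- f \<in> N"
proof -
  have "f \<in> carrier (free_algebra X)" using N_W[OF assms] by (simp only: W_def)
  then show ?thesis
    using FA.two_sided_idealD(4)[OF ideal_N assms] free_algebra_minus[of f X] by (simp only:)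
qed
lemma N_diff: "f \<in> N \<Longrightarrow> g \<in> N \<Longrightarrow> f - g \<in> N"
  using N_add[of f "- g"] N_minus[of g] by simp
lemma N_left: "f \<in> W \<Longrightarrow> g \<in> N \<Longrightarrow> f * g \<in> N"
  using FA.two_sided_idealD(5)[OF ideal_N, of f g] by (simp only: W_def free_algebra_simps(2))
lemma N_right: "f \<in> N \<Longrightarrow> g \<in> W \<Longrightarrow> f * g \<in> N"
  using FA.two_sided_idealD(6)[OF ideal_N, of g f] by (simp only: W_def free_algebra_simps(2))

text \<open>
  The quotient of \<open>W\<close> by \<open>N\<close> acts faithfully from the left on the quotient of the space of all
  words by \<open>N + Z\<close>, where the words in \<open>Z\<close> use a letter outside \<open>X\<close>. The linear map \<open>\<pi>\<close> picks
  representatives in a complement of \<open>N + Z\<close>.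
\<close>

definition Z :: "('x, 'k) words set" where
  "Z = {f. \<forall>w\<in>Poly_Mapping.keys f. \<not> set w \<subseteq> X}"

definition NZ :: "('x, 'k) words set" where
  "NZ = {n + z | n z. n \<in> N \<and> z \<in> Z}"

lemma NZ_I: "n \<in> N \<Longrightarrow> z \<in> Z \<Longrightarrow> n + z \<in> NZ"
  unfolding NZ_def by blast

lemma NZ_E: assumes "f \<in> NZ" obtains n z where "f = n + z" "n \<in> N" "z \<in> Z"
  using assms unfolding NZ_def by blast

lemma Z_0: "0 \<in> Z" by (simp add: Z_def)

lemma Z_add: "f \<in> Z \<Longrightarrow> g \<in> Z \<Longrightarrow> f + g \<in> Z"
  using keys_add[of f g] unfolding Z_def by blast

lemma Z_scal: "f \<in> Z \<Longrightarrow> scal c f \<in> Z"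
  using scal_keys[of c f] unfolding Z_def by blast

lemma Z_left: "f \<in> Z \<Longrightarrow> g * f \<in> Z"
  unfolding Z_def by (auto elim!: mult_keys)

lemma subspace_NZ: "words.subspace NZ"
proof (rule words.subspaceI)
  show "0 \<in> NZ" using NZ_I[OF N_0 Z_0] by simp
  show "f + g \<in> NZ" if f: "f \<in> NZ" and g: "g \<in> NZ" for f g
  proof -
    obtain n z where "f = n + z" "n \<in> N" "z \<in> Z" using f by (rule NZ_E)
    moreover obtain n' z' where "g = n' + z'" "n' \<in> N" "z' \<in> Z" using g by (rule NZ_E)
    ultimately show ?thesis using NZ_I[OF N_add Z_add, of n n' z z'] by (simp add: add_ac)
  qed
  show "scal c f \<in> NZ" if f: "f \<in> NZ" for c f
  proof -
    obtain n z where "f = n + z" "n \<in> N" "z \<in> Z" using f by (rule NZ_E)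
    then show ?thesis using NZ_I[OF N_scal Z_scal, of n z c c] by (simp only: distrib_left)
  qed
qed

lemma NZ_left: assumes "f \<in> W" "g \<in> NZ" shows "f * g \<in> NZ"
proof -
  obtain n z where "g = n + z" "n \<in> N" "z \<in> Z" using assms(2) by (rule NZ_E)
  then show ?thesis using NZ_I[OF N_left Z_left, of f n z f] assms(1) by (simp only: distrib_left)
qed

text \<open>\<open>N\<close> is an ideal of \<open>W\<close> only, so the words outside
  \<open>W\<close> are treated apart: the empty word acts as a scalar, and a word with a foreign
  letter sends everything into \<open>Z\<close>.\<close>

lemma N_mult_NZ: assumes f: "f \<in> N" shows "f * g \<in> NZ"
proof (induction g rule: words_induct[where K = UNIV])
  case zero
  then show ?case using NZ_I[OF N_0 Z_0] by simp
next
  case (add w c g)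
  have "f * Poly_Mapping.single w c \<in> NZ"
  proof -
    consider "w = []" | "w \<noteq> []" "set w \<subseteq> X" | "\<not> set w \<subseteq> X" by blast
    then show ?thesis
    proof cases
      case 1
      have "f * scal c 1 = scal c f" unfolding scal_central by simp
      then have "f * Poly_Mapping.single w c = scal c f" using 1 by (simp add: zero_list_def)
      then show ?thesis using NZ_I[OF N_scal[OF f] Z_0] by simp
    next
      case 2
      then have "Poly_Mapping.single w c \<in> W" by (simp add: W_iff)
      then show ?thesis using NZ_I[OF N_right[OF f] Z_0] by simp
    next
      case 3
      then have "Poly_Mapping.single w c \<in> Z" by (simp add: Z_def)
      then show ?thesis using NZ_I[OF N_0 Z_left] by simp
    qed
  qed
  then show ?case using words.subspace_add[OF subspace_NZ _ add(3)] by (simp only: distrib_left)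
qed simp

lemma NZ_W: assumes "f \<in> NZ" "f \<in> W" shows "f \<in> N"
proof -
  obtain n z where nz: "f = n + z" "n \<in> N" "z \<in> Z" using assms(1) by (rule NZ_E)
  have "z \<in> W" using W_add[OF assms(2) W_minus[OF N_W[OF nz(2)]]] nz(1) by simp
  then have "Poly_Mapping.keys z = {}" using nz(3) by (auto simp: W_iff Z_def)
  then have "z = 0" by simp
  then show ?thesis using nz by simp
qed

definition \<pi> :: "('x, 'k) words \<Rightarrow> ('x, 'k) words" where
  "\<pi> = (SOME \<pi>. (\<forall>x y. \<pi> (x + y) = \<pi> x + \<pi> y) \<and> (\<forall>c x. \<pi> (scal c x) = scal c (\<pi> x)) \<and>
    (\<forall>x\<in>NZ. \<pi> x = 0) \<and> (\<forall>x. x - \<pi> x \<in> NZ))"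

lemma \<pi>: "\<pi> (x + y) = \<pi> x + \<pi> y" "\<pi> (scal c x) = scal c (\<pi> x)" "x \<in> NZ \<Longrightarrow> \<pi> x = 0" "x - \<pi> x \<in> NZ"
proof -
  have *: "(\<forall>x y. \<pi> (x + y) = \<pi> x + \<pi> y) \<and> (\<forall>c x. \<pi> (scal c x) = scal c (\<pi> x)) \<and>
    (\<forall>x\<in>NZ. \<pi> x = 0) \<and> (\<forall>x. x - \<pi> x \<in> NZ)"
    unfolding \<pi>_def by (rule someI_ex[OF ex_reduction[OF subspace_NZ]])
  then show "\<pi> (x + y) = \<pi> x + \<pi> y" "\<pi> (scal c x) = scal c (\<pi> x)" "x \<in> NZ \<Longrightarrow> \<pi> x = 0" "x - \<pi> x \<in> NZ"
    by blast+
qed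

definition \<phi> :: "('x, 'k) words \<Rightarrow> ('x, 'k) endo" where "\<phi> f = Endo (\<lambda>x. \<pi> (f * x))"

lemma app_\<phi>: "app (\<phi> f) x = \<pi> (f * x)"
  unfolding \<phi>_def by (subst Endo_inverse) (simp_all only: mem_Collect_eq distrib_left scal_central \<pi>(1,2) simp_thms)

lemma \<phi>_add: "\<phi> (f + g) = \<phi> f + \<phi> g"
  by (rule endo_eqI) (simp only: app_\<phi> endo_simps distrib_right \<pi>(1))

lemma \<phi>_scal: "\<phi> (scal c f) = scalar_endo c * \<phi> f"
  by (rule endo_eqI) (simp only: app_\<phi> endo_simps scalar_endo.rep_eq mult.assoc[of "Poly_Mapping.single 0 c"] \<pi>(2))

text \<open>Reducing \<open>g * x\<close> before multiplying by \<open>f\<close> changes the product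
  by an element of f NZ. For \<open>f\<close> in \<open>W\<close> this stays in \<open>NZ\<close>,
  where \<pi> vanishes.\<close>

lemma \<phi>_mult: assumes f: "f \<in> W" shows "\<phi> (f * g) = \<phi> f * \<phi> g"
proof (rule endo_eqI)
  fix x
  have "\<pi> (f * (g * x)) = \<pi> (f * (g * x - \<pi> (g * x)) + f * \<pi> (g * x))"
    by (rule arg_cong[of _ _ \<pi>]) (simp add: right_diff_distrib)
  also have "\<dots> = \<pi> (f * \<pi> (g * x))"
    by (simp only: \<pi>(1) \<pi>(3)[OF NZ_left[OF f \<pi>(4)]] add_0)
  finally show "app (\<phi> (f * g)) x = app (\<phi> f * \<phi> g) x"
    by (simp only: app_\<phi> endo_simps mult.assoc)
qed

text \<open>The operator is tested at the empty word, where its value is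
  \<open>\<pi> f\<close>.\<close>

lemma \<phi>_0_iff: assumes f: "f \<in> W" shows "\<phi> f = 0 \<longleftrightarrow> f \<in> N"
proof
  assume "\<phi> f = 0"
  then have "app (\<phi> f) 1 = app 0 1" by simp
  then have "\<pi> f = 0" by (simp add: app_\<phi> endo_simps)
  then have "f \<in> NZ" using \<pi>(4)[of f] by simp
  then show "f \<in> N" using f by (rule NZ_W)
next
  assume "f \<in> N"
  then show "\<phi> f = 0" by (intro endo_eqI) (simp add: app_\<phi> endo_simps \<pi>(3) N_mult_NZ)
qed

lemma \<phi>_eq_iff: assumes "f \<in> W" "g \<in> W" shows "\<phi> f = \<phi> g \<longleftrightarrow> f - g \<in> N"
proof -
  have "\<phi> f = \<phi> (f - g) + \<phi> g" using \<phi>_add[of "f - g" g] by simp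
  then have "\<phi> f = \<phi> g \<longleftrightarrow> \<phi> (f - g) = 0" by simp
  then show ?thesis using \<phi>_0_iff[of "f - g"] W_add[OF assms(1) W_minus[OF assms(2)]] by simp
qed

section \<open>The quotient record and its embedding into the operators\<close>

definition coset :: "('x, 'k) words \<Rightarrow> ('x, 'k) words set" where "coset f = {g. g - f \<in> N}"

lemma coset_eq: "N +>\<^bsub>free_algebra X\<^esub> f = coset f"
proof -
  have "N +>\<^bsub>free_algebra X\<^esub> f = (\<Union>n\<in>N. {n + f})" by (simp add: a_r_coset_def')
  also have "\<dots> = coset f"
    unfolding coset_def
  proof (intro equalityI subsetI)
    fix g assume "g \<in> {g. g - f \<in> N}"
    then show "g \<in> (\<Union>n\<in>N. {n + f})" by (intro UN_I[of "g - f"]) simp_all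
  qed auto
  finally show ?thesis .
qed

lemma coset_W: "f \<in> W \<Longrightarrow> g \<in> coset f \<Longrightarrow> g \<in> W"
  using W_add[of "g - f" f] N_W by (simp add: coset_def)

lemma coset_self: "f \<in> coset f" by (simp add: coset_def N_0)

lemma \<phi>_coset: "f \<in> W \<Longrightarrow> g \<in> coset f \<Longrightarrow> \<phi> g = \<phi> f"
  using \<phi>_eq_iff[OF coset_W] by (simp add: coset_def)

lemma coset_eq_iff: assumes "f \<in> W" "g \<in> W" shows "coset f = coset g \<longleftrightarrow> f - g \<in> N"
proof
  assume "coset f = coset g"
  then show "f - g \<in> N" using coset_self[of f] by (simp add: coset_def)
next
  assume fg: "f - g \<in> N"
  have "h - g \<in> N \<longleftrightarrow> h - f \<in> N" for h
    using N_add[OF _ fg, of "h - f"] N_diff[OF _ fg, of "h - g"] by auto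
  then show "coset f = coset g" by (simp add: coset_def)
qed

abbreviation (input) L :: "('k, ('x, 'k) words set) module" where
  "L \<equiv> quotient_algebra (free_algebra X) N"

lemma carrier_L: "carrier L = coset ` W"
  unfolding quotient_algebra_def ring.extend_def FactRing_def
  by (auto simp: A_RCOSETS_def' coset_eq W_def simp del: free_algebra_simps(1))

lemma add_L: assumes f: "f \<in> W" and g: "g \<in> W" shows "coset f \<oplus>\<^bsub>L\<^esub> coset g = coset (f + g)"
proof -
  have "coset f \<oplus>\<^bsub>L\<^esub> coset g = (\<Union>a\<in>coset f. \<Union>b\<in>coset g. {a + b})"
    unfolding quotient_algebra_def ring.extend_def FactRing_def by (simp add: set_add_def')
  also have "\<dots> = coset (f + g)"
  proof (intro equalityI subsetI)
    fix h assume "h \<in> (\<Union>a\<in>coset f. \<Union>b\<in>coset g. {a + b})"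
    then obtain a b where "h = a + b" "a - f \<in> N" "b - g \<in> N" by (auto simp: coset_def)
    then show "h \<in> coset (f + g)" using N_add[of "a - f" "b - g"] by (simp add: coset_def algebra_simps)
  next
    fix h assume "h \<in> coset (f + g)"
    then have "h - g \<in> coset f" by (simp add: coset_def algebra_simps)
    then show "h \<in> (\<Union>a\<in>coset f. \<Union>b\<in>coset g. {a + b})"
      by (intro UN_I[of "h - g"] UN_I[of g] coset_self) simp_all
  qed
  finally show ?thesis .
qed

lemma mult_L: assumes f: "f \<in> W" and g: "g \<in> W" shows "coset f \<otimes>\<^bsub>L\<^esub> coset g = coset (f * g)"
proof -
  have "coset f \<otimes>\<^bsub>L\<^esub> coset g = (\<Union>a\<in>coset f. \<Union>b\<in>coset g. coset (a * b))"
    unfolding quotient_algebra_def ring.extend_def FactRing_def by (simp add: rcoset_mult_def coset_eq)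
  also have "\<dots> = (\<Union>a\<in>coset f. \<Union>b\<in>coset g. coset (f * g))"
  proof (intro SUP_cong refl)
    fix a b assume ab: "a \<in> coset f" "b \<in> coset g"
    have W: "a \<in> W" "b \<in> W" using ab f g coset_W by blast+
    have "a * (b - g) + (a - f) * g \<in> N"
      using ab W g by (intro N_add N_left N_right) (simp_all add: coset_def)
    then have "a * b - f * g \<in> N" by (simp add: algebra_simps)
    then show "coset (a * b) = coset (f * g)" using coset_eq_iff W_mult W f g by blast
  qed
  also have "\<dots> = coset (f * g)" using coset_self[of f] coset_self[of g] by blast
  finally show ?thesis .
qed

lemma zero_L: "\<zero>\<^bsub>L\<^esub> = coset 0"
  unfolding quotient_algebra_def ring.extend_def FactRing_def by (simp add: coset_def)

definition \<Phi> :: "('x, 'k) words set \<Rightarrow> ('x, 'k) endo" where "\<Phi> C = \<phi> (SOME f. f \<in> C)"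

lemma \<Phi>_coset: "f \<in> W \<Longrightarrow> \<Phi> (coset f) = \<phi> f"
  unfolding \<Phi>_def by (erule \<phi>_coset) (rule someI[of _ f], rule coset_self)

lemma nonunital_ring_L: "nonunital_ring L"
proof -
  have "abelian_group L"
  proof (rule abelian_groupI)
    fix x y z
    assume "x \<in> carrier L" "y \<in> carrier L" "z \<in> carrier L"
    then obtain f g h where W: "f \<in> W" "g \<in> W" "h \<in> W" and "x = coset f" "y = coset g" "z = coset h"
      unfolding carrier_L by blast
    then show "x \<oplus>\<^bsub>L\<^esub> y \<oplus>\<^bsub>L\<^esub> z = x \<oplus>\<^bsub>L\<^esub> (y \<oplus>\<^bsub>L\<^esub> z)"
      by (simp only: add_L W_add add.assoc)
  next
    fix x y
    assume "x \<in> carrier L" "y \<in> carrier L"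
    then obtain f g where W: "f \<in> W" "g \<in> W" and "x = coset f" "y = coset g"
      unfolding carrier_L by blast
    then show "x \<oplus>\<^bsub>L\<^esub> y = y \<oplus>\<^bsub>L\<^esub> x" "x \<oplus>\<^bsub>L\<^esub> y \<in> carrier L"
      using W_add[OF W] by (simp_all only: add_L add.commute carrier_L imageI)
  next
    fix x
    assume "x \<in> carrier L"
    then obtain f where W: "f \<in> W" and x: "x = coset f" unfolding carrier_L by blast
    show "\<zero>\<^bsub>L\<^esub> \<oplus>\<^bsub>L\<^esub> x = x" using W W_0 by (simp only: x zero_L add_L add_0)
    show "\<exists>y\<in>carrier L. y \<oplus>\<^bsub>L\<^esub> x = \<zero>\<^bsub>L\<^esub>"
    proof (rule bexI[of _ "coset (- f)"])
      show "coset (- f) \<oplus>\<^bsub>L\<^esub> x = \<zero>\<^bsub>L\<^esub>"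
        using W W_minus[OF W] by (simp only: x zero_L add_L left_minus)
      show "coset (- f) \<in> carrier L" using W_minus[OF W] by (simp only: carrier_L imageI)
    qed
  next
    show "\<zero>\<^bsub>L\<^esub> \<in> carrier L" using W_0 by (simp only: carrier_L zero_L imageI)
  qed
  moreover have "nonunital_ring_axioms L"
  proof
    fix x y z
    assume "x \<in> carrier L" "y \<in> carrier L" "z \<in> carrier L"
    then obtain f g h where W: "f \<in> W" "g \<in> W" "h \<in> W" and "x = coset f" "y = coset g" "z = coset h"
      unfolding carrier_L by blast
    then show "x \<otimes>\<^bsub>L\<^esub> y \<otimes>\<^bsub>L\<^esub> z = x \<otimes>\<^bsub>L\<^esub> (y \<otimes>\<^bsub>L\<^esub> z)"
      "(x \<oplus>\<^bsub>L\<^esub> y) \<otimes>\<^bsub>L\<^esub> z = x \<otimes>\<^bsub>L\<^esub> z \<oplus>\<^bsub>L\<^esub> y \<otimes>\<^bsub>L\<^esub> z"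
      "z \<otimes>\<^bsub>L\<^esub> (x \<oplus>\<^bsub>L\<^esub> y) = z \<otimes>\<^bsub>L\<^esub> x \<oplus>\<^bsub>L\<^esub> z \<otimes>\<^bsub>L\<^esub> y"
      by (simp_all only: add_L mult_L W_add W_mult mult.assoc distrib_left distrib_right)
  next
    fix x y
    assume "x \<in> carrier L" "y \<in> carrier L"
    then obtain f g where W: "f \<in> W" "g \<in> W" and "x = coset f" "y = coset g"
      unfolding carrier_L by blast
    then show "x \<otimes>\<^bsub>L\<^esub> y \<in> carrier L"
      using W_mult[OF W] by (simp only: mult_L carrier_L imageI)
  qed
  ultimately show ?thesis by (rule nonunital_ring.intro)
qed

lemma \<Phi>_add_L: "x \<in> carrier L \<Longrightarrow> y \<in> carrier L \<Longrightarrow> \<Phi> (x \<oplus>\<^bsub>L\<^esub> y) = \<Phi> x + \<Phi> y"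
  unfolding carrier_L by (auto simp: add_L \<Phi>_coset W_add \<phi>_add)

lemma \<Phi>_mult_L: "x \<in> carrier L \<Longrightarrow> y \<in> carrier L \<Longrightarrow> \<Phi> (x \<otimes>\<^bsub>L\<^esub> y) = \<Phi> x * \<Phi> y"
  unfolding carrier_L by (auto simp: mult_L \<Phi>_coset W_mult \<phi>_mult)

lemma inj_\<Phi>: "inj_on \<Phi> (carrier L)"
  unfolding carrier_L by (auto simp: inj_on_def \<Phi>_coset \<phi>_eq_iff coset_eq_iff)

lemma image_\<Phi>: "\<Phi> ` carrier L = \<phi> ` W"
  unfolding carrier_L image_image by (rule image_cong) (simp_all add: \<Phi>_coset)

end

lemma generated_algebra_ideal_quotient:
  fixes R :: "('x, 'k::field) words set"
  assumes "R \<subseteq> carrier (free_algebra X)"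
  shows "word_quotient X (generated_algebra_ideal (free_algebra X) R)"
    and "R \<subseteq> generated_algebra_ideal (free_algebra X) R"
proof -
  let ?F = "free_algebra X :: ('k, ('x, 'k) words) module"
  interpret FA: nonunital_ring ?F by (rule free_algebra_nonunital_ring)
  define \<J> where "\<J> = {I. two_sided_ideal ?F I \<and> (\<forall>c. \<forall>a\<in>I. c \<odot>\<^bsub>?F\<^esub> a \<in> I) \<and> R \<subseteq> I}"
  have gen: "generated_algebra_ideal ?F R = \<Inter>\<J>"
    by (simp only: generated_algebra_ideal_def \<J>_def)
  have J: "two_sided_ideal ?F I" if "I \<in> \<J>" for I using that unfolding \<J>_def by blast
  have "two_sided_ideal ?F (carrier ?F)"
    by (rule FA.two_sided_idealI)
      (rule order_refl FA.zero_closed FA.a_closed FA.a_inv_closed FA.m_closed; assumption)+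
  moreover have "c \<odot>\<^bsub>?F\<^esub> a \<in> carrier ?F" if "a \<in> carrier ?F" for c a
    using that scal_keys[of c a] unfolding free_algebra_simps(1,5) by blast
  \<comment> \<open>The whole carrier takes part in the intersection, which is therefore contained
    in the free algebra.\<close>
  ultimately have carrier: "carrier ?F \<in> \<J>" unfolding \<J>_def using assms by blast
  have "two_sided_ideal ?F (\<Inter>\<J>)"
  proof (rule FA.two_sided_idealI)
    show "\<Inter>\<J> \<subseteq> carrier ?F" using carrier by (rule Inter_lower)
    note D = FA.two_sided_idealD[OF J]
    show "\<zero>\<^bsub>?F\<^esub> \<in> \<Inter>\<J>" by (rule InterI) (rule D(2))
    show "x \<oplus>\<^bsub>?F\<^esub> y \<in> \<Inter>\<J>" if "x \<in> \<Inter>\<J>" "y \<in> \<Inter>\<J>" for x y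
      by (rule InterI) (rule D(3)[OF _ InterD[OF that(1)] InterD[OF that(2)]])
    show "\<ominus>\<^bsub>?F\<^esub> x \<in> \<Inter>\<J>" if "x \<in> \<Inter>\<J>" for x
      by (rule InterI) (rule D(4)[OF _ InterD[OF that]])
    show "x \<otimes>\<^bsub>?F\<^esub> a \<in> \<Inter>\<J>" "a \<otimes>\<^bsub>?F\<^esub> x \<in> \<Inter>\<J>"
      if "x \<in> carrier ?F" "a \<in> \<Inter>\<J>" for x a
    proof -
      show "x \<otimes>\<^bsub>?F\<^esub> a \<in> \<Inter>\<J>"
        by (rule InterI) (rule D(5)[OF _ that(1) InterD[OF that(2)]])
      show "a \<otimes>\<^bsub>?F\<^esub> x \<in> \<Inter>\<J>"
        by (rule InterI) (rule D(6)[OF _ that(1) InterD[OF that(2)]])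
    qed
  qed
  moreover have "scal c a \<in> \<Inter>\<J>" if a: "a \<in> \<Inter>\<J>" for c a
  proof (rule InterI)
    fix I assume I: "I \<in> \<J>"
    have "a \<in> I" by (rule InterD[OF a I])
    then have "c \<odot>\<^bsub>?F\<^esub> a \<in> I" using I unfolding \<J>_def by blast
    then show "scal c a \<in> I" by (simp only: free_algebra_simps(5))
  qed
  ultimately show "word_quotient X (generated_algebra_ideal ?F R)"
    unfolding gen by (rule word_quotient.intro)
  show "R \<subseteq> generated_algebra_ideal ?F R" unfolding gen \<J>_def by blast
qed

section \<open>The grading of a Leavitt path algebra\<close>

primrec gen_degree :: "('v, 'e) lpa_gen \<Rightarrow> int" where
  "gen_degree (Vertex v) = 0"
| "gen_degree (Edge e) = 1"
| "gen_degree (Ghost e) = - 1"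

definition word_degree :: "('v, 'e) lpa_gen list \<Rightarrow> int" where
  "word_degree w = sum_list (map gen_degree w)"

lemma word_degree_simps [simp]:
  "word_degree [] = 0" "word_degree (x # w) = gen_degree x + word_degree w"
  "word_degree (u @ w) = word_degree u + word_degree w" "word_degree 0 = 0"
  by (simp_all add: word_degree_def zero_list_def)

definition component :: "int \<Rightarrow> (('v, 'e) lpa_gen, 'k::field) words \<Rightarrow> (('v, 'e) lpa_gen, 'k) words" where
  "component n f = Poly_Mapping.mapp (\<lambda>w c. c when word_degree w = n) f"

lemma lookup_component:
  "Poly_Mapping.lookup (component n f) w = (if word_degree w = n then Poly_Mapping.lookup f w else 0)"
  by (auto simp: component_def lookup_mapp when_def in_keys_iff)

lemma component_0: "component n 0 = 0"
  by (rule poly_mapping_eqI) (simp add: lookup_component)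

lemma component_add: "component n (f + g) = component n f + component n g"
  by (rule poly_mapping_eqI) (simp add: lookup_component lookup_add)

lemma component_diff: "component n (f - g) = component n f - component n g"
  by (rule poly_mapping_eqI) (simp add: lookup_component lookup_minus)

lemma component_uminus: "component n (- f) = - component n f"
  using component_diff[of n 0 f] by (simp add: component_0)

lemma component_sum: "component n (sum f I) = (\<Sum>i\<in>I. component n (f i))"
  by (induction I rule: infinite_finite_induct) (simp_all add: component_0 component_add)

lemma component_single:
  "component n (Poly_Mapping.single w c) = (if n = word_degree w then Poly_Mapping.single w c else 0)"
  by (rule poly_mapping_eqI) (auto simp: lookup_component lookup_single when_def)

lemma component_mult_left:
  "component n (Poly_Mapping.single w c * f) = Poly_Mapping.single w c * component (n - word_degree w) f"
proof (induction f rule: words_induct[where K = UNIV])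
  case (add u d f)
  have "component n (Poly_Mapping.single w c * Poly_Mapping.single u d)
    = Poly_Mapping.single w c * component (n - word_degree w) (Poly_Mapping.single u d)"
    by (auto simp: mult_single plus_list_def component_single)
  then show ?case using add by (simp only: distrib_left component_add)
qed (simp_all add: component_0)

lemma component_mult_right:
  "component n (f * Poly_Mapping.single w c) = component (n - word_degree w) f * Poly_Mapping.single w c"
proof (induction f rule: words_induct[where K = UNIV])
  case (add u d f)
  have "component n (Poly_Mapping.single u d * Poly_Mapping.single w c)
    = component (n - word_degree w) (Poly_Mapping.single u d) * Poly_Mapping.single w c"
    by (auto simp: mult_single plus_list_def component_single)
  then show ?case using add by (simp only: distrib_left distrib_right component_add)
qed (simp_all add: component_0)

text \<open>Homogeneity stated through all components, so that 0 is pure of every degree and sums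
  need no case distinction.\<close>

definition pure :: "int \<Rightarrow> (('v, 'e) lpa_gen, 'k::field) words \<Rightarrow> bool" where
  "pure m f \<longleftrightarrow> (\<forall>n. component n f = (if n = m then f else 0))"

lemma pure_single: "word_degree w = m \<Longrightarrow> pure m (Poly_Mapping.single w c)"
  by (simp add: pure_def component_single)
lemma pure_0: "pure m 0" by (simp add: pure_def component_0)
lemma pure_add: "pure m f \<Longrightarrow> pure m g \<Longrightarrow> pure m (f + g)" by (simp add: pure_def component_add)
lemma pure_diff: "pure m f \<Longrightarrow> pure m g \<Longrightarrow> pure m (f - g)" by (simp add: pure_def component_diff)
lemma pure_sum: "(\<And>i. i \<in> I \<Longrightarrow> pure m (f i)) \<Longrightarrow> pure m (sum f I)"
  by (simp add: pure_def component_sum)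
lemma pure_left: "pure m f \<Longrightarrow> pure (m + word_degree w) (Poly_Mapping.single w c * f)"
  by (auto simp: pure_def component_mult_left)
lemma pure_right: "pure m f \<Longrightarrow> pure (m + word_degree w) (f * Poly_Mapping.single w c)"
  by (auto simp: pure_def component_mult_right)

lemma lpa_relations_pure: "f \<in> lpa_relations E \<Longrightarrow> \<exists>m. pure m f"
  unfolding lpa_relations_def
  by (elim UnE CollectE exE conjE; simp only:)
    (rule exI, rule pure_diff; (rule pure_sum)?; (split if_split)?; (intro conjI impI pure_0)?; rule pure_single; simp)+

lemma free_algebra_word: "w \<noteq> [] \<Longrightarrow> set w \<subseteq> X \<Longrightarrow> Poly_Mapping.single w c \<in> carrier (free_algebra X)"
  by simp

lemma free_algebra_diff:
  "f \<in> carrier (free_algebra X) \<Longrightarrow> g \<in> carrier (free_algebra X) \<Longrightarrow> f - g \<in> carrier (free_algebra X)"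
  using keys_diff[of f g] by auto

lemma free_algebra_sum:
  assumes "\<And>i. i \<in> I \<Longrightarrow> f i \<in> carrier (free_algebra X)"
  shows "sum f I \<in> carrier (free_algebra X)"
proof -
  have "w \<noteq> [] \<and> set w \<subseteq> X" if w: "w \<in> Poly_Mapping.keys (sum f I)" for w
  proof -
    obtain i where "i \<in> I" "w \<in> Poly_Mapping.keys (f i)" using subsetD[OF keys_sum w] by blast
    then show ?thesis using assms[of i] by simp
  qed
  then show ?thesis by simp
qed

lemma lpa_gens_iff [simp]:
  "Vertex v \<in> lpa_gens E \<longleftrightarrow> v \<in> verts E" "Edge e \<in> lpa_gens E \<longleftrightarrow> e \<in> arcs E"
  "Ghost e \<in> lpa_gens E \<longleftrightarrow> e \<in> arcs E"
  by (auto simp: lpa_gens_def)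

lemma lpa_relations_carrier:
  assumes "wf_digraph E"
  shows "(lpa_relations E :: (('v, 'e) lpa_gen, 'k::field) words set) \<subseteq> carrier (free_algebra (lpa_gens E))"
proof
  fix f :: "(('v, 'e) lpa_gen, 'k) words" assume "f \<in> lpa_relations E"
  then show "f \<in> carrier (free_algebra (lpa_gens E))"
    unfolding lpa_relations_def
  proof (elim UnE CollectE exE conjE)
    fix v w assume "f = word [Vertex v, Vertex w] - (if v = w then word [Vertex v] else 0)"
      "v \<in> verts E" "w \<in> verts E"
    then show ?thesis by (simp only:) (rule free_algebra_diff; simp)
  next
    fix e f' assume "f = word [Ghost e, Edge f'] - (if e = f' then word [Vertex (head E e)] else 0)"
      "e \<in> arcs E" "f' \<in> arcs E"
    then show ?thesis
      by (simp only:) (rule free_algebra_diff; simp add: wf_digraph.head_in_verts[OF assms])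
  next
    fix v assume f: "f = word [Vertex v] - (\<Sum>e\<in>out_arcs E v. word [Edge e, Ghost e])" "regular_vertex E v"
    have "word [Vertex v] \<in> carrier (free_algebra (lpa_gens E))"
      using f(2) by (intro free_algebra_word) (simp_all add: regular_vertex_def)
    moreover have "(\<Sum>e\<in>out_arcs E v. word [Edge e, Ghost e]) \<in> carrier (free_algebra (lpa_gens E))"
      by (intro free_algebra_sum free_algebra_word) auto
    ultimately show ?thesis unfolding f(1) by (rule free_algebra_diff)
  qed ((simp only:)?, rule free_algebra_diff; rule free_algebra_word;
      simp add: wf_digraph.head_in_verts[OF assms] wf_digraph.tail_in_verts[OF assms])+
qed

locale leavitt_presentation =
  fixes E :: "('v, 'e) pre_digraph" and N :: "(('v, 'e) lpa_gen, 'k::field) words set"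
  assumes wf: "wf_digraph E"
    and N_eq: "N = generated_algebra_ideal (free_algebra (lpa_gens E)) (lpa_relations E)"

sublocale leavitt_presentation \<subseteq> word_quotient "lpa_gens E" N
  unfolding N_eq by (rule generated_algebra_ideal_quotient(1)[OF lpa_relations_carrier[OF wf]])

context leavitt_presentation
begin

lemma relations_N: "lpa_relations E \<subseteq> N"
  unfolding N_eq by (rule generated_algebra_ideal_quotient(2)[OF lpa_relations_carrier[OF wf]])

lemma W_word: "w \<noteq> [] \<Longrightarrow> set w \<subseteq> lpa_gens E \<Longrightarrow> Poly_Mapping.single w c \<in> W"
  unfolding W_def by (rule free_algebra_word)

lemma W_induct [consumes 1, case_names zero add]:
  assumes "f \<in> W" "Q 0"
    and "\<And>w c f. w \<noteq> [] \<Longrightarrow> set w \<subseteq> lpa_gens E \<Longrightarrow> f \<in> W \<Longrightarrow> Q f \<Longrightarrow> Q (Poly_Mapping.single w c + f)"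
  shows "Q f"
proof (rule words_induct[where K = "{w. w \<noteq> [] \<and> set w \<subseteq> lpa_gens E}"])
  show "Q 0" by fact
  show "Poly_Mapping.keys f \<subseteq> {w. w \<noteq> [] \<and> set w \<subseteq> lpa_gens E}" using assms(1) by (auto simp: W_iff)
  show "Q (Poly_Mapping.single w c + g)"
    if "w \<in> {w. w \<noteq> [] \<and> set w \<subseteq> lpa_gens E}"
      "Poly_Mapping.keys g \<subseteq> {w. w \<noteq> [] \<and> set w \<subseteq> lpa_gens E}" "Q g" for w c g
    using that by (intro assms(3)) (auto simp: W_iff)
qed

lemma W_component: "f \<in> W \<Longrightarrow> component n f \<in> W"
  by (auto simp: W_iff in_keys_iff lookup_component split: if_splits)

text \<open>The elements all of whose components lie in \<open>N\<close> form an ideal closed under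
  scalars. It contains the relations, because each of them is pure, so it contains the generated
  ideal \<open>N\<close>.\<close>

lemma N_component: assumes "f \<in> N" shows "component n f \<in> N"
proof -
  interpret FA: nonunital_ring "free_algebra (lpa_gens E) :: ('k, (('v, 'e) lpa_gen, 'k) words) module"
    by (rule free_algebra_nonunital_ring)
  define M where "M = {f \<in> W. \<forall>n. component n f \<in> N}"
  have left: "f * g \<in> M" if f: "f \<in> W" and g: "g \<in> M" for f g
    using f
  proof (induction rule: W_induct)
    case zero
    show ?case by (simp add: M_def W_0 component_0 N_0)
  next
    case (add w c f)
    have gW: "g \<in> W" "\<And>n. component n g \<in> N" using g by (auto simp: M_def)
    have "component n ((Poly_Mapping.single w c + f) * g) \<in> N" for n
      unfolding distrib_right component_add component_mult_left
      using add gW(2) N_left[OF W_word[OF add(1,2)]] by (intro N_add) (auto simp: M_def)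
    moreover have "(Poly_Mapping.single w c + f) * g \<in> W"
      using W_mult[OF W_add[OF W_word[OF add(1,2)] add(3)] gW(1)] .
    ultimately show ?case by (simp add: M_def)
  qed
  have right: "g * f \<in> M" if f: "f \<in> W" and g: "g \<in> M" for f g
    using f
  proof (induction rule: W_induct)
    case zero
    show ?case by (simp add: M_def W_0 component_0 N_0)
  next
    case (add w c f)
    have gW: "g \<in> W" "\<And>n. component n g \<in> N" using g by (auto simp: M_def)
    have "component n (g * (Poly_Mapping.single w c + f)) \<in> N" for n
      unfolding distrib_left component_add component_mult_right
      using add gW(2) N_right[OF _ W_word[OF add(1,2)]] by (intro N_add) (auto simp: M_def)
    moreover have "g * (Poly_Mapping.single w c + f) \<in> W"
      using W_mult[OF gW(1) W_add[OF W_word[OF add(1,2)] add(3)]] .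
    ultimately show ?case by (simp add: M_def)
  qed
  have "two_sided_ideal (free_algebra (lpa_gens E)) M"
  proof (rule FA.two_sided_idealI)
    show "M \<subseteq> carrier (free_algebra (lpa_gens E))" by (auto simp only: M_def W_def)
    show "\<zero>\<^bsub>free_algebra (lpa_gens E)\<^esub> \<in> M" by (simp add: M_def W_0 component_0 N_0)
    show "f \<oplus>\<^bsub>free_algebra (lpa_gens E)\<^esub> g \<in> M" if "f \<in> M" "g \<in> M" for f g
      using that by (simp add: M_def W_add component_add N_add)
    show "\<ominus>\<^bsub>free_algebra (lpa_gens E)\<^esub> f \<in> M" if "f \<in> M" for f
    proof -
      have "f \<in> carrier (free_algebra (lpa_gens E))" using that by (simp only: M_def W_def mem_Collect_eq)
      then have "\<ominus>\<^bsub>free_algebra (lpa_gens E)\<^esub> f = - f" by (rule free_algebra_minus)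
      then show ?thesis using that by (simp add: M_def W_minus component_uminus N_minus)
    qed
    show "f \<otimes>\<^bsub>free_algebra (lpa_gens E)\<^esub> g \<in> M" "g \<otimes>\<^bsub>free_algebra (lpa_gens E)\<^esub> f \<in> M"
      if "f \<in> carrier (free_algebra (lpa_gens E))" "g \<in> M" for f g
      using left[of f g] right[of f g] that by (simp_all only: W_def free_algebra_simps(2))
  qed
  moreover have "c \<odot>\<^bsub>free_algebra (lpa_gens E)\<^esub> f \<in> M" if "f \<in> M" for c f
    using that by (simp add: M_def W_scal component_mult_left N_scal)
  moreover have "lpa_relations E \<subseteq> M"
  proof
    fix f :: "(('v, 'e) lpa_gen, 'k) words" assume f: "f \<in> lpa_relations E"
    then obtain m where m: "pure m f" using lpa_relations_pure by blast
    have "f \<in> N" using f relations_N by blast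
    then show "f \<in> M" using m N_W N_0 by (auto simp: M_def pure_def)
  qed
  ultimately have "N \<subseteq> M"
    unfolding N_eq[unfolded generated_algebra_ideal_def] by (intro Inter_lower) blast
  then show ?thesis using assms by (auto simp: M_def)
qed

section \<open>The generators as operators, and their grading\<close>

abbreviation vx :: "'v \<Rightarrow> (('v, 'e) lpa_gen, 'k) endo" where "vx v \<equiv> \<phi> (word [Vertex v])"
abbreviation ed :: "'e \<Rightarrow> (('v, 'e) lpa_gen, 'k) endo" where "ed e \<equiv> \<phi> (word [Edge e])"
abbreviation gh :: "'e \<Rightarrow> (('v, 'e) lpa_gen, 'k) endo" where "gh e \<equiv> \<phi> (word [Ghost e])"

lemma \<phi>_0: "\<phi> 0 = 0" using \<phi>_0_iff[OF W_0] N_0 by simp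

lemma \<phi>_word_mult:
  "u \<noteq> [] \<Longrightarrow> set u \<subseteq> lpa_gens E \<Longrightarrow> \<phi> (word u) * \<phi> (word w) = \<phi> (word (u @ w))"
  using \<phi>_mult[OF W_word, of u 1 "word w"] by (simp add: mult_single plus_list_def)

lemma \<phi>_relation: "f - g \<in> lpa_relations E \<Longrightarrow> \<phi> f = \<phi> g"
proof -
  assume "f - g \<in> lpa_relations E"
  then have "f - g \<in> N" using relations_N by blast
  then have "\<phi> (f - g) = 0" using \<phi>_0_iff[OF N_W] by blast
  then show ?thesis using \<phi>_add[of "f - g" g] by simp
qed

lemma \<phi>_gen_mult: "x \<in> lpa_gens E \<Longrightarrow> \<phi> (word [x]) * \<phi> (word [y]) = \<phi> (word [x, y])"
  using \<phi>_word_mult[of "[x]" "[y]"] by simp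

lemma vx_vx:
  assumes "v \<in> verts E" "w \<in> verts E"
  shows "vx v * vx w = (if v = w then vx v else 0)"
proof -
  have "vx v * vx w = \<phi> (word [Vertex v, Vertex w])"
    by (rule \<phi>_gen_mult) (simp only: lpa_gens_iff assms)
  \<comment> \<open>The chain of \<open>UnI1\<close> and \<open>UnI2\<close> selects the family of
    relations by its place in the union.\<close>
  also have "\<dots> = \<phi> (if v = w then word [Vertex v] else 0)"
    by (rule \<phi>_relation) (unfold lpa_relations_def, rule UnI1, rule UnI1, rule UnI1, rule UnI1, rule UnI1, rule UnI1,
        rule CollectI, rule exI[of _ v], rule exI[of _ w], intro conjI refl assms)
  finally show ?thesis by (simp only: \<phi>_0 if_distrib[of \<phi>])
qed

lemma gh_ed:
  assumes "e \<in> arcs E" "f \<in> arcs E"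
  shows "gh e * ed f = (if e = f then vx (head E e) else 0)"
proof -
  have "gh e * ed f = \<phi> (word [Ghost e, Edge f])"
    by (rule \<phi>_gen_mult) (simp only: lpa_gens_iff assms)
  also have "\<dots> = \<phi> (if e = f then word [Vertex (head E e)] else 0)"
    by (rule \<phi>_relation) (unfold lpa_relations_def, rule UnI1, rule UnI2,
        rule CollectI, rule exI[of _ e], rule exI[of _ f], intro conjI refl assms)
  finally show ?thesis by (simp only: \<phi>_0 if_distrib[of \<phi>])
qed

lemma endpoint_relations:
  assumes e: "e \<in> arcs E"
  shows "vx (tail E e) * ed e = ed e" "ed e * vx (head E e) = ed e"
    and "vx (head E e) * gh e = gh e" "gh e * vx (tail E e) = gh e"
proof -
  have V: "tail E e \<in> verts E" "head E e \<in> verts E"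
    by (rule wf_digraph.tail_in_verts[OF wf e], rule wf_digraph.head_in_verts[OF wf e])
  have gens: "Vertex (tail E e) \<in> lpa_gens E" "Vertex (head E e) \<in> lpa_gens E"
    "Edge e \<in> lpa_gens E" "Ghost e \<in> lpa_gens E"
    by (simp_all only: lpa_gens_iff V e)
  show "vx (tail E e) * ed e = ed e" unfolding \<phi>_gen_mult[OF gens(1)]
    by (rule \<phi>_relation) (unfold lpa_relations_def, rule UnI1, rule UnI1, rule UnI1, rule UnI1, rule UnI1, rule UnI2,
        rule CollectI, rule exI[of _ e], intro conjI refl e)
  show "ed e * vx (head E e) = ed e" unfolding \<phi>_gen_mult[OF gens(3)]
    by (rule \<phi>_relation) (unfold lpa_relations_def, rule UnI1, rule UnI1, rule UnI1, rule UnI1, rule UnI2,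
        rule CollectI, rule exI[of _ e], intro conjI refl e)
  show "vx (head E e) * gh e = gh e" unfolding \<phi>_gen_mult[OF gens(2)]
    by (rule \<phi>_relation) (unfold lpa_relations_def, rule UnI1, rule UnI1, rule UnI1, rule UnI2,
        rule CollectI, rule exI[of _ e], intro conjI refl e)
  show "gh e * vx (tail E e) = gh e" unfolding \<phi>_gen_mult[OF gens(4)]
    by (rule \<phi>_relation) (unfold lpa_relations_def, rule UnI1, rule UnI1, rule UnI2,
        rule CollectI, rule exI[of _ e], intro conjI refl e)
qed

sublocale lf: leavitt_family "verts E" "arcs E" "tail E" "head E" scalar_endo vx ed gh
  by unfold_locales
    (fact wf_digraph.tail_in_verts[OF wf] wf_digraph.head_in_verts[OF wf] scalar_endo_simps
      vx_vx endpoint_relations gh_ed)+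

text \<open>A monomial is lifted letter by letter: ghost edges are attached to the vertex on the
  right, edges on the left, and each letter shifts the degree of the pure word by one.\<close>

lemma image_homog: assumes "x \<in> lf.homog n" shows "\<exists>f\<in>W. pure n f \<and> \<phi> f = x"
  using assms unfolding lf.homog_def
proof (induction rule: lf.lspan.induct)
  case zero
  show ?case using W_0 pure_0 \<phi>_0 by blast
next
  case (add b x c)
  then obtain g where g: "g \<in> W" "pure n g" "\<phi> g = x" by blast
  from add(1) obtain as bs v where b: "b = lf.ep as * vx v * lf.gp bs" "set as \<subseteq> arcs E"
    "set bs \<subseteq> arcs E" "v \<in> verts E" "int (length as) - int (length bs) = n"
    by (auto elim!: lf.monomials.cases)
  have "\<exists>f\<in>W. pure (- int (length bs)) f \<and> \<phi> f = vx v * lf.gp bs"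
    using b(3)
  proof (induction bs)
    case Nil
    have "word [Vertex v] \<in> W" using b(4) by (intro W_word) (simp_all)
    moreover have "pure 0 (word [Vertex v])" by (rule pure_single) simp
    ultimately show ?case by (intro bexI[of _ "word [Vertex v]"] conjI) simp_all
  next
    case (Cons e bs)
    then obtain f where f: "f \<in> W" "pure (- int (length bs)) f" "\<phi> f = vx v * lf.gp bs" by auto
    have "word [Ghost e] \<in> W" using Cons.prems by (intro W_word) (simp_all)
    then have "f * word [Ghost e] \<in> W" by (rule W_mult[OF f(1)])
    moreover have "pure (- int (length (e # bs))) (f * word [Ghost e])"
    proof -
      have "- int (length bs) + word_degree [Ghost e :: ('v, 'e) lpa_gen] = - int (length (e # bs))" by simp
      then show ?thesis using pure_right[OF f(2), of "[Ghost e]" 1] by (simp only:)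
    qed
    moreover have "\<phi> (f * word [Ghost e]) = vx v * lf.gp (e # bs)"
      by (simp only: \<phi>_mult[OF f(1)] f(3) lf.gp_simps mult.assoc)
    ultimately show ?case by blast
  qed
  then obtain f where f: "f \<in> W" "pure (- int (length bs)) f" "\<phi> f = vx v * lf.gp bs" by blast
  have "\<exists>h\<in>W. pure (int (length as) - int (length bs)) h \<and> \<phi> h = lf.ep as * (vx v * lf.gp bs)"
    using b(2)
  proof (induction as)
    case Nil
    then show ?case using f by (intro bexI[of _ f] conjI) simp_all
  next
    case (Cons e as)
    then obtain h where h: "h \<in> W" "pure (int (length as) - int (length bs)) h"
      "\<phi> h = lf.ep as * (vx v * lf.gp bs)" by auto
    have e: "word [Edge e] \<in> W" using Cons.prems by (intro W_word) (simp_all)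
    then have "word [Edge e] * h \<in> W" using h(1) by (rule W_mult)
    moreover have "pure (int (length (e # as)) - int (length bs)) (word [Edge e] * h)"
      using pure_left[OF h(2), of "[Edge e]" 1] by (simp add: algebra_simps)
    moreover have "\<phi> (word [Edge e] * h) = lf.ep (e # as) * (vx v * lf.gp bs)"
      by (simp only: \<phi>_mult[OF e] h(3) lf.ep_simps mult.assoc)
    ultimately show ?case by blast
  qed
  then obtain h where h: "h \<in> W" "pure n h" "\<phi> h = b"
    unfolding b(1,5) by (auto simp: mult.assoc)
  have "pure n (scal c h)" using pure_left[OF h(2), of 0 c] by simp
  then have "scal c h + g \<in> W \<and> pure n (scal c h + g)"
    using W_add[OF W_scal[OF h(1)] g(1)] pure_add g(2) by blast
  moreover have "\<phi> (scal c h + g) = scalar_endo c * b + x"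
    by (simp only: \<phi>_add \<phi>_scal h(3) g(3))
  ultimately show ?case by blast
qed

lemma image_W: "\<phi> ` W = lf.S"
proof
  have words: "\<phi> (word w) \<in> lf.S" if "w \<noteq> []" "set w \<subseteq> lpa_gens E" for w
    using that
  proof (induction w rule: list_nonempty_induct)
    case (single x)
    then show ?case by (cases x) (simp_all add: lf.vx_S lf.ed_S lf.gh_S)
  next
    case (cons x w)
    then have "\<phi> (word [x]) \<in> lf.S" by (cases x) (simp_all add: lf.vx_S lf.ed_S lf.gh_S)
    then have "\<phi> (word [x]) * \<phi> (word w) \<in> lf.S" using cons by (intro lf.S_mult) simp_all
    then show ?case using \<phi>_word_mult[of "[x]" w] cons.prems by simp
  qed
  show "\<phi> ` W \<subseteq> lf.S"
  proof clarify
    fix f assume "f \<in> W"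
    then show "\<phi> f \<in> lf.S"
    proof (induction rule: W_induct)
      case (add w c f)
      have "Poly_Mapping.single w c = scal c (word w)" by (simp add: mult_single)
      then have "\<phi> (Poly_Mapping.single w c + f) = scalar_endo c * \<phi> (word w) + \<phi> f"
        by (simp only: \<phi>_add \<phi>_scal)
      then show ?case using lf.S_add[OF lf.S_scale[OF words[OF add(1,2)]] add(4)] by (simp only:)
    qed (simp add: \<phi>_0)
  qed
  show "lf.S \<subseteq> \<phi> ` W"
  proof
    fix x assume "x \<in> lf.S"
    then show "x \<in> \<phi> ` W"
    proof (induction rule: lf.S_induct)
      case zero
      show ?case using W_0 \<phi>_0 by (metis imageI)
    next
      case (add n b x)
      obtain f where "f \<in> W" "\<phi> f = b" using image_homog[OF add(1)] by blast
      moreover obtain g where "g \<in> W" "x = \<phi> g" using add(3) by blast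
      ultimately show ?case using W_add[of f g] \<phi>_add[of f g] by (metis imageI)
    qed
  qed
qed

text \<open>The choice of the preimage does not matter, since \<open>N\<close> contains the
  components of its elements.\<close>

definition hc :: "int \<Rightarrow> (('v, 'e) lpa_gen, 'k) endo \<Rightarrow> (('v, 'e) lpa_gen, 'k) endo" where
  "hc n x = \<phi> (component n (SOME f. f \<in> W \<and> \<phi> f = x))"

lemma hc_\<phi>: assumes f: "f \<in> W" shows "hc n (\<phi> f) = \<phi> (component n f)"
proof -
  define g where "g = (SOME g. g \<in> W \<and> \<phi> g = \<phi> f)"
  have g: "g \<in> W" "\<phi> g = \<phi> f"
    using someI[of "\<lambda>g. g \<in> W \<and> \<phi> g = \<phi> f" f] f unfolding g_def by blast+
  then have "g - f \<in> N" using \<phi>_eq_iff f by blast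
  then have "component n g - component n f \<in> N" using N_component[of "g - f" n] by (simp only: component_diff)
  then have "\<phi> (component n g) = \<phi> (component n f)" using \<phi>_eq_iff W_component f g(1) by blast
  then show ?thesis by (simp only: hc_def g_def)
qed

sublocale graded_leavitt_family "verts E" "arcs E" "tail E" "head E" scalar_endo vx ed gh hc
proof
  show "hc n (x + y) = hc n x + hc n y" if xy: "x \<in> lf.S" "y \<in> lf.S" for x y n
  proof -
    obtain f g where fg: "f \<in> W" "g \<in> W" "x = \<phi> f" "y = \<phi> g" using xy unfolding image_W[symmetric] by blast
    have "hc n (\<phi> (f + g)) = \<phi> (component n f + component n g)"
      by (simp only: hc_\<phi>[OF W_add[OF fg(1,2)]] component_add)
    then show ?thesis using fg by (simp only: \<phi>_add hc_\<phi>)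
  qed
  show "hc n x = (if n = m then x else 0)" if "x \<in> lf.homog m" for x m n
  proof -
    obtain f where "f \<in> W" "pure m f" "\<phi> f = x" using image_homog[OF \<open>x \<in> lf.homog m\<close>] by blast
    then show ?thesis using hc_\<phi>[of f n] by (auto simp: pure_def \<phi>_0)
  qed
qed

sublocale leavitt_embedding "verts E" "arcs E" "tail E" "head E" scalar_endo vx ed gh hc
  "quotient_algebra (free_algebra (lpa_gens E)) N" \<Phi>
proof (intro leavitt_embedding.intro leavitt_embedding_axioms.intro)
  show "graded_leavitt_family (verts E) (arcs E) (tail E) (head E) scalar_endo vx ed gh hc"
    by unfold_locales
  show "\<Phi> ` carrier (quotient_algebra (free_algebra (lpa_gens E)) N) = lf.S"
    using image_\<Phi> image_W by simp
qed (rule nonunital_ring_L \<Phi>_add_L \<Phi>_mult_L inj_\<Phi>; assumption)+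

end

theorem corollary3p4:
  fixes E :: "('v, 'e) pre_digraph"
    and L :: "('k::field, (('v, 'e) lpa_gen list \<Rightarrow>\<^sub>0 'k) set) module"
    and I :: "(('v, 'e) lpa_gen list \<Rightarrow>\<^sub>0 'k) set set"
    and Ps Qs :: "(('v, 'e) lpa_gen list \<Rightarrow>\<^sub>0 'k) set set list"
  assumes "wf_digraph E" and "verts E \<noteq> {}"
    and "L = leavitt_path_algebra E"
    and "two_sided_ideal L I"
    and "Ps \<noteq> []" and "\<forall>P\<in>set Ps. prime_two_sided_ideal L P"
    and "irredundant_product L Ps" and "I = ideal_list_prod L Ps"
    and "Qs \<noteq> []" and "\<forall>Q\<in>set Qs. prime_two_sided_ideal L Q"
    and "irredundant_product L Qs" and "I = ideal_list_prod L Qs"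
  shows "length Ps = length Qs \<and>
    (\<exists>\<sigma>. \<sigma> permutes {..<length Ps} \<and> (\<forall>i<length Ps. Ps ! i = Qs ! \<sigma> i))"
proof -
  interpret leavitt_presentation E
    "generated_algebra_ideal (free_algebra (lpa_gens E)) (lpa_relations E) :: (('v, 'e) lpa_gen, 'k) words set"
    by (rule leavitt_presentation.intro) (rule assms(1), rule refl)
  have L: "L = quotient_algebra (free_algebra (lpa_gens E))
      (generated_algebra_ideal (free_algebra (lpa_gens E)) (lpa_relations E))"
    unfolding assms(3) leavitt_path_algebra_def presented_algebra_def ..
  have "mset Ps = mset Qs"
    by (rule irredundant_prime_products_unique[folded L, OF assms(5-7,9-11)])
       (use assms(8,12) in \<open>simp only:\<close>)
  then obtain \<sigma> where \<sigma>: "\<sigma> permutes {..<length Qs}" "permute_list \<sigma> Qs = Ps"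
    by (rule mset_eq_permutation)
  have len: "length Ps = length Qs" using mset_eq_length[OF \<open>mset Ps = mset Qs\<close>] .
  have "Ps ! i = Qs ! \<sigma> i" if "i < length Ps" for i
    using permute_list_nth[OF \<sigma>(1), of i] \<sigma>(2) that len by simp
  then show ?thesis using \<sigma>(1) len by auto
qed

end
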